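(* Let $V$ be a complex Banach space and let $T(V)$ be the tensor algebra over $V$. Then $\mathcal{HC}^n(T(V))=0$ for every odd $n$, and $\mathcal{HC}^n(T(V))\cong\mathbb C$ for every even $n>0$.
   Context: Tensor algebra: $T(V)=\ell^1\text{-}\bigoplus_{k=0}^\infty\hat\bigotimes^kV$, the $\ell^1$-direct sum of the completed projective tensor powers of $V$ with their usual norms, where $\hat\bigotimes^0V:=\mathbb C$ (its elements are written $\lambda\mathbf 1$, and $\mathbf 1$ is the unit). The product is the linear extension of the isometric isomorphisms $\hat\bigotimes^kV\,\hat\otimes\,\hat\bigotimes^lV\to\hat\bigotimes^{k+l}V$ given by concatenation $(v_1\otimes\cdots\otimes v_k)\otimes(w_1\otimes\cdots\otimes w_l)\mapsto v_1\otimes\cdots\otimes v_k\otimes w_1\otimes\cdots\otimes w_l$. Cohomology: for a Banach algebra $\mathcal A$ and $n\ge0$, $\mathcal C_n(\mathcal A,\mathcal A)=\mathcal A^{\hat\otimes(n+1)}$ is the $(n+1)$-fold completed projective tensor product, and $d^n:\mathcal C_{n+1}(\mathcal A,\mathcal A)\to\mathcal C_n(\mathcal A,\mathcal A)$ is the bounded linear map with $$d^n(a_1\otimes\cdots\otimes a_{n+2})=a_2\otimes\cdots\otimes a_{n+1}\otimes a_{n+2}a_1+\sum_{j=1}^{n+1}(-1)^j a_1\otimes\cdots\otimes a_ja_{j+1}\otimes\cdots\otimes a_{n+2}.$$ The space of $n$-cochains $\mathcal C^n(\mathcal A,\mathcal A')$ is the dual of $\mathcal C_n(\mathcal A,\mathcal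 A)$ (equivalently, bounded $n$-linear maps $T:\mathcal A^n\to\mathcal A'$ via $T(a_1\otimes\cdots\otimes a_{n+1})=T(a_1,\dots,a_n)(a_{n+1})$), with $\mathcal C^n=0$ for $n<0$, and $\delta^n:\mathcal C^n\to\mathcal C^{n+1}$ is the adjoint of $d^n$. Let $\mathbf t(a_1\otimes\cdots\otimes a_{n+1})=(-1)^n a_{n+1}\otimes a_1\otimes\cdots\otimes a_n$. A cochain $T\in\mathcal C^n(\mathcal A,\mathcal A')$ is cyclic if $T(\mathbf t x)=T(x)$ for all $x\in\mathcal C_n(\mathcal A,\mathcal A)$. The cyclic cochains $\mathcal{CC}^n(\mathcal A)$ form a subcomplex, with cocycles $\mathcal{ZC}^n(\mathcal A)$, coboundaries $\mathcal{BC}^n(\mathcal A)=\delta^{n-1}\mathcal{CC}^{n-1}(\mathcal A)$ and cohomology $\mathcal{HC}^n(\mathcal A)=\mathcal{ZC}^n(\mathcal A)/\mathcal{BC}^n(\mathcal A)$, the cyclic cohomology of $\mathcal A$. *)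

theory Defs
  imports "HOL-Analysis.Analysis" "HOL-Library.Poly_Mapping"
begin

text \<open>This notation would make \<open>\<Sum>k. f k\<close> ambiguous with infinite series.\<close>

no_syntax
  "_Sum_any" :: "pttrn \<Rightarrow> 'a \<Rightarrow> 'a :: comm_monoid_add"
    (\<open>(\<open>indent=2 notation=\<open>binder \<Sum>\<close>\<close>\<Sum>_. _)\<close> [0, 10] 10)

section \<open>Complex Banach spaces and Banach algebras\<close>

class complex_banach = banach +
  fixes scaleC :: "complex \<Rightarrow> 'a \<Rightarrow> 'a"  (infixr \<open>*\<^sub>C\<close> 75)
  assumes scaleC_add_right: "c *\<^sub>C (x + y) = c *\<^sub>C x + c *\<^sub>C y"
    and scaleC_add_left: "(c + d) *\<^sub>C x = c *\<^sub>C x + d *\<^sub>C x"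
    and scaleC_scaleC: "c *\<^sub>C d *\<^sub>C x = (c * d) *\<^sub>C x"
    and scaleR_scaleC: "r *\<^sub>R x = complex_of_real r *\<^sub>C x"
    and norm_scaleC: "norm (c *\<^sub>C x) = cmod c * norm x"

class complex_banach_algebra = complex_banach + real_normed_algebra +
  assumes mult_scaleC_left: "(c *\<^sub>C x) * y = c *\<^sub>C (x * y)"
    and mult_scaleC_right: "x * (c *\<^sub>C y) = c *\<^sub>C (x * y)"

instantiation complex :: complex_banach_algebra
begin
definition scaleC_complex :: "complex \<Rightarrow> complex \<Rightarrow> complex" where
  "scaleC_complex c x = c * x"
instance
  by standard (simp_all add: scaleC_complex_def algebra_simps norm_mult scaleR_conv_of_real)
end

lemma scaleC_one [simp]: "(1 :: complex) *\<^sub>C (x :: 'a :: complex_banach) = x"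
  using scaleR_scaleC[of 1 x] by simp

global_interpretation complex_vector: vector_space "scaleC :: complex \<Rightarrow> 'a \<Rightarrow> 'a :: complex_banach"
  by standard (simp_all add: scaleC_add_right scaleC_add_left scaleC_scaleC)

lemma bounded_linear_scaleC: "bounded_linear ((*\<^sub>C) c :: 'a \<Rightarrow> 'a :: complex_banach)"
proof (rule bounded_linear_intro[where K = "cmod c"])
  fix r and x :: 'a
  show "c *\<^sub>C r *\<^sub>R x = r *\<^sub>R c *\<^sub>C x"
    by (simp add: scaleR_scaleC scaleC_scaleC mult.commute)
qed (simp_all add: scaleC_add_right norm_scaleC mult.commute)

definition bounded_clinear :: "('a :: complex_banach \<Rightarrow> 'b :: complex_banach) \<Rightarrow> bool" where
  "bounded_clinear f \<longleftrightarrow> bounded_linear f \<and> (\<forall>c x. f (c *\<^sub>C x) = c *\<^sub>C f x)"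

lemma bounded_clinearI:
  assumes "\<And>x y. f (x + y) = f x + f y" "\<And>c x. f (c *\<^sub>C x) = c *\<^sub>C f x"
    "\<And>x. norm (f x) \<le> K * norm x"
  shows "bounded_clinear f"
  unfolding bounded_clinear_def using assms
  by (auto intro!: bounded_linear_intro[where K = K] simp: scaleR_scaleC mult.commute)


section \<open>Completed projective tensor powers\<close>

text \<open>
  A formal sum of words stands for a combination of elementary tensors: the word
  \<open>[v\<^sub>1, \<dots>, v\<^sub>k]\<close> stands for \<open>v\<^sub>1 \<otimes> \<dots> \<otimes> v\<^sub>k\<close>, and the empty word for the unit of
  the zeroth power.  Modulo \<open>tensor_relations\<close> the formal sums are the algebraic direct sum
  of all algebraic tensor powers; \<open>proj_norm\<close> is the projective norm
  \<open>inf (\<Sum>\<^sub>i \<bar>c\<^sub>i\<bar> \<parallel>v\<^sub>1\<^sup>i\<parallel> \<dots> \<parallel>v\<^sub>k\<^sup>i\<parallel>)\<close> over all representations of the given tensor.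
\<close>

type_synonym 'v formal = "'v list \<Rightarrow>\<^sub>0 complex"

definition fscale :: "complex \<Rightarrow> 'v formal \<Rightarrow> 'v formal" where
  "fscale c x = Poly_Mapping.map ((*) c) x"

lemma lookup_fscale [simp]: "Poly_Mapping.lookup (fscale c x) w = c * Poly_Mapping.lookup x w"
  by (simp add: fscale_def map.rep_eq when_def)

global_interpretation formal: vector_space "fscale :: complex \<Rightarrow> 'v formal \<Rightarrow> 'v formal"
  by standard (auto intro!: poly_mapping_eqI simp: lookup_add algebra_simps)

definition tensor_relations :: "'v :: complex_banach formal set" where
  "tensor_relations = formal.span
     ({Poly_Mapping.single (us @ (a + b) # ws) 1 - Poly_Mapping.single (us @ a # ws) 1
         - Poly_Mapping.single (us @ b # ws) 1 | us ws a b. True}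
      \<union> {Poly_Mapping.single (us @ (c *\<^sub>C a) # ws) 1 - fscale c (Poly_Mapping.single (us @ a # ws) 1)
         | us ws a c. True})"

definition word_norm :: "'v :: complex_banach list \<Rightarrow> real" where
  "word_norm w = prod_list (map norm w)"

definition formal_norm :: "'v :: complex_banach formal \<Rightarrow> real" where
  "formal_norm x = (\<Sum>w\<in>Poly_Mapping.keys x. cmod (Poly_Mapping.lookup x w) * word_norm w)"

definition proj_norm :: "'v :: complex_banach formal \<Rightarrow> real" where
  "proj_norm x = Inf (formal_norm ` {y. y - x \<in> tensor_relations})"

lemma word_norm_nonneg [simp]: "word_norm w \<ge> 0"
  unfolding word_norm_def by (induction w) auto

lemma word_norm_simps [simp]:
  "word_norm [] = 1" "word_norm (a # w) = norm a * word_norm w"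
  "word_norm (v @ w) = word_norm v * word_norm w"
  by (simp_all add: word_norm_def)

lemma formal_norm_superset:
  assumes "finite A" "Poly_Mapping.keys x \<subseteq> A"
  shows "formal_norm x = (\<Sum>w\<in>A. cmod (Poly_Mapping.lookup x w) * word_norm w)"
  unfolding formal_norm_def using assms by (intro sum.mono_neutral_left) (auto simp: in_keys_iff)

lemma formal_norm_nonneg [simp]: "formal_norm x \<ge> 0"
  unfolding formal_norm_def by (intro sum_nonneg) auto

lemma formal_norm_add: "formal_norm (x + y) \<le> formal_norm x + formal_norm y"
proof -
  let ?A = "Poly_Mapping.keys x \<union> Poly_Mapping.keys y"
  have "formal_norm (x + y) = (\<Sum>w\<in>?A. cmod (Poly_Mapping.lookup (x + y) w) * word_norm w)"
    by (intro formal_norm_superset keys_add) auto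
  also have "\<dots> \<le> (\<Sum>w\<in>?A. cmod (Poly_Mapping.lookup x w) * word_norm w + cmod (Poly_Mapping.lookup y w) * word_norm w)"
    by (intro sum_mono) (auto simp: lookup_add norm_triangle_ineq mult_right_mono simp flip: distrib_right)
  also have "\<dots> = formal_norm x + formal_norm y"
    by (simp add: sum.distrib formal_norm_superset[of ?A])
  finally show ?thesis .
qed

lemma formal_norm_scale: "formal_norm (fscale c x) = cmod c * formal_norm x"
  by (subst formal_norm_superset[of "Poly_Mapping.keys x"])
     (auto simp: formal_norm_def sum_distrib_left norm_mult mult_ac in_keys_iff)

lemma formal_norm_zero [simp]: "formal_norm 0 = 0"
  by (simp add: formal_norm_def)

lemma fscale_minus: "fscale (- 1) x = - x"
  by (intro poly_mapping_eqI) simp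

lemma bdd_below_formal_norm [simp]: "bdd_below (formal_norm ` A)"
  by (rule bdd_belowI[of _ 0]) auto

lemma proj_norm_le: "y - x \<in> tensor_relations \<Longrightarrow> proj_norm x \<le> formal_norm y"
  unfolding proj_norm_def by (intro cINF_lower) auto

lemma relations_zero [simp]: "0 \<in> tensor_relations"
  unfolding tensor_relations_def by (rule formal.span_zero)

lemma proj_norm_le_formal_norm: "proj_norm x \<le> formal_norm x"
  by (rule proj_norm_le) simp

lemma proj_norm_greatest:
  "(\<And>y. y - x \<in> tensor_relations \<Longrightarrow> K \<le> formal_norm y) \<Longrightarrow> K \<le> proj_norm x"
  unfolding proj_norm_def by (rule cINF_greatest) (auto intro: exI[of _ x])

lemma proj_norm_nonneg [simp]: "proj_norm x \<ge> 0"
  by (rule proj_norm_greatest) simp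

lemma proj_norm_zero [simp]: "proj_norm 0 = 0"
  using proj_norm_le_formal_norm[of 0] by (intro antisym) simp_all

lemma proj_norm_less:
  assumes "proj_norm x < e"
  obtains y where "y - x \<in> tensor_relations" "formal_norm y < e"
  using assms proj_norm_greatest[of x e] by force

lemma proj_norm_add: "proj_norm (x + y) \<le> proj_norm x + proj_norm y"
proof (rule field_le_epsilon)
  fix e :: real assume e: "e > 0"
  obtain x' where x': "x' - x \<in> tensor_relations" "formal_norm x' < proj_norm x + e/2"
    using proj_norm_less[of x "proj_norm x + e/2"] e by auto
  obtain y' where y': "y' - y \<in> tensor_relations" "formal_norm y' < proj_norm y + e/2"
    using proj_norm_less[of y "proj_norm y + e/2"] e by auto
  have "(x' + y') - (x + y) = (x' - x) + (y' - y)"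
    by (rule add_diff_add)
  then have "(x' + y') - (x + y) \<in> tensor_relations"
    using formal.span_add[OF x'(1)[unfolded tensor_relations_def] y'(1)[unfolded tensor_relations_def]]
    unfolding tensor_relations_def by (rule ssubst)
  then have "proj_norm (x + y) \<le> formal_norm (x' + y')"
    by (rule proj_norm_le)
  with formal_norm_add[of x' y'] x' y' show "proj_norm (x + y) \<le> proj_norm x + proj_norm y + e"
    by linarith
qed

lemma proj_norm_scale_le: "proj_norm (fscale c x) \<le> cmod c * proj_norm x"
proof (cases "c = 0")
  case True
  then show ?thesis
    by simp
next
  case False
  have "proj_norm (fscale c x) / cmod c \<le> proj_norm x"
  proof (rule proj_norm_greatest)
    fix y assume "y - x \<in> tensor_relations"
    then have "fscale c (y - x) \<in> tensor_relations"
      unfolding tensor_relations_def by (rule formal.span_scale)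
    then have "fscale c y - fscale c x \<in> tensor_relations"
      by (simp add: formal.scale_right_diff_distrib)
    then have "proj_norm (fscale c x) \<le> cmod c * formal_norm y"
      using proj_norm_le formal_norm_scale by metis
    then show "proj_norm (fscale c x) / cmod c \<le> formal_norm y"
      using False by (simp add: field_simps)
  qed
  then show ?thesis
    using False by (simp add: field_simps)
qed

lemma proj_norm_scale: "proj_norm (fscale c x) = cmod c * proj_norm x"
proof (cases "c = 0")
  case True
  then show ?thesis
    by simp
next
  case False
  have "proj_norm (fscale (inverse c) (fscale c x)) \<le> inverse (cmod c) * proj_norm (fscale c x)"
    using proj_norm_scale_le[of "inverse c" "fscale c x"] by (simp only: norm_inverse)
  moreover have "fscale (inverse c) (fscale c x) = x"
    using False by simp
  ultimately have "cmod c * proj_norm x \<le> cmod c * (inverse (cmod c) * proj_norm (fscale c x))"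
    by (intro mult_left_mono) auto
  then have "cmod c * proj_norm x \<le> proj_norm (fscale c x)"
    using False by (simp flip: mult.assoc)
  then show ?thesis
    using proj_norm_scale_le[of c x] by simp
qed

lemma proj_norm_uminus [simp]: "proj_norm (- x) = proj_norm x"
  using proj_norm_scale[of "-1" x] by (simp add: fscale_minus)

lemma proj_norm_minus_commute: "proj_norm (x - y) = proj_norm (y - x)"
  using proj_norm_uminus[of "x - y"] by simp

lemma proj_norm_diff3: "proj_norm (x - z) \<le> proj_norm (x - y) + proj_norm (y - z)"
  using proj_norm_add[of "x - y" "y - z"] by simp

lemma proj_norm_diff_abs: "\<bar>proj_norm x - proj_norm y\<bar> \<le> proj_norm (x - y)"
  using proj_norm_add[of "x - y" y] proj_norm_add[of "y - x" x] proj_norm_minus_commute[of x y]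
  by simp

subsection \<open>Completion\<close>

definition proj_Cauchy :: "(nat \<Rightarrow> 'v :: complex_banach formal) \<Rightarrow> bool" where
  "proj_Cauchy x \<longleftrightarrow> (\<forall>e>0. \<exists>N. \<forall>m\<ge>N. \<forall>n\<ge>N. proj_norm (x m - x n) < e)"

definition tensor_rel :: "(nat \<Rightarrow> 'v :: complex_banach formal) \<Rightarrow> (nat \<Rightarrow> 'v formal) \<Rightarrow> bool" where
  "tensor_rel x y \<longleftrightarrow>
     proj_Cauchy x \<and> proj_Cauchy y \<and> (\<lambda>n. proj_norm (x n - y n)) \<longlonglongrightarrow> 0"

lemma proj_Cauchy_const [simp]: "proj_Cauchy (\<lambda>_. x)"
  unfolding proj_Cauchy_def by auto

lemma proj_Cauchy_add:
  assumes "proj_Cauchy x" "proj_Cauchy y"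
  shows "proj_Cauchy (\<lambda>n. x n + y n)"
  unfolding proj_Cauchy_def
proof (intro allI impI)
  fix e :: real assume "e > 0"
  then obtain M N where M: "\<forall>m\<ge>M. \<forall>n\<ge>M. proj_norm (x m - x n) < e/2"
    and N: "\<forall>m\<ge>N. \<forall>n\<ge>N. proj_norm (y m - y n) < e/2"
    using assms unfolding proj_Cauchy_def by (meson half_gt_zero)
  show "\<exists>N. \<forall>m\<ge>N. \<forall>n\<ge>N. proj_norm (x m + y m - (x n + y n)) < e"
  proof (intro exI[of _ "max M N"] allI impI)
    fix m n assume mn: "m \<ge> max M N" "n \<ge> max M N"
    have "proj_norm (x m + y m - (x n + y n)) \<le> proj_norm (x m - x n) + proj_norm (y m - y n)"
      using proj_norm_add[of "x m - x n" "y m - y n"] by (simp add: algebra_simps)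
    moreover have "proj_norm (x m - x n) < e/2" "proj_norm (y m - y n) < e/2"
      using mn M N by auto
    ultimately show "proj_norm (x m + y m - (x n + y n)) < e"
      by linarith
  qed
qed

lemma proj_Cauchy_scale:
  assumes "proj_Cauchy x"
  shows "proj_Cauchy (\<lambda>n. fscale c (x n))"
  unfolding proj_Cauchy_def
proof (intro allI impI)
  fix e :: real assume e: "e > 0"
  then have "e / (cmod c + 1) > 0"
    by (simp add: add_nonneg_pos)
  then obtain N where N: "\<forall>m\<ge>N. \<forall>n\<ge>N. proj_norm (x m - x n) < e / (cmod c + 1)"
    using assms unfolding proj_Cauchy_def by meson
  show "\<exists>N. \<forall>m\<ge>N. \<forall>n\<ge>N. proj_norm (fscale c (x m) - fscale c (x n)) < e"
  proof (intro exI[of _ N] allI impI)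
    fix m n assume mn: "m \<ge> N" "n \<ge> N"
    have "proj_norm (fscale c (x m) - fscale c (x n)) = cmod c * proj_norm (x m - x n)"
      by (simp add: proj_norm_scale flip: formal.scale_right_diff_distrib)
    also have "\<dots> \<le> (cmod c + 1) * proj_norm (x m - x n)"
      by (intro mult_right_mono) auto
    also have "\<dots> < e"
      using N mn by (simp add: pos_less_divide_eq add_nonneg_pos mult.commute)
    finally show "proj_norm (fscale c (x m) - fscale c (x n)) < e" .
  qed
qed

lemma proj_Cauchy_uminus: "proj_Cauchy x \<Longrightarrow> proj_Cauchy (\<lambda>n. - x n)"
  using proj_Cauchy_scale[of x "-1"] by (simp add: fscale_minus)

lemma proj_Cauchy_diff: "proj_Cauchy x \<Longrightarrow> proj_Cauchy y \<Longrightarrow> proj_Cauchy (\<lambda>n. x n - y n)"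
  using proj_Cauchy_add[of x "\<lambda>n. - y n"] proj_Cauchy_uminus[of y] by simp

lemma proj_Cauchy_convergent:
  assumes "proj_Cauchy x"
  shows "convergent (\<lambda>n. proj_norm (x n))"
proof (rule Cauchy_convergent, rule metric_CauchyI)
  fix e :: real assume "e > 0"
  then obtain N where N: "\<forall>m\<ge>N. \<forall>n\<ge>N. proj_norm (x m - x n) < e"
    using assms unfolding proj_Cauchy_def by meson
  show "\<exists>M. \<forall>m\<ge>M. \<forall>n\<ge>M. dist (proj_norm (x m)) (proj_norm (x n)) < e"
    using N proj_norm_diff_abs le_less_trans unfolding dist_real_def by meson
qed

lemma tensor_rel_refl: "proj_Cauchy x \<Longrightarrow> tensor_rel x x"
  by (simp add: tensor_rel_def)

lemma tensor_relI:
  assumes "proj_Cauchy x" "proj_Cauchy y" "f \<longlonglongrightarrow> 0" "\<And>n. proj_norm (x n - y n) \<le> f n"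
  shows "tensor_rel x y"
  unfolding tensor_rel_def using assms
  by (auto intro!: tendsto_sandwich[OF _ _ tendsto_const assms(3)])

lemma part_equivp_tensor_rel:
  "part_equivp (tensor_rel :: (nat \<Rightarrow> 'v :: complex_banach formal) \<Rightarrow> _)"
proof (rule part_equivpI)
  show "\<exists>x :: nat \<Rightarrow> 'v formal. tensor_rel x x"
    using tensor_rel_refl proj_Cauchy_const by metis
  show "symp (tensor_rel :: (nat \<Rightarrow> 'v formal) \<Rightarrow> _)"
    by (intro sympI) (auto simp: tensor_rel_def proj_norm_minus_commute)
  show "transp (tensor_rel :: (nat \<Rightarrow> 'v formal) \<Rightarrow> _)"
  proof (rule transpI)
    fix x y z :: "nat \<Rightarrow> 'v formal" assume *: "tensor_rel x y" "tensor_rel y z"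
    then have "(\<lambda>n. proj_norm (x n - y n) + proj_norm (y n - z n)) \<longlonglongrightarrow> 0 + 0"
      unfolding tensor_rel_def by (intro tendsto_add) auto
    then have lim: "(\<lambda>n. proj_norm (x n - y n) + proj_norm (y n - z n)) \<longlonglongrightarrow> 0"
      by simp
    show "tensor_rel x z"
      by (rule tensor_relI[OF _ _ lim proj_norm_diff3]) (use * in \<open>simp_all add: tensor_rel_def\<close>)
  qed
qed

text \<open>Completion and passage to the quotient modulo the relations are done in one step.\<close>

quotient_type (overloaded) 'v ptensor =
  "nat \<Rightarrow> 'v :: complex_banach formal" / partial: tensor_rel
  by (rule part_equivp_tensor_rel)

lemma tensor_relD:
  assumes "tensor_rel x y"
  shows "proj_Cauchy x" "proj_Cauchy y" "(\<lambda>n. proj_norm (x n - y n)) \<longlonglongrightarrow> 0"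
  using assms unfolding tensor_rel_def by blast+

lemma proj_norm_LIMSEQ:
  "proj_Cauchy x \<Longrightarrow> (\<lambda>n. proj_norm (x n)) \<longlonglongrightarrow> lim (\<lambda>n. proj_norm (x n))"
  using proj_Cauchy_convergent convergent_LIMSEQ_iff by blast

lemma tensor_rel_norm:
  assumes "tensor_rel x y"
  shows "lim (\<lambda>n. proj_norm (x n)) = lim (\<lambda>n. proj_norm (y n))"
proof -
  note x = proj_norm_LIMSEQ[OF tensor_relD(1)[OF assms]]
  note y = proj_norm_LIMSEQ[OF tensor_relD(2)[OF assms]]
  have "(\<lambda>n. proj_norm (x n) - proj_norm (y n)) \<longlonglongrightarrow> 0"
    by (rule Lim_null_comparison[OF _ tensor_relD(3)[OF assms]])
       (simp add: proj_norm_diff_abs)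
  from LIMSEQ_unique[OF tendsto_diff[OF x y] this] show ?thesis
    by simp
qed

instantiation ptensor :: (complex_banach) real_normed_vector
begin

lift_definition zero_ptensor :: "'a ptensor" is "\<lambda>_. 0"
  by (simp add: tensor_rel_refl)

lift_definition plus_ptensor :: "'a ptensor \<Rightarrow> 'a ptensor \<Rightarrow> 'a ptensor" is "\<lambda>x y n. x n + y n"
proof -
  fix x x' y y' :: "nat \<Rightarrow> 'a formal"
  assume *: "tensor_rel x x'" "tensor_rel y y'"
  then have "(\<lambda>n. proj_norm (x n - x' n) + proj_norm (y n - y' n)) \<longlonglongrightarrow> 0 + 0"
    unfolding tensor_rel_def by (intro tendsto_add) auto
  moreover have "proj_norm (x n + y n - (x' n + y' n)) \<le> proj_norm (x n - x' n) + proj_norm (y n - y' n)" for n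
    using proj_norm_add[of "x n - x' n" "y n - y' n"] by (simp add: algebra_simps)
  ultimately show "tensor_rel (\<lambda>n. x n + y n) (\<lambda>n. x' n + y' n)"
    using * by (intro tensor_relI) (auto simp: tensor_rel_def intro!: proj_Cauchy_add)
qed

lift_definition uminus_ptensor :: "'a ptensor \<Rightarrow> 'a ptensor" is "\<lambda>x n. - x n"
proof -
  fix x y :: "nat \<Rightarrow> 'a formal"
  assume *: "tensor_rel x y"
  have "proj_norm (- x n - - y n) = proj_norm (x n - y n)" for n
    using proj_norm_uminus[of "x n - y n"] by simp
  with * show "tensor_rel (\<lambda>n. - x n) (\<lambda>n. - y n)"
    by (auto simp: tensor_rel_def proj_Cauchy_uminus simp del: minus_diff_eq)
qed

lift_definition minus_ptensor :: "'a ptensor \<Rightarrow> 'a ptensor \<Rightarrow> 'a ptensor" is "\<lambda>x y n. x n - y n"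
proof -
  fix x x' y y' :: "nat \<Rightarrow> 'a formal"
  assume *: "tensor_rel x x'" "tensor_rel y y'"
  then have "(\<lambda>n. proj_norm (x n - x' n) + proj_norm (y n - y' n)) \<longlonglongrightarrow> 0 + 0"
    unfolding tensor_rel_def by (intro tendsto_add) auto
  moreover have "proj_norm (x n - y n - (x' n - y' n)) \<le> proj_norm (x n - x' n) + proj_norm (y n - y' n)" for n
    using proj_norm_add[of "x n - x' n" "y' n - y n"]
    by (simp add: algebra_simps proj_norm_minus_commute)
  ultimately show "tensor_rel (\<lambda>n. x n - y n) (\<lambda>n. x' n - y' n)"
    using * by (intro tensor_relI) (auto simp: tensor_rel_def intro!: proj_Cauchy_diff)
qed

lift_definition ptensor_scale :: "complex \<Rightarrow> 'a ptensor \<Rightarrow> 'a ptensor" is "\<lambda>c x n. fscale c (x n)"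
proof -
  fix c and x y :: "nat \<Rightarrow> 'a formal"
  assume *: "tensor_rel x y"
  then have "(\<lambda>n. cmod c * proj_norm (x n - y n)) \<longlonglongrightarrow> cmod c * 0"
    unfolding tensor_rel_def by (intro tendsto_mult tendsto_const) auto
  with * show "tensor_rel (\<lambda>n. fscale c (x n)) (\<lambda>n. fscale c (y n))"
    by (auto simp: tensor_rel_def proj_Cauchy_scale proj_norm_scale
             simp flip: formal.scale_right_diff_distrib)
qed

lift_definition norm_ptensor :: "'a ptensor \<Rightarrow> real" is "\<lambda>x. lim (\<lambda>n. proj_norm (x n))"
  by (rule tensor_rel_norm)

definition scaleR_ptensor :: "real \<Rightarrow> 'a ptensor \<Rightarrow> 'a ptensor" where
  "scaleR_ptensor r = ptensor_scale (of_real r)"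

definition dist_ptensor :: "'a ptensor \<Rightarrow> 'a ptensor \<Rightarrow> real" where
  "dist_ptensor x y = norm (x - y)"

definition sgn_ptensor :: "'a ptensor \<Rightarrow> 'a ptensor" where
  "sgn_ptensor x = inverse (norm x) *\<^sub>R x"

definition uniformity_ptensor :: "('a ptensor \<times> 'a ptensor) filter" where
  "uniformity_ptensor = (INF e\<in>{0<..}. principal {(x, y). dist x y < e})"

definition open_ptensor :: "'a ptensor set \<Rightarrow> bool" where
  "open_ptensor U \<longleftrightarrow> (\<forall>x\<in>U. \<forall>\<^sub>F (x', y) in uniformity. x' = x \<longrightarrow> y \<in> U)"

lemma norm_ptensor_lim:
  "proj_Cauchy x \<Longrightarrow> (\<lambda>n. proj_norm (x n)) \<longlonglongrightarrow> norm (abs_ptensor x)"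
  using proj_Cauchy_convergent
  by (auto simp: norm_ptensor.abs_eq tensor_rel_refl convergent_LIMSEQ_iff)

lemma abs_ptensor_ops:
  assumes "proj_Cauchy x" "proj_Cauchy y"
  shows "abs_ptensor x + abs_ptensor y = abs_ptensor (\<lambda>n. x n + y n)"
    "abs_ptensor x - abs_ptensor y = abs_ptensor (\<lambda>n. x n - y n)"
    "ptensor_scale c (abs_ptensor x) = abs_ptensor (\<lambda>n. fscale c (x n))"
  using assms
  by (simp_all add: plus_ptensor.abs_eq minus_ptensor.abs_eq ptensor_scale.abs_eq tensor_rel_refl)

lemma ptensor_exhaust:
  obtains x where "proj_Cauchy x" "u = abs_ptensor x"
  using ptensor.abs_induct[of "\<lambda>u. \<exists>x. proj_Cauchy x \<and> u = abs_ptensor x" u]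
  by (auto simp: tensor_rel_def)

lemma norm_ptensor_scale: "norm (ptensor_scale c (u :: 'a ptensor)) = cmod c * norm u"
proof (cases u rule: ptensor_exhaust)
  case (1 x)
  then have "(\<lambda>n. cmod c * proj_norm (x n)) \<longlonglongrightarrow> cmod c * norm u"
    by (intro tendsto_mult tendsto_const) (auto simp: norm_ptensor_lim)
  moreover have "(\<lambda>n. proj_norm (fscale c (x n))) \<longlonglongrightarrow> norm (ptensor_scale c u)"
    using 1 by (auto simp: abs_ptensor_ops intro!: norm_ptensor_lim proj_Cauchy_scale)
  ultimately show ?thesis
    by (simp add: proj_norm_scale LIMSEQ_unique)
qed

lemma ptensor_scale_simps:
  fixes u v :: "'a ptensor"
  shows "ptensor_scale c (u + v) = ptensor_scale c u + ptensor_scale c v"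
    "ptensor_scale (c + d) u = ptensor_scale c u + ptensor_scale d u"
    "ptensor_scale c (ptensor_scale d u) = ptensor_scale (c * d) u"
    "ptensor_scale 1 u = u"
  by (cases u rule: ptensor_exhaust; cases v rule: ptensor_exhaust;
      simp add: abs_ptensor_ops proj_Cauchy_add proj_Cauchy_scale formal.scale_right_distrib
        formal.scale_left_distrib)+

lemma zero_ptensor_abs: "(0 :: 'a ptensor) = abs_ptensor (\<lambda>_. 0)"
  by (simp add: zero_ptensor_def)

instance
proof
  fix a b c :: "'a ptensor" and r s :: real
  obtain x where x: "proj_Cauchy x" "a = abs_ptensor x" by (rule ptensor_exhaust)
  obtain y where y: "proj_Cauchy y" "b = abs_ptensor y" by (rule ptensor_exhaust)
  obtain z where z: "proj_Cauchy z" "c = abs_ptensor z" by (rule ptensor_exhaust)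
  note xyz = x y z
  show "a + b + c = a + (b + c)"
    using xyz by (simp add: abs_ptensor_ops proj_Cauchy_add add.assoc)
  show "a + b = b + a"
    using xyz by (simp add: abs_ptensor_ops add.commute)
  show "0 + a = a"
    using xyz by (simp add: zero_ptensor_abs abs_ptensor_ops)
  have um: "- a = abs_ptensor (\<lambda>n. - x n)" "- b = abs_ptensor (\<lambda>n. - y n)"
    using x y by (simp_all add: uminus_ptensor.abs_eq tensor_rel_refl)
  show "- a + a = 0"
    using um(1) x by (simp add: zero_ptensor_abs abs_ptensor_ops proj_Cauchy_uminus)
  show "a - b = a + - b"
    using um(2) x y by (simp add: abs_ptensor_ops proj_Cauchy_uminus)
  show "r *\<^sub>R (a + b) = r *\<^sub>R a + r *\<^sub>R b" "(r + s) *\<^sub>R a = r *\<^sub>R a + s *\<^sub>R a"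
    "r *\<^sub>R s *\<^sub>R a = (r * s) *\<^sub>R a" "1 *\<^sub>R a = a"
    by (simp_all add: scaleR_ptensor_def ptensor_scale_simps)
  show "dist a b = norm (a - b)" "sgn a = inverse (norm a) *\<^sub>R a"
    by (simp_all add: dist_ptensor_def sgn_ptensor_def)
  show "uniformity = (INF e\<in>{0<..}. principal {(x, y :: 'a ptensor). dist x y < e})"
    by (rule uniformity_ptensor_def)
  show "open U \<longleftrightarrow> (\<forall>x\<in>U. \<forall>\<^sub>F (x', y) in uniformity. x' = x \<longrightarrow> y \<in> U)" for U :: "'a ptensor set"
    by (rule open_ptensor_def)
  show "norm (r *\<^sub>R a) = \<bar>r\<bar> * norm a"
    by (simp add: scaleR_ptensor_def norm_ptensor_scale)
  show "norm (a + b) \<le> norm a + norm b"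
  proof (rule LIMSEQ_le)
    show "(\<lambda>n. proj_norm (x n + y n)) \<longlonglongrightarrow> norm (a + b)"
      using x y by (simp add: abs_ptensor_ops norm_ptensor_lim proj_Cauchy_add)
    show "(\<lambda>n. proj_norm (x n) + proj_norm (y n)) \<longlonglongrightarrow> norm a + norm b"
      using x y by (intro tendsto_add) (simp_all add: norm_ptensor_lim)
  qed (auto intro: proj_norm_add)
  show "(norm a = 0) = (a = 0)"
  proof
    assume "norm a = 0"
    then have "tensor_rel x (\<lambda>_. 0)"
      using x norm_ptensor_lim[of x] by (simp add: tensor_rel_def)
    then show "a = 0"
      using Quotient3_ptensor Quotient3_rel_abs x unfolding zero_ptensor_abs by metis
  next
    assume "a = 0"
    then show "norm a = 0"
      using norm_ptensor_lim[of "\<lambda>_. 0"] by (simp add: zero_ptensor_abs LIMSEQ_const_iff)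
  qed
qed

end

definition tensor :: "'v :: complex_banach list \<Rightarrow> 'v ptensor" where
  "tensor w = abs_ptensor (\<lambda>_. Poly_Mapping.single w 1)"

lemma ptensor_approx:
  assumes "e > 0"
  obtains x where "dist u (abs_ptensor (\<lambda>_. x)) < e"
proof (cases u rule: ptensor_exhaust)
  case (1 x)
  obtain N where N: "\<forall>m\<ge>N. \<forall>n\<ge>N. proj_norm (x m - x n) < e / 2"
    using 1 assms unfolding proj_Cauchy_def by (meson half_gt_zero)
  have "(\<lambda>n. proj_norm (x n - x N)) \<longlonglongrightarrow> norm (u - abs_ptensor (\<lambda>_. x N))"
    using 1 by (simp add: abs_ptensor_ops norm_ptensor_lim proj_Cauchy_diff)
  moreover have "\<forall>n\<ge>N. proj_norm (x n - x N) \<le> e / 2"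
    using N by (simp add: less_imp_le)
  ultimately have "norm (u - abs_ptensor (\<lambda>_. x N)) \<le> e / 2"
    using LIMSEQ_le_const2 by blast
  with assms show ?thesis
    by (intro that[of "x N"]) (simp add: dist_norm)
qed

lemma norm_abs_const: "norm (abs_ptensor (\<lambda>_. x)) = proj_norm x"
  using norm_ptensor_lim[of "\<lambda>_. x"] by (simp add: LIMSEQ_const_iff)

lemma abs_const_tendsto:
  assumes "proj_Cauchy x"
  shows "(\<lambda>n. abs_ptensor (\<lambda>_. x n)) \<longlonglongrightarrow> abs_ptensor x"
proof (rule metric_LIMSEQ_I)
  fix e :: real assume e: "e > 0"
  then obtain N where N: "\<forall>m\<ge>N. \<forall>n\<ge>N. proj_norm (x m - x n) < e / 2"
    using assms unfolding proj_Cauchy_def by (meson half_gt_zero)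
  have "dist (abs_ptensor (\<lambda>_. x n)) (abs_ptensor x) < e" if n: "n \<ge> N" for n
  proof -
    have "(\<lambda>m. proj_norm (x n - x m)) \<longlonglongrightarrow> norm (abs_ptensor (\<lambda>_. x n) - abs_ptensor x)"
      using assms norm_ptensor_lim[of "\<lambda>m. x n - x m"] by (simp add: abs_ptensor_ops proj_Cauchy_diff)
    moreover have "\<forall>m\<ge>N. proj_norm (x n - x m) \<le> e / 2"
      using N n by (simp add: less_imp_le)
    ultimately have "norm (abs_ptensor (\<lambda>_. x n) - abs_ptensor x) \<le> e / 2"
      using LIMSEQ_le_const2 by blast
    with e show ?thesis by (simp add: dist_norm)
  qed
  then show "\<exists>N. \<forall>n\<ge>N. dist (abs_ptensor (\<lambda>_. x n)) (abs_ptensor x) < e"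
    by blast
qed

instantiation ptensor :: (complex_banach) complex_banach
begin

definition scaleC_ptensor :: "complex \<Rightarrow> 'a ptensor \<Rightarrow> 'a ptensor" where
  "scaleC_ptensor = ptensor_scale"

instance
proof
  fix X :: "nat \<Rightarrow> 'a ptensor" assume X: "Cauchy X"
  have "\<exists>y. dist (X n) (abs_ptensor (\<lambda>_. y)) < inverse (Suc n)" for n
    by (rule ptensor_approx[of "inverse (Suc n)" "X n"]) auto
  then obtain y where y: "\<And>n. dist (X n) (abs_ptensor (\<lambda>_. y n)) < inverse (Suc n)"
    by metis
  define Y where "Y n = abs_ptensor (\<lambda>_. y n)" for n
  have "(\<lambda>n. X n - Y n) \<longlonglongrightarrow> 0"
    using y by (intro Lim_null_comparison[OF _ LIMSEQ_inverse_real_of_nat])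
      (auto simp: Y_def dist_norm less_imp_le)
  have "Cauchy Y"
  proof (rule metric_CauchyI)
    fix e :: real assume "e > 0"
    then have e: "e / 3 > 0" by simp
    obtain M where M: "\<And>n. n \<ge> M \<Longrightarrow> dist (X n) (Y n) < e / 3"
      using LIMSEQ_D[OF \<open>(\<lambda>n. X n - Y n) \<longlonglongrightarrow> 0\<close> e] by (auto simp: dist_norm)
    obtain N where N: "\<And>m n. m \<ge> N \<Longrightarrow> n \<ge> N \<Longrightarrow> dist (X m) (X n) < e / 3"
      using metric_CauchyD[OF X e] by blast
    have "dist (Y m) (Y n) < e" if "m \<ge> max M N" "n \<ge> max M N" for m n
      using dist_triangle[of "Y m" "Y n" "X m"] dist_triangle[of "X m" "Y n" "X n"]
        M[of m] M[of n] N[of m n] that by (simp add: dist_commute)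
    then show "\<exists>M. \<forall>m\<ge>M. \<forall>n\<ge>M. dist (Y m) (Y n) < e"
      by blast
  qed
  then have "proj_Cauchy y"
    unfolding proj_Cauchy_def Cauchy_def
    by (simp add: Y_def dist_norm abs_ptensor_ops norm_abs_const)
  then have "Y \<longlonglongrightarrow> abs_ptensor y"
    unfolding Y_def by (rule abs_const_tendsto)
  then have "(\<lambda>n. (X n - Y n) + Y n) \<longlonglongrightarrow> 0 + abs_ptensor y"
    using \<open>(\<lambda>n. X n - Y n) \<longlonglongrightarrow> 0\<close> by (intro tendsto_add)
  then show "convergent X"
    by (auto simp: convergent_def)
qed (simp_all add: scaleC_ptensor_def scaleR_ptensor_def ptensor_scale_simps norm_ptensor_scale)

end

subsection \<open>The universal property\<close>

text \<open>
  A function on words is treated as one function of \<open>k\<close> variables for every \<open>k\<close>; boundedness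
  is uniform in \<open>k\<close>.  A single \<open>k\<close>-linear map is the case in which \<open>f w = 0\<close> unless
  \<open>length w = k\<close>.
\<close>

definition multilinear :: "('v :: complex_banach list \<Rightarrow> 'w :: complex_banach) \<Rightarrow> bool" where
  "multilinear f \<longleftrightarrow>
     (\<forall>us ws a b. f (us @ (a + b) # ws) = f (us @ a # ws) + f (us @ b # ws)) \<and>
     (\<forall>us ws a c. f (us @ (c *\<^sub>C a) # ws) = c *\<^sub>C f (us @ a # ws))"

definition bounded_multilinear :: "('v :: complex_banach list \<Rightarrow> 'w :: complex_banach) \<Rightarrow> bool" where
  "bounded_multilinear f \<longleftrightarrow> multilinear f \<and> (\<exists>K. \<forall>w. norm (f w) \<le> K * word_norm w)"

definition formal_lift :: "('v list \<Rightarrow> 'w :: complex_banach) \<Rightarrow> 'v formal \<Rightarrow> 'w" where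
  "formal_lift f x = (\<Sum>w\<in>Poly_Mapping.keys x. Poly_Mapping.lookup x w *\<^sub>C f w)"

definition tensor_lift :: "('v :: complex_banach list \<Rightarrow> 'w :: complex_banach) \<Rightarrow> 'v ptensor \<Rightarrow> 'w" where
  "tensor_lift f u = lim (\<lambda>n. formal_lift f (rep_ptensor u n))"

lemma formal_lift_superset:
  assumes "finite A" "Poly_Mapping.keys x \<subseteq> A"
  shows "formal_lift f x = (\<Sum>w\<in>A. Poly_Mapping.lookup x w *\<^sub>C f w)"
  unfolding formal_lift_def using assms by (intro sum.mono_neutral_left) (auto simp: in_keys_iff)

lemma formal_lift_add: "formal_lift f (x + y) = formal_lift f x + formal_lift f y"
proof -
  let ?A = "Poly_Mapping.keys x \<union> Poly_Mapping.keys y"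
  have "formal_lift f (x + y) = (\<Sum>w\<in>?A. Poly_Mapping.lookup (x + y) w *\<^sub>C f w)"
    by (intro formal_lift_superset keys_add) auto
  also have "\<dots> = formal_lift f x + formal_lift f y"
    by (simp add: lookup_add scaleC_add_left sum.distrib formal_lift_superset[of ?A])
  finally show ?thesis .
qed

lemma formal_lift_scale: "formal_lift f (fscale c x) = c *\<^sub>C formal_lift f x"
  by (subst formal_lift_superset[of "Poly_Mapping.keys x"])
     (auto simp: formal_lift_def complex_vector.scale_sum_right scaleC_scaleC in_keys_iff)

lemma formal_lift_minus: "formal_lift f (x - y) = formal_lift f x - formal_lift f y"
  using formal_lift_add[of f "x - y" y] by simp

lemma formal_lift_single [simp]: "formal_lift f (Poly_Mapping.single w c) = c *\<^sub>C f w"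
  by (subst formal_lift_superset[of "{w}"]) auto

lemma formal_lift_relations:
  assumes "multilinear f" "x \<in> tensor_relations"
  shows "formal_lift f x = 0"
proof -
  have "formal.subspace {x. formal_lift f x = 0}"
    by (rule formal.subspaceI)
       (simp_all add: formal_lift_add formal_lift_scale, simp add: formal_lift_def)
  moreover note assms(1)
  ultimately have "tensor_relations \<subseteq> {x. formal_lift f x = 0}"
    unfolding tensor_relations_def multilinear_def
    by (intro formal.span_minimal) (auto simp: formal_lift_minus formal_lift_scale)
  with assms(2) show ?thesis by auto
qed

lemma formal_lift_bound:
  assumes "multilinear f" "\<And>w. norm (f w) \<le> K * word_norm w"
  shows "norm (formal_lift f x) \<le> K * proj_norm x"
proof -
  have K: "K \<ge> 0"
    using order_trans[OF norm_ge_zero assms(2)[of "[]"]] by simp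
  have fn: "norm (formal_lift f y) \<le> K * formal_norm y" for y
  proof -
    have "norm (formal_lift f y) \<le> (\<Sum>w\<in>Poly_Mapping.keys y. cmod (Poly_Mapping.lookup y w) * (K * word_norm w))"
      unfolding formal_lift_def
      by (intro sum_norm_le) (auto simp: norm_scaleC intro!: mult_left_mono assms(2))
    then show ?thesis
      by (simp add: formal_norm_def sum_distrib_left mult_ac)
  qed
  show ?thesis
  proof (cases "K = 0")
    case True
    then show ?thesis using fn[of x] by simp
  next
    case False
    then have "norm (formal_lift f x) / K \<le> formal_norm y" if "y - x \<in> tensor_relations" for y
      using fn[of y] formal_lift_relations[OF assms(1) that] K
      by (simp add: formal_lift_minus field_simps)
    then have "norm (formal_lift f x) / K \<le> proj_norm x"
      by (rule proj_norm_greatest)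
    then show ?thesis
      using False K by (simp add: field_simps)
  qed
qed

lemma tensor_lift_abs:
  assumes f: "bounded_multilinear f" and x: "proj_Cauchy x"
  shows "(\<lambda>n. formal_lift f (x n)) \<longlonglongrightarrow> tensor_lift f (abs_ptensor x)"
proof -
  obtain K where K: "\<And>w. norm (f w) \<le> K * word_norm w" and ml: "multilinear f"
    using f unfolding bounded_multilinear_def by blast
  have K0: "K \<ge> 0"
    using order_trans[OF norm_ge_zero K[of "[]"]] by simp
  define y where "y = rep_ptensor (abs_ptensor x)"
  have xy: "tensor_rel y x"
    unfolding y_def using Quotient3_ptensor tensor_rel_refl[OF x] by (metis rep_abs_rsp_left)
  then have y: "proj_Cauchy y"
    by (rule tensor_relD)
  have "Cauchy (\<lambda>n. formal_lift f (y n))"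
    unfolding Cauchy_def
  proof (intro allI impI)
    fix e :: real assume e: "e > 0"
    then obtain N where N: "\<forall>m\<ge>N. \<forall>n\<ge>N. proj_norm (y m - y n) < e / (K + 1)"
      using y K0 unfolding proj_Cauchy_def by (meson add_nonneg_pos divide_pos_pos zero_less_one)
    have "dist (formal_lift f (y m)) (formal_lift f (y n)) < e" if "m \<ge> N" "n \<ge> N" for m n
    proof -
      have "dist (formal_lift f (y m)) (formal_lift f (y n)) \<le> K * proj_norm (y m - y n)"
        using formal_lift_bound[OF ml K, of "y m - y n"] by (simp add: dist_norm formal_lift_minus)
      also have "\<dots> \<le> (K + 1) * proj_norm (y m - y n)"
        by (intro mult_right_mono) auto
      also have "\<dots> < e"
        using N that K0 by (simp add: pos_less_divide_eq mult.commute)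
      finally show ?thesis .
    qed
    then show "\<exists>M. \<forall>m\<ge>M. \<forall>n\<ge>M. dist (formal_lift f (y m)) (formal_lift f (y n)) < e"
      by blast
  qed
  then have lim: "(\<lambda>n. formal_lift f (y n)) \<longlonglongrightarrow> tensor_lift f (abs_ptensor x)"
    by (simp add: tensor_lift_def y_def Cauchy_convergent_iff convergent_LIMSEQ_iff)
  have null: "(\<lambda>n. K * proj_norm (y n - x n)) \<longlonglongrightarrow> 0"
    using tendsto_mult[OF tendsto_const[of K] tensor_relD(3)[OF xy]] by simp
  have "(\<lambda>n. formal_lift f (y n) - formal_lift f (x n)) \<longlonglongrightarrow> 0"
    by (rule Lim_null_comparison[OF _ null])
       (simp add: formal_lift_bound[OF ml K] flip: formal_lift_minus)
  from tendsto_diff[OF lim this] show ?thesis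
    by simp
qed

lemma tensor_lift_tensor:
  assumes "bounded_multilinear f"
  shows "tensor_lift f (tensor w) = f w"
  using tensor_lift_abs[OF assms, of "\<lambda>_. Poly_Mapping.single w 1"]
  by (simp add: tensor_def LIMSEQ_const_iff)

lemma tensor_lift_bound:
  assumes "multilinear f" "\<And>w. norm (f w) \<le> K * word_norm w"
  shows "norm (tensor_lift f u) \<le> K * norm u"
proof (cases u rule: ptensor_exhaust)
  case (1 x)
  have "bounded_multilinear f"
    using assms unfolding bounded_multilinear_def by blast
  then have "(\<lambda>n. norm (formal_lift f (x n))) \<longlonglongrightarrow> norm (tensor_lift f u)"
    using 1 by (intro tendsto_norm) (auto intro: tensor_lift_abs)
  moreover have "(\<lambda>n. K * proj_norm (x n)) \<longlonglongrightarrow> K * norm u"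
    using 1 by (intro tendsto_mult tendsto_const) (auto intro: norm_ptensor_lim)
  ultimately show ?thesis
    by (rule LIMSEQ_le) (auto intro: formal_lift_bound[OF assms])
qed

lemma abs_ptensor_scaleC:
  "proj_Cauchy x \<Longrightarrow> c *\<^sub>C abs_ptensor x = abs_ptensor (\<lambda>n. fscale c (x n))"
  by (simp add: scaleC_ptensor_def abs_ptensor_ops)

lemma bounded_clinear_tensor_lift:
  fixes f :: "'v :: complex_banach list \<Rightarrow> 'w :: complex_banach"
  assumes f: "bounded_multilinear f"
  shows "bounded_clinear (tensor_lift f)"
proof -
  obtain K where K: "\<And>w. norm (f w) \<le> K * word_norm w" and ml: "multilinear f"
    using f unfolding bounded_multilinear_def by blast
  show ?thesis
  proof (rule bounded_clinearI[where K = K])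
    show "norm (tensor_lift f u) \<le> K * norm u" for u
      using ml K by (rule tensor_lift_bound)
    fix u v :: "'v ptensor" and c :: complex
    obtain x where x: "proj_Cauchy x" "u = abs_ptensor x" by (rule ptensor_exhaust)
    obtain y where y: "proj_Cauchy y" "v = abs_ptensor y" by (rule ptensor_exhaust)
    have "(\<lambda>n. formal_lift f (x n + y n)) \<longlonglongrightarrow> tensor_lift f (u + v)"
      using x y tensor_lift_abs[OF f proj_Cauchy_add[OF x(1) y(1)]] by (simp add: abs_ptensor_ops)
    moreover have "(\<lambda>n. formal_lift f (x n) + formal_lift f (y n)) \<longlonglongrightarrow> tensor_lift f u + tensor_lift f v"
      using x y by (intro tendsto_add) (auto intro: tensor_lift_abs[OF f])
    ultimately show "tensor_lift f (u + v) = tensor_lift f u + tensor_lift f v"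
      by (simp add: formal_lift_add LIMSEQ_unique)
    have "(\<lambda>n. formal_lift f (fscale c (x n))) \<longlonglongrightarrow> tensor_lift f (c *\<^sub>C u)"
      using x tensor_lift_abs[OF f proj_Cauchy_scale[OF x(1)]] by (simp add: abs_ptensor_scaleC)
    moreover have "(\<lambda>n. c *\<^sub>C formal_lift f (x n)) \<longlonglongrightarrow> c *\<^sub>C tensor_lift f u"
      using x by (intro bounded_linear.tendsto[OF bounded_linear_scaleC]) (auto intro: tensor_lift_abs[OF f])
    ultimately show "tensor_lift f (c *\<^sub>C u) = c *\<^sub>C tensor_lift f u"
      by (simp add: formal_lift_scale LIMSEQ_unique)
  qed
qed

lemma abs_ptensor_relation:
  assumes "x - y \<in> tensor_relations"
  shows "abs_ptensor (\<lambda>_. x) = abs_ptensor (\<lambda>_. y)"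
proof -
  have "- (x - y) \<in> tensor_relations"
    using assms unfolding tensor_relations_def by (rule formal.span_neg)
  then have "proj_norm (x - y) \<le> 0"
    using proj_norm_le[of 0 "x - y"] by simp
  then have "norm (abs_ptensor (\<lambda>_. x) - abs_ptensor (\<lambda>_. y)) = 0"
    by (simp add: abs_ptensor_ops norm_abs_const order.antisym)
  then show ?thesis by simp
qed

lemma norm_tensor_le: "norm (tensor w) \<le> word_norm w"
proof -
  have "formal_norm (Poly_Mapping.single w (1 :: complex)) = word_norm w"
    by (simp add: formal_norm_def)
  then show ?thesis
    unfolding tensor_def norm_abs_const using proj_norm_le_formal_norm by metis
qed

lemma tensor_add: "tensor (us @ (a + b) # ws) = tensor (us @ a # ws) + tensor (us @ b # ws)"
proof -
  have "Poly_Mapping.single (us @ (a + b) # ws) 1 - Poly_Mapping.single (us @ a # ws) 1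
      - Poly_Mapping.single (us @ b # ws) 1 \<in> tensor_relations"
    unfolding tensor_relations_def by (rule formal.span_base) blast
  then show ?thesis
    unfolding tensor_def abs_ptensor_ops(1)[OF proj_Cauchy_const proj_Cauchy_const]
    by (intro abs_ptensor_relation) (simp only: diff_diff_eq)
qed

lemma tensor_scaleC: "tensor (us @ (c *\<^sub>C a) # ws) = c *\<^sub>C tensor (us @ a # ws)"
proof -
  have "Poly_Mapping.single (us @ (c *\<^sub>C a) # ws) 1
      - fscale c (Poly_Mapping.single (us @ a # ws) 1) \<in> tensor_relations"
    unfolding tensor_relations_def by (rule formal.span_base) blast
  then show ?thesis
    unfolding tensor_def abs_ptensor_scaleC[OF proj_Cauchy_const]
    by (rule abs_ptensor_relation)
qed

lemma bounded_multilinear_tensor: "bounded_multilinear tensor"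
  unfolding bounded_multilinear_def multilinear_def
  by (auto simp: tensor_add tensor_scaleC norm_tensor_le intro!: exI[of _ 1])

lemma closure_subspace_complex:
  fixes S :: "'a :: complex_banach set"
  assumes "complex_vector.subspace S"
  shows "complex_vector.subspace (closure S)"
proof (rule complex_vector.subspaceI)
  show "0 \<in> closure S"
    using assms closure_subset complex_vector.subspace_0 by blast
  fix x y c assume "x \<in> closure S" "y \<in> closure S"
  then obtain X Y where X: "\<And>n. X n \<in> S" "X \<longlonglongrightarrow> x" and Y: "\<And>n. Y n \<in> S" "Y \<longlonglongrightarrow> y"
    unfolding closure_sequential by blast
  show "x + y \<in> closure S"
    unfolding closure_sequential using X Y assms
    by (intro exI[of _ "\<lambda>n. X n + Y n"]) (auto intro: tendsto_add complex_vector.subspace_add)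
  show "c *\<^sub>C x \<in> closure S"
    unfolding closure_sequential using X assms
    by (intro exI[of _ "\<lambda>n. c *\<^sub>C X n"])
       (auto intro: bounded_linear.tendsto[OF bounded_linear_scaleC] complex_vector.subspace_scale)
qed

text \<open>
  The norm on the whole space is the \<open>\<ell>\<^sup>1\<close>-sum of the norms of its homogeneous parts: the relations
  are homogeneous, so dropping the words of length other than \<open>k\<close> from a representation of a
  tensor of degree \<open>k\<close> leaves a representation of it.  Hence the closed span of the words of length
  \<open>k\<close>, with the induced norm, is the completed projective tensor power, the infimum being taken
  over representations by words of length \<open>k\<close>.
\<close>

definition tensor_power :: "nat \<Rightarrow> 'v :: complex_banach ptensor set" where
  "tensor_power k = closure (complex_vector.span (tensor ` {w. length w = k}))"

lemma tensor_power_subspace: "complex_vector.subspace (tensor_power k)"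
  unfolding tensor_power_def by (intro closure_subspace_complex) simp

lemma closed_tensor_power [simp]: "closed (tensor_power k)"
  unfolding tensor_power_def by simp

lemma tensor_in_tensor_power: "length w = k \<Longrightarrow> tensor w \<in> tensor_power k"
  unfolding tensor_power_def
  by (auto intro!: closure_subset[THEN subsetD] complex_vector.span_base)

lemma bounded_clinearD:
  assumes "bounded_clinear f"
  shows "bounded_linear f" "f (x + y) = f x + f y" "f (x - y) = f x - f y" "f 0 = 0"
    "f (c *\<^sub>C x) = c *\<^sub>C f x" "f (sum h A) = (\<Sum>a\<in>A. f (h a))"
proof -
  interpret bounded_linear f
    using assms by (simp add: bounded_clinear_def)
  show "bounded_linear f" "f (x + y) = f x + f y" "f (x - y) = f x - f y" "f 0 = 0"
     "f (sum h A) = (\<Sum>a\<in>A. f (h a))"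
    by (rule bounded_linear_axioms add diff zero sum)+
  show "f (c *\<^sub>C x) = c *\<^sub>C f x"
    using assms by (simp add: bounded_clinear_def)
qed

lemma bounded_clinear_vimage_closure:
  assumes F: "bounded_clinear F" and S: "complex_vector.subspace S" "closed S"
    and A: "\<And>x. x \<in> A \<Longrightarrow> F x \<in> S" and x: "x \<in> closure (complex_vector.span A)"
  shows "F x \<in> S"
proof -
  have cl: "closed (F -` S)"
    using S(2) bounded_clinearD(1)[OF F]
    by (intro closed_vimage) (auto intro: linear_continuous_on)
  have "complex_vector.subspace (F -` S)"
    using S(1) by (auto intro!: complex_vector.subspaceI simp: bounded_clinearD[OF F]
      complex_vector.subspace_0 complex_vector.subspace_add complex_vector.subspace_scale)
  then have "complex_vector.span A \<subseteq> F -` S"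
    using A by (intro complex_vector.span_minimal) auto
  then have "closure (complex_vector.span A) \<subseteq> F -` S"
    using cl by (rule closure_minimal)
  with x show ?thesis by auto
qed

lemma bounded_clinear_maps_tensor_power:
  assumes "bounded_clinear F" "complex_vector.subspace S" "closed S"
    and "\<And>w. length w = k \<Longrightarrow> F (tensor w) \<in> S" and "x \<in> tensor_power k"
  shows "F x \<in> S"
  by (rule bounded_clinear_vimage_closure[OF assms(1-3) _ assms(5)[unfolded tensor_power_def]])
     (use assms(4) in blast)

lemma bounded_clinear_diff:
  assumes "bounded_clinear F" "bounded_clinear G"
  shows "bounded_clinear (\<lambda>x. F x - G x)"
  using assms unfolding bounded_clinear_def
  by (auto intro: bounded_linear_sub simp: complex_vector.scale_right_diff_distrib)

lemma tensor_power_eqI: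
  assumes "bounded_clinear F" "bounded_clinear G"
    and "\<And>w. length w = k \<Longrightarrow> F (tensor w) = G (tensor w)" and "x \<in> tensor_power k"
  shows "F x = G x"
proof -
  have "F x - G x \<in> {0}"
    by (rule bounded_clinear_maps_tensor_power[OF bounded_clinear_diff[OF assms(1,2)] _ _ _ assms(4)])
       (simp_all add: assms(3))
  then show ?thesis by simp
qed

lemma abs_ptensor_formal_lift: "abs_ptensor (\<lambda>_. x) = formal_lift tensor x"
proof -
  have single: "abs_ptensor (\<lambda>_. Poly_Mapping.single w c) = c *\<^sub>C tensor w" for w :: "'a list" and c
  proof -
    have "Poly_Mapping.single w c = fscale c (Poly_Mapping.single w 1)"
      by (rule poly_mapping_eqI) (simp add: lookup_single when_def)
    then show ?thesis
      by (simp add: tensor_def abs_ptensor_scaleC)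
  qed
  have sum: "abs_ptensor (\<lambda>_. \<Sum>w\<in>A. f w) = (\<Sum>w\<in>A. abs_ptensor (\<lambda>_. f w))"
    if "finite A" for A :: "'a list set" and f
    using that
  proof induction
    case empty
    show ?case by (simp add: zero_ptensor_abs)
  next
    case (insert w A)
    then show ?case
      by (simp flip: abs_ptensor_ops(1)[OF proj_Cauchy_const proj_Cauchy_const])
  qed
  have "x = (\<Sum>w\<in>Poly_Mapping.keys x. Poly_Mapping.single w (Poly_Mapping.lookup x w))"
    by (rule poly_mapping_eqI) (auto simp: lookup_sum lookup_single when_def in_keys_iff)
  then have "abs_ptensor (\<lambda>_. x) =
      abs_ptensor (\<lambda>_. \<Sum>w\<in>Poly_Mapping.keys x. Poly_Mapping.single w (Poly_Mapping.lookup x w))"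
    by (rule arg_cong)
  then show ?thesis
    by (simp add: sum single formal_lift_def)
qed

lemma closure_span_tensor:
  "closure (complex_vector.span (range (tensor :: 'a :: complex_banach list \<Rightarrow> _))) = UNIV"
proof -
  have "formal_lift tensor x \<in> complex_vector.span (range tensor)" for x :: "'a formal"
    unfolding formal_lift_def
    by (intro complex_vector.span_sum complex_vector.span_scale complex_vector.span_base) auto
  moreover have "\<exists>x. dist (formal_lift tensor x) u < e" if e: "e > 0" for e and u :: "'a ptensor"
    by (rule ptensor_approx[OF e, of u]) (auto simp: abs_ptensor_formal_lift dist_commute)
  ultimately have "u \<in> closure (complex_vector.span (range tensor))" for u :: "'a ptensor"
    unfolding closure_approachable by blast
  then show ?thesis by blast
qed

lemma ptensor_eqI:
  assumes "bounded_clinear F" "bounded_clinear G" "\<And>w. F (tensor w) = G (tensor w)"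
  shows "F u = G u"
proof -
  have "F u - G u \<in> {0}"
    by (rule bounded_clinear_vimage_closure[OF bounded_clinear_diff[OF assms(1,2)], of _ "range tensor"])
       (auto simp: assms(3) closure_span_tensor)
  then show ?thesis by simp
qed

lemma norm_tensor_Nil [simp]: "norm (tensor [] :: 'v :: complex_banach ptensor) = 1"
proof -
  define f :: "'v list \<Rightarrow> complex" where "f w = (if w = [] then 1 else 0)" for w
  have f: "multilinear f" "\<And>w. norm (f w) \<le> 1 * word_norm w"
    by (auto simp: multilinear_def f_def)
  then have "bounded_multilinear f"
    unfolding bounded_multilinear_def by blast
  then have "norm (f []) \<le> 1 * norm (tensor [] :: 'v ptensor)"
    using tensor_lift_bound[OF f, of "tensor []"] by (simp add: tensor_lift_tensor)
  with norm_tensor_le[of "[] :: 'v list"] show ?thesis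
    by (simp add: f_def)
qed

subsection \<open>Concatenation\<close>

definition tensor_append :: "'v :: complex_banach ptensor \<Rightarrow> 'v ptensor \<Rightarrow> 'v ptensor" where
  "tensor_append u v = tensor_lift (\<lambda>xs. tensor_lift (\<lambda>ys. tensor (xs @ ys)) v) u"

lemma bounded_multilinear_append:
  "multilinear (\<lambda>ys. tensor (xs @ ys))" "norm (tensor (xs @ ys)) \<le> word_norm xs * word_norm ys"
  "bounded_multilinear (\<lambda>ys. tensor (xs @ ys))"
proof -
  show ml: "multilinear (\<lambda>ys. tensor (xs @ ys))"
    using tensor_add[of "xs @ _"] tensor_scaleC[of "xs @ _"] by (auto simp: multilinear_def)
  show bd: "norm (tensor (xs @ ys)) \<le> word_norm xs * word_norm ys" for ys
    using norm_tensor_le[of "xs @ ys"] by simp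
  show "bounded_multilinear (\<lambda>ys. tensor (xs @ ys))"
    using ml bd unfolding bounded_multilinear_def by blast
qed

lemma bounded_clinear_add:
  assumes "bounded_clinear F" "bounded_clinear G"
  shows "bounded_clinear (\<lambda>x. F x + G x)"
  using assms unfolding bounded_clinear_def
  by (auto intro: bounded_linear_add simp: scaleC_add_right)

lemma bounded_clinear_scaleC:
  assumes "bounded_clinear F"
  shows "bounded_clinear (\<lambda>x. c *\<^sub>C F x)"
  using assms bounded_linear_compose[OF bounded_linear_scaleC] unfolding bounded_clinear_def
  by (auto simp: scaleC_scaleC mult.commute)

lemma bounded_clinear_compose:
  assumes "bounded_clinear F" "bounded_clinear G"
  shows "bounded_clinear (\<lambda>x. F (G x))"
  using assms bounded_linear_compose[of F G] unfolding bounded_clinear_def by auto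

lemma append_aux:
  fixes v :: "'v :: complex_banach ptensor"
  defines "f \<equiv> (\<lambda>xs. tensor_lift (\<lambda>ys. tensor (xs @ ys)) v)"
  shows "multilinear f" "norm (f xs) \<le> norm v * word_norm xs" "bounded_multilinear f"
proof -
  note bcl = bounded_clinear_tensor_lift[OF bounded_multilinear_append(3)]
  note ten = tensor_lift_tensor[OF bounded_multilinear_append(3)]
  show ml: "multilinear f"
    unfolding multilinear_def
  proof (intro conjI allI)
    fix us ws :: "'v list" and a b c
    show "f (us @ (a + b) # ws) = f (us @ a # ws) + f (us @ b # ws)"
      unfolding f_def
      by (rule ptensor_eqI[OF bcl bounded_clinear_add[OF bcl bcl]])
         (simp only: ten, simp only: tensor_add append_assoc append_Cons)
    show "f (us @ (c *\<^sub>C a) # ws) = c *\<^sub>C f (us @ a # ws)"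
      unfolding f_def
      by (rule ptensor_eqI[OF bcl bounded_clinear_scaleC[OF bcl]])
         (simp only: ten, simp only: tensor_scaleC append_assoc append_Cons)
  qed
  show bd: "norm (f xs) \<le> norm v * word_norm xs" for xs
    using tensor_lift_bound[OF bounded_multilinear_append(1,2), of xs v]
    by (simp add: f_def mult.commute)
  show "bounded_multilinear f"
    using ml bd unfolding bounded_multilinear_def by blast
qed

lemma tensor_append_tensor_left:
  "tensor_append (tensor xs) v = tensor_lift (\<lambda>ys. tensor (xs @ ys)) v"
  unfolding tensor_append_def by (rule tensor_lift_tensor[OF append_aux(3)])

lemma tensor_append_tensor [simp]: "tensor_append (tensor xs) (tensor ys) = tensor (xs @ ys)"
  by (simp add: tensor_append_tensor_left tensor_lift_tensor[OF bounded_multilinear_append(3)])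

lemma tensor_append_norm: "norm (tensor_append u v) \<le> norm u * norm v"
  unfolding tensor_append_def using tensor_lift_bound[OF append_aux(1,2), of v u]
  by (simp add: mult.commute)

lemma bounded_clinear_tensor_append_left: "bounded_clinear (\<lambda>u. tensor_append u v)"
  unfolding tensor_append_def by (rule bounded_clinear_tensor_lift[OF append_aux(3)])

lemma tensor_append_add_right: "tensor_append u (v + v') = tensor_append u v + tensor_append u v'"
  by (rule ptensor_eqI[OF bounded_clinear_tensor_append_left
        bounded_clinear_add[OF bounded_clinear_tensor_append_left bounded_clinear_tensor_append_left]])
     (simp add: tensor_append_tensor_left bounded_clinearD[OF bounded_clinear_tensor_lift[OF bounded_multilinear_append(3)]])

lemma tensor_append_scaleC_right: "tensor_append u (c *\<^sub>C v) = c *\<^sub>C tensor_append u v"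
  by (rule ptensor_eqI[OF bounded_clinear_tensor_append_left
        bounded_clinear_scaleC[OF bounded_clinear_tensor_append_left]])
     (simp add: tensor_append_tensor_left bounded_clinearD[OF bounded_clinear_tensor_lift[OF bounded_multilinear_append(3)]])

lemma bounded_clinear_tensor_append_right: "bounded_clinear (\<lambda>v. tensor_append u v)"
  by (rule bounded_clinearI[where K = "norm u"])
     (simp_all add: tensor_append_add_right tensor_append_scaleC_right tensor_append_norm)

lemma tensor_append_assoc:
  "tensor_append (tensor_append u v) w = tensor_append u (tensor_append v w)"
proof (rule ptensor_eqI[where u = u])
  show "bounded_clinear (\<lambda>u. tensor_append (tensor_append u v) w)"
    by (rule bounded_clinear_compose) (rule bounded_clinear_tensor_append_left)+
  show "bounded_clinear (\<lambda>u. tensor_append u (tensor_append v w))"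
    by (rule bounded_clinear_tensor_append_left)
  fix xs
  show "tensor_append (tensor_append (tensor xs) v) w = tensor_append (tensor xs) (tensor_append v w)"
  proof (rule ptensor_eqI[where u = v])
    show "bounded_clinear (\<lambda>v. tensor_append (tensor_append (tensor xs) v) w)"
      by (rule bounded_clinear_compose[OF bounded_clinear_tensor_append_left bounded_clinear_tensor_append_right])
    show "bounded_clinear (\<lambda>v. tensor_append (tensor xs) (tensor_append v w))"
      by (rule bounded_clinear_compose[OF bounded_clinear_tensor_append_right bounded_clinear_tensor_append_left])
    fix ys
    show "tensor_append (tensor_append (tensor xs) (tensor ys)) w = tensor_append (tensor xs) (tensor_append (tensor ys) w)"
    proof (rule ptensor_eqI[where u = w])
      show "bounded_clinear (\<lambda>w. tensor_append (tensor_append (tensor xs) (tensor ys)) w)"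
        by (rule bounded_clinear_tensor_append_right)
      show "bounded_clinear (\<lambda>w. tensor_append (tensor xs) (tensor_append (tensor ys) w))"
        by (rule bounded_clinear_compose) (rule bounded_clinear_tensor_append_right)+
    qed simp
  qed
qed

lemma tensor_append_Nil_left [simp]: "tensor_append (tensor []) v = v"
  by (rule ptensor_eqI[where u = v, OF bounded_clinear_tensor_append_right])
     (auto intro: bounded_clinearI[where K = 1])

lemma tensor_append_Nil_right [simp]: "tensor_append u (tensor []) = u"
  by (rule ptensor_eqI[where u = u, OF bounded_clinear_tensor_append_left])
     (auto intro: bounded_clinearI[where K = 1])

lemma tensor_append_in_tensor_power:
  assumes "u \<in> tensor_power k" "v \<in> tensor_power l"
  shows "tensor_append u v \<in> tensor_power (k + l)"
proof (rule bounded_clinear_maps_tensor_power[OF bounded_clinear_tensor_append_left tensor_power_subspace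
      closed_tensor_power _ assms(1)])
  fix xs :: "'a list" assume xs: "length xs = k"
  show "tensor_append (tensor xs) v \<in> tensor_power (k + l)"
    by (rule bounded_clinear_maps_tensor_power[OF bounded_clinear_tensor_append_right tensor_power_subspace
      closed_tensor_power _ assms(2)]) (use xs in \<open>auto intro: tensor_in_tensor_power\<close>)
qed

section \<open>The tensor algebra\<close>

text \<open>The \<open>\<ell>\<^sup>1\<close>-direct sum of the completed projective tensor powers.\<close>

typedef (overloaded) 'v tensor_algebra =
  "{u :: nat \<Rightarrow> 'v :: complex_banach ptensor. (\<forall>k. u k \<in> tensor_power k) \<and> summable (\<lambda>k. norm (u k))}"
  morphisms component Abs_tensor_algebra
  by (rule exI[of _ "\<lambda>_. 0"]) (simp add: complex_vector.subspace_0 tensor_power_subspace)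

setup_lifting type_definition_tensor_algebra

lemma component_in [simp]: "component u k \<in> tensor_power k"
  using component[of u] by simp

lemma component_summable [simp]: "summable (\<lambda>k. norm (component u k))"
  using component[of u] by simp

lemma tensor_algebra_eqI: "(\<And>k. component u k = component v k) \<Longrightarrow> u = v"
  by (simp add: component_inject[symmetric] fun_eq_iff)

lemma summable_norm_add:
  fixes u v :: "nat \<Rightarrow> 'b :: real_normed_vector"
  assumes "summable (\<lambda>k. norm (u k))" "summable (\<lambda>k. norm (v k))"
  shows "summable (\<lambda>k. norm (u k + v k))"
  by (rule summable_comparison_test'[OF summable_add[OF assms], of 0]) (simp add: norm_triangle_ineq)

lemma tensor_power_scaleR: "x \<in> tensor_power k \<Longrightarrow> r *\<^sub>R x \<in> tensor_power k"
  by (simp add: scaleR_scaleC complex_vector.subspace_scale tensor_power_subspace)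

instantiation tensor_algebra :: (complex_banach) real_normed_vector
begin

lift_definition zero_tensor_algebra :: "'a tensor_algebra" is "\<lambda>_. 0"
  by (simp add: complex_vector.subspace_0 tensor_power_subspace)

lift_definition plus_tensor_algebra :: "'a tensor_algebra \<Rightarrow> 'a tensor_algebra \<Rightarrow> 'a tensor_algebra"
  is "\<lambda>u v k. u k + v k"
  by (simp add: complex_vector.subspace_add tensor_power_subspace summable_norm_add)

lift_definition uminus_tensor_algebra :: "'a tensor_algebra \<Rightarrow> 'a tensor_algebra" is "\<lambda>u k. - u k"
  by (simp add: complex_vector.subspace_neg tensor_power_subspace)

lift_definition minus_tensor_algebra :: "'a tensor_algebra \<Rightarrow> 'a tensor_algebra \<Rightarrow> 'a tensor_algebra"
  is "\<lambda>u v k. u k - v k"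
proof -
  fix u v :: "nat \<Rightarrow> 'a ptensor"
  assume "(\<forall>k. u k \<in> tensor_power k) \<and> summable (\<lambda>k. norm (u k))"
    "(\<forall>k. v k \<in> tensor_power k) \<and> summable (\<lambda>k. norm (v k))"
  then show "(\<forall>k. u k - v k \<in> tensor_power k) \<and> summable (\<lambda>k. norm (u k - v k))"
    using summable_norm_add[of u "\<lambda>k. - v k"]
    by (simp add: complex_vector.subspace_diff tensor_power_subspace)
qed

lift_definition scaleR_tensor_algebra :: "real \<Rightarrow> 'a tensor_algebra \<Rightarrow> 'a tensor_algebra"
  is "\<lambda>r u k. r *\<^sub>R u k"
  by (simp add: tensor_power_scaleR summable_mult)

definition norm_tensor_algebra :: "'a tensor_algebra \<Rightarrow> real" where
  "norm_tensor_algebra u = (\<Sum>k. norm (component u k))"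

definition dist_tensor_algebra :: "'a tensor_algebra \<Rightarrow> 'a tensor_algebra \<Rightarrow> real" where
  "dist_tensor_algebra u v = norm (u - v)"

definition sgn_tensor_algebra :: "'a tensor_algebra \<Rightarrow> 'a tensor_algebra" where
  "sgn_tensor_algebra u = inverse (norm u) *\<^sub>R u"

definition uniformity_tensor_algebra :: "('a tensor_algebra \<times> 'a tensor_algebra) filter" where
  "uniformity_tensor_algebra = (INF e\<in>{0<..}. principal {(u, v). dist u v < e})"

definition open_tensor_algebra :: "'a tensor_algebra set \<Rightarrow> bool" where
  "open_tensor_algebra U \<longleftrightarrow> (\<forall>u\<in>U. \<forall>\<^sub>F (u', v) in uniformity. u' = u \<longrightarrow> v \<in> U)"

lemma component_simps [simp]:
  "component (0 :: 'a tensor_algebra) k = 0"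
  "component (u + v) k = component u k + component v k"
  "component (- u) k = - component u k"
  "component (u - v) k = component u k - component v k"
  "component (r *\<^sub>R u) k = r *\<^sub>R component u k"
  by (simp_all add: zero_tensor_algebra.rep_eq plus_tensor_algebra.rep_eq uminus_tensor_algebra.rep_eq
      minus_tensor_algebra.rep_eq scaleR_tensor_algebra.rep_eq)

instance
proof
  fix a b c :: "'a tensor_algebra" and r s :: real
  show "a + b + c = a + (b + c)" "a + b = b + a" "0 + a = a" "- a + a = 0" "a - b = a + - b"
    "r *\<^sub>R (a + b) = r *\<^sub>R a + r *\<^sub>R b" "(r + s) *\<^sub>R a = r *\<^sub>R a + s *\<^sub>R a"
    "r *\<^sub>R s *\<^sub>R a = (r * s) *\<^sub>R a" "1 *\<^sub>R a = a"
    by (rule tensor_algebra_eqI, simp add: algebra_simps)+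
  show "dist a b = norm (a - b)" "sgn a = inverse (norm a) *\<^sub>R a"
    by (simp_all add: dist_tensor_algebra_def sgn_tensor_algebra_def)
  show "uniformity = (INF e\<in>{0<..}. principal {(u, v :: 'a tensor_algebra). dist u v < e})"
    by (rule uniformity_tensor_algebra_def)
  show "open U \<longleftrightarrow> (\<forall>u\<in>U. \<forall>\<^sub>F (u', v) in uniformity. u' = u \<longrightarrow> v \<in> U)" for U :: "'a tensor_algebra set"
    by (rule open_tensor_algebra_def)
  show "norm (r *\<^sub>R a) = \<bar>r\<bar> * norm a"
    by (simp add: norm_tensor_algebra_def suminf_mult)
  show "norm (a + b) \<le> norm a + norm b"
  proof -
    have "norm (a + b) \<le> (\<Sum>k. norm (component a k) + norm (component b k))"
      unfolding norm_tensor_algebra_def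
      by (rule suminf_le[OF _ component_summable summable_add[OF component_summable component_summable]])
         (simp add: norm_triangle_ineq)
    then show ?thesis
      by (simp add: norm_tensor_algebra_def suminf_add)
  qed
  show "(norm a = 0) = (a = 0)"
  proof
    assume "norm a = 0"
    then have "\<forall>k. norm (component a k) = 0"
      by (simp add: norm_tensor_algebra_def suminf_eq_zero_iff)
    then show "a = 0"
      by (intro tensor_algebra_eqI) simp
  qed (simp add: norm_tensor_algebra_def)
qed

end

lemma sum_norm_component_le: "(\<Sum>k<N. norm (component u k)) \<le> norm u"
  unfolding norm_tensor_algebra_def by (rule sum_le_suminf) auto

lemma norm_component_le: "norm (component u k) \<le> norm u"
proof -
  have "norm (component u k) \<le> (\<Sum>i<Suc k. norm (component u i))"
    by (rule member_le_sum) auto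
  then show ?thesis
    using sum_norm_component_le[where N = "Suc k" and u = u] by linarith
qed

instantiation tensor_algebra :: (complex_banach) complex_banach
begin

lift_definition scaleC_tensor_algebra :: "complex \<Rightarrow> 'a tensor_algebra \<Rightarrow> 'a tensor_algebra"
  is "\<lambda>c u k. c *\<^sub>C u k"
  by (simp add: complex_vector.subspace_scale tensor_power_subspace norm_scaleC summable_mult)

lemma component_scaleC [simp]: "component (c *\<^sub>C u) k = c *\<^sub>C component (u :: 'a tensor_algebra) k"
  by (simp add: scaleC_tensor_algebra.rep_eq)

instance
proof
  fix c d :: complex and r :: real and u v :: "'a tensor_algebra"
  show "c *\<^sub>C (u + v) = c *\<^sub>C u + c *\<^sub>C v" "(c + d) *\<^sub>C u = c *\<^sub>C u + d *\<^sub>C u"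
    "c *\<^sub>C d *\<^sub>C u = (c * d) *\<^sub>C u" "r *\<^sub>R u = complex_of_real r *\<^sub>C u"
    by (rule tensor_algebra_eqI, simp add: scaleC_add_left scaleC_add_right scaleC_scaleC scaleR_scaleC)+
  show "norm (c *\<^sub>C u) = cmod c * norm u"
    by (simp add: norm_tensor_algebra_def norm_scaleC suminf_mult)
next
  fix X :: "nat \<Rightarrow> 'a tensor_algebra" assume X: "Cauchy X"
  have "Cauchy (\<lambda>n. component (X n) k)" for k
  proof (rule metric_CauchyI)
    fix e :: real assume "e > 0"
    then obtain M where M: "\<And>m n. m \<ge> M \<Longrightarrow> n \<ge> M \<Longrightarrow> dist (X m) (X n) < e"
      using metric_CauchyD[OF X] by blast
    have "dist (component (X m) k) (component (X n) k) < e" if "m \<ge> M" "n \<ge> M" for m n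
      using norm_component_le[of "X m - X n" k] M[OF that] by (simp add: dist_norm)
    then show "\<exists>M. \<forall>m\<ge>M. \<forall>n\<ge>M. dist (component (X m) k) (component (X n) k) < e"
      by blast
  qed
  then have "\<exists>l. (\<lambda>n. component (X n) k) \<longlonglongrightarrow> l" for k
    by (simp add: Cauchy_convergent_iff convergent_def)
  then obtain L where L: "\<And>k. (\<lambda>n. component (X n) k) \<longlonglongrightarrow> L k"
    by metis
  have L_in: "L k \<in> tensor_power k" for k
    by (rule closed_sequentially[OF closed_tensor_power _ L]) simp
  have bound: "\<exists>M. \<forall>n\<ge>M. \<forall>N. (\<Sum>k<N. norm (L k - component (X n) k)) \<le> e" if e: "e > 0" for e
  proof -
    obtain M where M: "\<And>m n. m \<ge> M \<Longrightarrow> n \<ge> M \<Longrightarrow> dist (X m) (X n) < e"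
      using metric_CauchyD[OF X e] by blast
    have "(\<Sum>k<N. norm (L k - component (X n) k)) \<le> e" if n: "n \<ge> M" for n N
    proof (rule LIMSEQ_le_const2)
      show "(\<lambda>m. \<Sum>k<N. norm (component (X m) k - component (X n) k))
          \<longlonglongrightarrow> (\<Sum>k<N. norm (L k - component (X n) k))"
        by (intro tendsto_sum tendsto_norm tendsto_diff L tendsto_const)
      have "(\<Sum>k<N. norm (component (X m) k - component (X n) k)) \<le> e" if "m \<ge> M" for m
        using sum_norm_component_le[of "X m - X n" N] M[OF that n] by (simp add: dist_norm)
      then show "\<exists>M. \<forall>m\<ge>M. (\<Sum>k<N. norm (component (X m) k - component (X n) k)) \<le> e"
        by blast
    qed
    then show ?thesis by blast
  qed
  have diff_summable: "summable (\<lambda>k. norm (L k - component (X n) k))"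
    if "\<And>N. (\<Sum>k<N. norm (L k - component (X n) k)) \<le> e" for n e
    by (rule summableI_nonneg_bounded[where x = e]) (use that in auto)
  obtain M where "\<forall>N. (\<Sum>k<N. norm (L k - component (X M) k)) \<le> 1"
    using bound[of 1] by auto
  then have "summable (\<lambda>k. norm (L k - component (X M) k))"
    by (intro diff_summable) auto
  from summable_norm_add[OF this component_summable[of "X M"]]
  have "summable (\<lambda>k. norm (L k))"
    by simp
  then have comp: "component (Abs_tensor_algebra L) = L"
    using L_in by (simp add: Abs_tensor_algebra_inverse)
  have "X \<longlonglongrightarrow> Abs_tensor_algebra L"
  proof (rule metric_LIMSEQ_I)
    fix e :: real assume e: "e > 0"
    then obtain M where M: "\<And>n N. n \<ge> M \<Longrightarrow> (\<Sum>k<N. norm (L k - component (X n) k)) \<le> e / 2"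
      using bound[of "e / 2"] by auto
    have "dist (X n) (Abs_tensor_algebra L) < e" if "n \<ge> M" for n
    proof -
      have "norm (Abs_tensor_algebra L - X n) \<le> e / 2"
        unfolding norm_tensor_algebra_def component_simps comp
        by (rule suminf_le_const[OF diff_summable[OF M[OF that]] M[OF that]])
      then show ?thesis
        using e by (simp add: dist_norm norm_minus_commute)
    qed
    then show "\<exists>M. \<forall>n\<ge>M. dist (X n) (Abs_tensor_algebra L) < e"
      by blast
  qed
  then show "convergent X"
    by (auto simp: convergent_def)
qed

end

lemma tensor_append_Cauchy_product:
  assumes "summable (\<lambda>k. norm (u k))" "summable (\<lambda>k. norm (v k))"
  shows "summable (\<lambda>m. norm (\<Sum>i\<le>m. tensor_append (u i) (v (m - i))))"
    "(\<Sum>m. norm (\<Sum>i\<le>m. tensor_append (u i) (v (m - i)))) \<le> (\<Sum>k. norm (u k)) * (\<Sum>k. norm (v k))"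
proof -
  have le: "norm (\<Sum>i\<le>m. tensor_append (u i) (v (m - i))) \<le> (\<Sum>i\<le>m. norm (u i) * norm (v (m - i)))" for m
    by (rule sum_norm_le) (rule tensor_append_norm)
  have s: "summable (\<lambda>m. \<Sum>i\<le>m. norm (u i) * norm (v (m - i)))"
    by (rule summable_Cauchy_product) (use assms in simp_all)
  show *: "summable (\<lambda>m. norm (\<Sum>i\<le>m. tensor_append (u i) (v (m - i))))"
    by (rule summable_comparison_test'[OF s, of 0]) (simp add: le)
  have "(\<Sum>k. norm (u k)) * (\<Sum>k. norm (v k)) = (\<Sum>m. \<Sum>i\<le>m. norm (u i) * norm (v (m - i)))"
    by (rule Cauchy_product) (use assms in simp_all)
  then show "(\<Sum>m. norm (\<Sum>i\<le>m. tensor_append (u i) (v (m - i)))) \<le> (\<Sum>k. norm (u k)) * (\<Sum>k. norm (v k))"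
    using suminf_le[OF le * s] by simp
qed

instantiation tensor_algebra :: (complex_banach) "{complex_banach_algebra, real_normed_algebra_1}"
begin

lift_definition one_tensor_algebra :: "'a tensor_algebra" is "\<lambda>k. if k = 0 then tensor [] else 0"
proof -
  have "summable (\<lambda>k. norm (if k = 0 then tensor [] else 0 :: 'a ptensor))"
    by (rule summable_finite[of "{0}"]) auto
  then show "(\<forall>k. (if k = 0 then tensor [] else 0) \<in> (tensor_power k :: 'a ptensor set))
      \<and> summable (\<lambda>k. norm (if k = 0 then tensor [] else 0 :: 'a ptensor))"
    by (simp add: tensor_in_tensor_power complex_vector.subspace_0 tensor_power_subspace)
qed

lift_definition times_tensor_algebra :: "'a tensor_algebra \<Rightarrow> 'a tensor_algebra \<Rightarrow> 'a tensor_algebra"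
  is "\<lambda>u v m. \<Sum>i\<le>m. tensor_append (u i) (v (m - i))"
proof -
  fix u v :: "nat \<Rightarrow> 'a ptensor"
  assume u: "(\<forall>k. u k \<in> tensor_power k) \<and> summable (\<lambda>k. norm (u k))"
    and v: "(\<forall>k. v k \<in> tensor_power k) \<and> summable (\<lambda>k. norm (v k))"
  have "tensor_append (u i) (v (m - i)) \<in> tensor_power m" if "i \<le> m" for i m
    using tensor_append_in_tensor_power[of "u i" i "v (m - i)" "m - i"] u v that by simp
  then have "(\<Sum>i\<le>m. tensor_append (u i) (v (m - i))) \<in> tensor_power m" for m
    by (intro complex_vector.subspace_sum tensor_power_subspace) simp
  then show "(\<forall>m. (\<Sum>i\<le>m. tensor_append (u i) (v (m - i))) \<in> tensor_power m)
      \<and> summable (\<lambda>m. norm (\<Sum>i\<le>m. tensor_append (u i) (v (m - i))))"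
    using tensor_append_Cauchy_product(1) u v by blast
qed

lemma component_times:
  "component (u * v :: 'a tensor_algebra) m = (\<Sum>i\<le>m. tensor_append (component u i) (component v (m - i)))"
  by (simp add: times_tensor_algebra.rep_eq)

lemma component_one: "component (1 :: 'a tensor_algebra) k = (if k = 0 then tensor [] else 0)"
  by (simp add: one_tensor_algebra.rep_eq)

lemmas tensor_append_linear =
  bounded_clinearD(2,4-6)[OF bounded_clinear_tensor_append_left]
  bounded_clinearD(2,4-6)[OF bounded_clinear_tensor_append_right]

lemma tensor_append_scaleR:
  "tensor_append (r *\<^sub>R u) v = r *\<^sub>R tensor_append u v"
  "tensor_append u (r *\<^sub>R v) = r *\<^sub>R tensor_append u v"
  by (simp_all add: scaleR_scaleC tensor_append_linear)

instance
proof
  fix a b c :: "'a tensor_algebra" and r :: real and z :: complex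
  show "a * b * c = a * (b * c)"
  proof (rule tensor_algebra_eqI)
    fix n
    have "component (a * b * c) n = (\<Sum>j=0..n. \<Sum>i=0..j.
        tensor_append (component a i) (tensor_append (component b (j - i)) (component c (n - j))))"
      by (simp add: component_times tensor_append_linear tensor_append_assoc atLeast0AtMost)
    also have "\<dots> = (\<Sum>j=0..n. \<Sum>i=0..n - j.
        tensor_append (component a j) (tensor_append (component b i) (component c (n - j - i))))"
      by (rule fps_mult_assoc_lemma)
    also have "\<dots> = component (a * (b * c)) n"
      by (simp add: component_times tensor_append_linear atLeast0AtMost)
    finally show "component (a * b * c) n = component (a * (b * c)) n" .
  qed
  show "(a + b) * c = a * c + b * c" "a * (b + c) = a * b + a * c"
    by (rule tensor_algebra_eqI, simp add: component_times tensor_append_linear sum.distrib)+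
  show "r *\<^sub>R a * b = r *\<^sub>R (a * b)" "a * r *\<^sub>R b = r *\<^sub>R (a * b)"
    by (rule tensor_algebra_eqI, simp add: component_times tensor_append_scaleR scaleR_sum_right)+
  show "z *\<^sub>C a * b = z *\<^sub>C (a * b)" "a * z *\<^sub>C b = z *\<^sub>C (a * b)"
    by (rule tensor_algebra_eqI,
        simp add: component_times tensor_append_linear complex_vector.scale_sum_right)+
  show "norm (a * b) \<le> norm a * norm b"
    unfolding norm_tensor_algebra_def component_times
    by (rule tensor_append_Cauchy_product) simp_all
  show "1 * a = a"
  proof (rule tensor_algebra_eqI)
    fix m
    have "component (1 * a) m = (\<Sum>i\<le>m. if i = 0 then component a m else 0)"
      unfolding component_times by (intro sum.cong) (auto simp: component_one tensor_append_linear)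
    then show "component (1 * a) m = component a m"
      by simp
  qed
  show "a * 1 = a"
  proof (rule tensor_algebra_eqI)
    fix m
    have "component (a * 1) m = (\<Sum>i\<le>m. if i = m then component a m else 0)"
      unfolding component_times by (intro sum.cong) (auto simp: component_one tensor_append_linear)
    then show "component (a * 1) m = component a m"
      by simp
  qed
  show norm1: "norm (1 :: 'a tensor_algebra) = 1"
  proof -
    have "norm (1 :: 'a tensor_algebra) = (\<Sum>k. if k = 0 then 1 else 0)"
      unfolding norm_tensor_algebra_def by (intro suminf_cong) (simp add: component_one)
    also have "\<dots> = (\<Sum>k\<in>{0::nat}. if k = 0 then 1 else 0)"
      by (rule suminf_finite) auto
    finally show ?thesis by simp
  qed
  then show "(0 :: 'a tensor_algebra) \<noteq> 1"
    by (metis norm_zero zero_neq_one)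
qed

end

section \<open>Cyclic cohomology\<close>

text \<open>
  The completed projective power of \<open>n + 1\<close> copies of the algebra is the same construction
  \<^const>\<open>tensor_power\<close> as above, now applied to the algebra as a Banach space.  The boundary is
  the \<open>d\<^sup>n\<close> from \<open>(n + 1)\<close>-chains to \<open>n\<close>-chains; list positions count from 0, so
  \<open>a ! (j - 1)\<close> is \<open>a\<^sub>j\<close>.
\<close>

definition hochschild_chains :: "nat \<Rightarrow> 'a :: complex_banach_algebra ptensor set" where
  "hochschild_chains n = tensor_power (n + 1)"

definition hochschild_boundary_word :: "nat \<Rightarrow> 'a :: complex_banach_algebra list \<Rightarrow> 'a ptensor" where
  "hochschild_boundary_word n a =
     tensor (tl (butlast a) @ [last a * hd a])
     + (\<Sum>j=1..n + 1. (- 1) ^ j *\<^sub>C tensor (take (j - 1) a @ [a ! (j - 1) * a ! j] @ drop (j + 1) a))"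

definition hochschild_boundary :: "nat \<Rightarrow> 'a :: complex_banach_algebra ptensor \<Rightarrow> 'a ptensor" where
  "hochschild_boundary n = tensor_lift (\<lambda>a. if length a = n + 2 then hochschild_boundary_word n a else 0)"

definition cyclic_shift :: "nat \<Rightarrow> 'a :: complex_banach_algebra ptensor \<Rightarrow> 'a ptensor" where
  "cyclic_shift n = tensor_lift
     (\<lambda>a. if length a = n + 1 then (- 1) ^ n *\<^sub>C tensor (last a # butlast a) else 0)"

lemma bounded_multilinear_guardI:
  assumes "\<And>us ws a b. length us + length ws + 1 = k \<Longrightarrow> f (us @ (a + b) # ws) = f (us @ a # ws) + f (us @ b # ws)"
    and "\<And>us ws a c. length us + length ws + 1 = k \<Longrightarrow> f (us @ (c *\<^sub>C a) # ws) = c *\<^sub>C f (us @ a # ws)"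
    and "\<And>w. length w = k \<Longrightarrow> norm (f w) \<le> word_norm w"
  shows "bounded_multilinear (\<lambda>w. if length w = k then f w else 0)"
  unfolding bounded_multilinear_def multilinear_def
proof (intro conjI allI)
  show "\<exists>K. \<forall>w. norm (if length w = k then f w else 0) \<le> K * word_norm w"
    by (rule exI[of _ 1]) (simp add: assms(3))
qed (auto simp: assms(1,2))

lemma bounded_multilinear_add:
  assumes "bounded_multilinear f" "bounded_multilinear g"
  shows "bounded_multilinear (\<lambda>w. f w + g w)"
proof -
  obtain K L where K: "\<And>w. norm (f w) \<le> K * word_norm w" and L: "\<And>w. norm (g w) \<le> L * word_norm w"
    using assms unfolding bounded_multilinear_def by blast
  have "norm (f w + g w) \<le> (K + L) * word_norm w" for w
    using norm_triangle_ineq[of "f w" "g w"] K[of w] L[of w] by (simp add: distrib_right)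
  then have "\<exists>K. \<forall>w. norm (f w + g w) \<le> K * word_norm w"
    by blast
  with assms show ?thesis
    unfolding bounded_multilinear_def multilinear_def by (simp add: scaleC_add_right)
qed

lemma bounded_multilinear_scaleC:
  assumes "bounded_multilinear f"
  shows "bounded_multilinear (\<lambda>w. c *\<^sub>C f w)"
proof -
  obtain K where K: "\<And>w. norm (f w) \<le> K * word_norm w"
    using assms unfolding bounded_multilinear_def by blast
  have "norm (c *\<^sub>C f w) \<le> (cmod c * K) * word_norm w" for w
    using mult_left_mono[OF K, of "cmod c" w] by (simp add: norm_scaleC mult.assoc)
  then have "\<exists>K. \<forall>w. norm (c *\<^sub>C f w) \<le> K * word_norm w"
    by blast
  with assms show ?thesis
    unfolding bounded_multilinear_def multilinear_def
    by (simp add: scaleC_add_right scaleC_scaleC mult.commute)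
qed

lemma bounded_multilinear_zero: "bounded_multilinear (\<lambda>_. 0)"
  unfolding bounded_multilinear_def multilinear_def by (auto intro: exI[of _ 0])

lemma bounded_multilinear_sum:
  "finite A \<Longrightarrow> (\<And>i. i \<in> A \<Longrightarrow> bounded_multilinear (f i)) \<Longrightarrow> bounded_multilinear (\<lambda>w. \<Sum>i\<in>A. f i w)"
  by (induction A rule: finite_induct) (auto intro: bounded_multilinear_zero bounded_multilinear_add)

lemma bounded_multilinear_wrap:
  "bounded_multilinear (\<lambda>a :: 'a :: complex_banach_algebra list. if length a = n + 2
     then tensor (tl (butlast a) @ [last a * hd a]) else 0)"
proof (rule bounded_multilinear_guardI)
  fix us ws :: "'a list" and a b c
  assume len: "length us + length ws + 1 = n + 2"
  note add = tensor_add[of "butlast ws" _ _ "[]"] tensor_add[of "tl us" _ _ "butlast ws @ _"]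
    tensor_add[of "tl us" _ _ "[]"]
  note scale = tensor_scaleC[of "butlast ws" _ _ "[]"] tensor_scaleC[of "tl us" _ _ "butlast ws @ _"]
    tensor_scaleC[of "tl us" _ _ "[]"]
  show "tensor (tl (butlast (us @ (a + b) # ws)) @ [last (us @ (a + b) # ws) * hd (us @ (a + b) # ws)]) =
      tensor (tl (butlast (us @ a # ws)) @ [last (us @ a # ws) * hd (us @ a # ws)])
      + tensor (tl (butlast (us @ b # ws)) @ [last (us @ b # ws) * hd (us @ b # ws)])"
    using len add by (cases us; cases "ws = []") (simp_all add: butlast_append distrib_left distrib_right)
  show "tensor (tl (butlast (us @ c *\<^sub>C a # ws)) @ [last (us @ c *\<^sub>C a # ws) * hd (us @ c *\<^sub>C a # ws)]) =
      c *\<^sub>C tensor (tl (butlast (us @ a # ws)) @ [last (us @ a # ws) * hd (us @ a # ws)])"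
    using len scale by (cases us; cases "ws = []") (simp_all add: butlast_append mult_scaleC_left mult_scaleC_right)
next
  fix w :: "'a list" assume w: "length w = n + 2"
  then obtain x u where "w = x # u" "length u = Suc n"
    by (cases w) auto
  then have "u \<noteq> []"
    by auto
  then obtain v y where "w = x # v @ [y]"
    using \<open>w = x # u\<close> by (metis append_butlast_last_id)
  then have "word_norm (tl (butlast w) @ [last w * hd w]) \<le> word_norm w"
    using mult_right_mono[OF norm_mult_ineq[of y x], of "word_norm v"] by (simp add: mult_ac butlast_append)
  then show "norm (tensor (tl (butlast w) @ [last w * hd w])) \<le> word_norm w"
    using norm_tensor_le order_trans by blast
qed

lemma bounded_multilinear_merge:
  assumes j: "j \<in> {1..n + 1}"
  shows "bounded_multilinear (\<lambda>a :: 'a :: complex_banach_algebra list. if length a = n + 2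
     then tensor (take (j - 1) a @ [a ! (j - 1) * a ! j] @ drop (j + 1) a) else 0)"
proof (rule bounded_multilinear_guardI)
  fix us ws :: "'a list" and a b c
  assume len: "length us + length ws + 1 = n + 2"
  obtain i where i: "j = Suc i"
    using j by (cases j) auto
  let ?m = "\<lambda>a :: 'a list. take (j - 1) a @ [a ! (j - 1) * a ! j] @ drop (j + 1) a"
  consider (lt) "length us < i" | (eq) "length us = i" | (suc) "length us = Suc i" | (gt) "length us > Suc i"
    by linarith
  then have "\<exists>P Q. \<exists>g\<in>{\<lambda>x. x} \<union> range (\<lambda>y x. x * y) \<union> range (\<lambda>y x. y * x).
      \<forall>x. ?m (us @ x # ws) = P @ g x # Q"
  proof cases
    case lt
    then obtain d where d: "i = Suc (length us + d)"
      using less_iff_Suc_add by auto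
    show ?thesis
      by (rule exI[of _ us], rule exI[of _ "take d ws @ [ws ! d * ws ! Suc d] @ drop (Suc (Suc d)) ws"],
          rule bexI[of _ "\<lambda>x. x"]) (simp_all add: i d nth_append numeral_3_eq_3)
  next
    case eq
    show ?thesis
      by (rule exI[of _ us], rule exI[of _ "drop 1 ws"], rule bexI[of _ "\<lambda>x. x * ws ! 0"])
         (auto simp: i eq[symmetric] nth_append)
  next
    case suc
    show ?thesis
      by (rule exI[of _ "take i us"], rule exI[of _ ws], rule bexI[of _ "\<lambda>x. us ! i * x"])
         (auto simp: i suc nth_append)
  next
    case gt
    show ?thesis
      by (rule exI[of _ "take i us @ [us ! i * us ! Suc i] @ drop (Suc (Suc i)) us"], rule exI[of _ ws],
          rule bexI[of _ "\<lambda>x. x"]) (use gt in \<open>simp_all add: i nth_append\<close>)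
  qed
  then obtain P Q g where g: "g \<in> {\<lambda>x. x} \<union> range (\<lambda>y x. x * y) \<union> range (\<lambda>y x. y * x)"
    and m: "\<And>x. ?m (us @ x # ws) = P @ g x # Q"
    by blast
  have "g (x + y) = g x + g y" "g (c *\<^sub>C x) = c *\<^sub>C g x" for x y c
    using g by (auto simp: distrib_left distrib_right mult_scaleC_left mult_scaleC_right)
  then show "tensor (?m (us @ (a + b) # ws)) = tensor (?m (us @ a # ws)) + tensor (?m (us @ b # ws))"
    "tensor (?m (us @ c *\<^sub>C a # ws)) = c *\<^sub>C tensor (?m (us @ a # ws))"
    unfolding m by (simp_all only: tensor_add tensor_scaleC)
next
  fix w :: "'a list" assume w: "length w = n + 2"
  obtain i where i: "j = Suc i"
    using j by (cases j) auto
  define P Q where "P = take i w" and "Q = drop (i + 2) w"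
  have w_eq: "w = P @ w ! i # w ! Suc i # Q"
    using j w by (simp add: P_def Q_def i Cons_nth_drop_Suc)
  have "word_norm (take (j - 1) w @ [w ! (j - 1) * w ! j] @ drop (j + 1) w)
      = word_norm P * (norm (w ! i * w ! Suc i) * word_norm Q)"
    by (simp add: P_def Q_def i)
  also have "\<dots> \<le> word_norm P * ((norm (w ! i) * norm (w ! Suc i)) * word_norm Q)"
    by (intro mult_left_mono mult_right_mono norm_mult_ineq) auto
  also have "\<dots> = word_norm w"
    by (subst (3) w_eq) (simp add: mult.assoc)
  finally show "norm (tensor (take (j - 1) w @ [w ! (j - 1) * w ! j] @ drop (j + 1) w)) \<le> word_norm w"
    using norm_tensor_le order_trans by blast
qed

lemma bounded_multilinear_hochschild_boundary:
  "bounded_multilinear (\<lambda>a :: 'a :: complex_banach_algebra list.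
     if length a = n + 2 then hochschild_boundary_word n a else 0)"
proof -
  have eq: "(\<lambda>a :: 'a list. if length a = n + 2 then hochschild_boundary_word n a else 0) = (\<lambda>a.
      (if length a = n + 2 then tensor (tl (butlast a) @ [last a * hd a]) else 0)
      + (\<Sum>j=1..n + 1. (- 1) ^ j *\<^sub>C (if length a = n + 2
           then tensor (take (j - 1) a @ [a ! (j - 1) * a ! j] @ drop (j + 1) a) else 0)))"
    by (simp add: fun_eq_iff hochschild_boundary_word_def)
  show ?thesis
    unfolding eq by (intro bounded_multilinear_add bounded_multilinear_wrap bounded_multilinear_sum
      bounded_multilinear_scaleC bounded_multilinear_merge) auto
qed

lemma bounded_multilinear_cyclic_shift:
  "bounded_multilinear (\<lambda>a :: 'a :: complex_banach_algebra list.
     if length a = n + 1 then (- 1) ^ n *\<^sub>C tensor (last a # butlast a) else 0)"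
proof (rule bounded_multilinear_guardI)
  fix us ws :: "'a list" and a b c
  note add = tensor_add[of "[]" a b us] tensor_add[of "last ws # us" a b "butlast ws"]
  note scale = tensor_scaleC[of "[]" c a us] tensor_scaleC[of "last ws # us" c a "butlast ws"]
  show "(- 1) ^ n *\<^sub>C tensor (last (us @ (a + b) # ws) # butlast (us @ (a + b) # ws)) =
      (- 1) ^ n *\<^sub>C tensor (last (us @ a # ws) # butlast (us @ a # ws))
      + (- 1) ^ n *\<^sub>C tensor (last (us @ b # ws) # butlast (us @ b # ws))"
    using add by (cases "ws = []") (simp_all add: butlast_append scaleC_add_right)
  show "(- 1) ^ n *\<^sub>C tensor (last (us @ c *\<^sub>C a # ws) # butlast (us @ c *\<^sub>C a # ws)) =
      c *\<^sub>C (- 1) ^ n *\<^sub>C tensor (last (us @ a # ws) # butlast (us @ a # ws))"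
    using scale by (cases "ws = []") (simp_all add: butlast_append scaleC_scaleC mult.commute)
next
  fix w :: "'a list" assume "length w = n + 1"
  then have "w = butlast w @ [last w]"
    by (metis Suc_eq_plus1 append_butlast_last_id list.size(3) nat.distinct(1))
  then have "word_norm (last w # butlast w) = word_norm w"
    by (metis word_norm_simps mult.commute mult.right_neutral)
  then show "norm ((- 1) ^ n *\<^sub>C tensor (last w # butlast w)) \<le> word_norm w"
    using norm_tensor_le[of "last w # butlast w"] by (simp add: norm_scaleC norm_power)
qed

lemma bounded_clinear_hochschild_boundary: "bounded_clinear (hochschild_boundary n)"
  unfolding hochschild_boundary_def by (rule bounded_clinear_tensor_lift[OF bounded_multilinear_hochschild_boundary])

lemma hochschild_boundary_tensor:
  "length a = n + 2 \<Longrightarrow> hochschild_boundary n (tensor a) = hochschild_boundary_word n a"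
  unfolding hochschild_boundary_def
  by (subst tensor_lift_tensor[OF bounded_multilinear_hochschild_boundary]) simp

lemma hochschild_boundary_word_in:
  assumes "length a = n + 2"
  shows "hochschild_boundary_word n a \<in> tensor_power (n + 1)"
  unfolding hochschild_boundary_word_def
proof (intro complex_vector.subspace_add complex_vector.subspace_sum complex_vector.subspace_scale
    tensor_power_subspace tensor_in_tensor_power)
  show "length (tl (butlast a) @ [last a * hd a]) = n + 1"
    using assms by simp
  fix j assume "j \<in> {1..n + 1}"
  then show "length (take (j - 1) a @ [a ! (j - 1) * a ! j] @ drop (j + 1) a) = n + 1"
    using assms by auto
qed

lemma hochschild_boundary_in_hochschild_chains:
  assumes "x \<in> hochschild_chains (n + 1)"
  shows "hochschild_boundary n x \<in> hochschild_chains n"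
  unfolding hochschild_chains_def
  by (rule bounded_clinear_maps_tensor_power[OF bounded_clinear_hochschild_boundary
        tensor_power_subspace closed_tensor_power _ assms[unfolded hochschild_chains_def]])
     (simp only: hochschild_boundary_tensor hochschild_boundary_word_in add.assoc one_add_one)

lemma bounded_clinear_cyclic_shift: "bounded_clinear (cyclic_shift n)"
  unfolding cyclic_shift_def by (rule bounded_clinear_tensor_lift[OF bounded_multilinear_cyclic_shift])

lemma cyclic_shift_tensor:
  "length a = n + 1 \<Longrightarrow> cyclic_shift n (tensor a) = (- 1) ^ n *\<^sub>C tensor (last a # butlast a)"
  unfolding cyclic_shift_def by (subst tensor_lift_tensor[OF bounded_multilinear_cyclic_shift]) simp

lemma cyclic_shift_in_hochschild_chains:
  "x \<in> hochschild_chains n \<Longrightarrow> cyclic_shift n x \<in> hochschild_chains n"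
  unfolding hochschild_chains_def
  by (rule bounded_clinear_maps_tensor_power[OF bounded_clinear_cyclic_shift tensor_power_subspace closed_tensor_power])
     (auto simp: cyclic_shift_tensor tensor_power_subspace
       intro!: complex_vector.subspace_scale tensor_in_tensor_power)

text \<open>
  The dual of \<^term>\<open>hochschild_chains n\<close>.  Functionals on this closed subspace are represented by
  functions that vanish off it, so that pointwise equality is equality of functionals.
\<close>

type_synonym 'a cochain = "'a ptensor \<Rightarrow> complex"

definition hochschild_cochains :: "nat \<Rightarrow> 'a :: complex_banach_algebra cochain set" where
  "hochschild_cochains n = {T.
     (\<forall>x\<in>hochschild_chains n. \<forall>y\<in>hochschild_chains n. T (x + y) = T x + T y) \<and>
     (\<forall>c. \<forall>x\<in>hochschild_chains n. T (c *\<^sub>C x) = c * T x) \<and>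
     (\<exists>K. \<forall>x\<in>hochschild_chains n. cmod (T x) \<le> K * norm x) \<and>
     (\<forall>x. x \<notin> hochschild_chains n \<longrightarrow> T x = 0)}"

definition hochschild_coboundary :: "nat \<Rightarrow> 'a :: complex_banach_algebra cochain \<Rightarrow> 'a cochain" where
  "hochschild_coboundary n T =
     (\<lambda>x. if x \<in> hochschild_chains (n + 1) then T (hochschild_boundary n x) else 0)"

definition cyclic_cochains :: "nat \<Rightarrow> 'a :: complex_banach_algebra cochain set" where
  "cyclic_cochains n = {T \<in> hochschild_cochains n. \<forall>x\<in>hochschild_chains n. T (cyclic_shift n x) = T x}"

definition cyclic_cocycles :: "nat \<Rightarrow> 'a :: complex_banach_algebra cochain set" where
  "cyclic_cocycles n = {T \<in> cyclic_cochains n. hochschild_coboundary n T = (\<lambda>_. 0)}"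

definition cyclic_coboundaries :: "nat \<Rightarrow> 'a :: complex_banach_algebra cochain set" where
  "cyclic_coboundaries n =
     (case n of 0 \<Rightarrow> {\<lambda>_. 0} | Suc m \<Rightarrow> hochschild_coboundary m ` cyclic_cochains m)"

text \<open>
  Cohomology is the quotient of the cocycles by the coboundaries; its vector space operations are
  those of cosets.  The coboundaries are added again in \<open>class_scale\<close> so that scaling by 0 yields
  the zero coset.
\<close>

definition cyclic_class :: "nat \<Rightarrow> 'a :: complex_banach_algebra cochain \<Rightarrow> 'a cochain set" where
  "cyclic_class n T = {(\<lambda>x. T x + S x) | S. S \<in> cyclic_coboundaries n}"

definition cyclic_cohomology :: "nat \<Rightarrow> 'a :: complex_banach_algebra cochain set set" where
  "cyclic_cohomology n = cyclic_class n ` cyclic_cocycles n"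

definition class_add :: "'a :: complex_banach_algebra cochain set \<Rightarrow> 'a cochain set \<Rightarrow> 'a cochain set" where
  "class_add P Q = {(\<lambda>x. S x + T x) | S T. S \<in> P \<and> T \<in> Q}"

definition class_scale ::
  "nat \<Rightarrow> complex \<Rightarrow> 'a :: complex_banach_algebra cochain set \<Rightarrow> 'a cochain set" where
  "class_scale n c P =
     {(\<lambda>x. c * T x + S x) | T S. T \<in> P \<and> S \<in> cyclic_coboundaries n}"

end

theory Submission
  imports Defs
begin

text \<open>
  A cochain is determined by its values on tuples of words.  If the letters of such a tuple are
  arranged on a circle, the words are the arcs between successive cuts, and the boundary removes
  cuts.  Inserting one additional cut just before a fixed letter contracts the cyclic complex above
  degree 0.  No letter is distinguished, so one averages over all letters; the averages have norm
  at most 1, however many letters there are, which makes the homotopy bounded.  Hence every cyclic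
  cocycle is a coboundary on the tuples that contain a letter, and only its value on
  \<open>1 \<otimes> \<dots> \<otimes> 1\<close> remains; in odd degree that value vanishes by cyclicity.
\<close>

section \<open>Cyclic sums over tuples of words\<close>

text \<open>On tuples with \<open>m\<close> letters the primitive of \<open>F\<close> is
  \<open>cyc (cut_last F)\<close> divided by \<open>m\<close>. Faces only concatenate words, so a
  tuple and its faces have the same \<open>m\<close>; division by \<open>m\<close> therefore
  commutes with the coboundary, and what has to be shown is a finite identity: the coboundary of
  \<open>cyc (cut_last F)\<close> is \<open>m\<close> times \<open>F\<close>. The extra cut splits a
  word \<open>w\<close> into two pieces. In the cocycle identity for the tuple that starts with the
  right piece and ends with the left one, the wrap-around face rejoins them and returns
  \<open>F\<close>, once for each letter of \<open>w\<close>; summing over the rotations gives the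
  factor \<open>m\<close>. The recipe refers to lengths and letters, so it makes sense on words but
  not on general elements of T(V). It is carried over by a correspondence: functions of word tuples
  that are linear in every letter and bounded by one constant times the product of all letter norms
  extend to bounded cochains. A constant independent of the word lengths is what the \<ell>^1-sum
  requires.\<close>

definition merge_at :: "nat \<Rightarrow> 'a list list \<Rightarrow> 'a list list" where
  "merge_at j x = take (j - 1) x @ [x ! (j - 1) @ x ! j] @ drop (j + 1) x"

definition wrap :: "'a list list \<Rightarrow> 'a list list" where
  "wrap x = tl (butlast x) @ [last x @ hd x]"

definition word_coboundary :: "('a list list \<Rightarrow> complex) \<Rightarrow> 'a list list \<Rightarrow> complex" where
  "word_coboundary F x = F (wrap x) + (\<Sum>j=1..length x - 1. (- 1) ^ j * F (merge_at j x))"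

text \<open>The norm operator N of cyclic theory, the sum of the powers of the signed rotation. It
  makes any function cyclic, see \<open>cyc_rotate1\<close>.\<close>

definition cyc :: "('a list \<Rightarrow> complex) \<Rightarrow> 'a list \<Rightarrow> complex" where
  "cyc g x = (\<Sum>k<length x. (- 1) ^ ((length x - 1) * k) * g (rotate k x))"

lemma merge_Cons: "j \<ge> 1 \<Longrightarrow> merge_at (Suc j) (a # x) = a # merge_at j x"
  by (cases j) (simp_all add: merge_at_def)

lemma merge_append: "1 \<le> j \<Longrightarrow> j < length x \<Longrightarrow> merge_at j (x @ y) = merge_at j x @ y"
  by (cases j) (auto simp: merge_at_def nth_append)

lemma merge_last: "merge_at (Suc (length c)) (c @ [v, w]) = c @ [v @ w]"
  by (simp add: merge_at_def nth_append)

lemma length_merge [simp]: "1 \<le> j \<Longrightarrow> j < length x \<Longrightarrow> length (merge_at j x) = length x - 1"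
  by (auto simp: merge_at_def)

lemma length_wrap [simp]: "length x \<ge> 2 \<Longrightarrow> length (wrap x) = length x - 1"
  by (auto simp: wrap_def)

lemma concat_merge: "1 \<le> j \<Longrightarrow> j < length x \<Longrightarrow> concat (merge_at j x) = concat x"
proof -
  assume j: "1 \<le> j" "j < length x"
  then obtain i where i: "j = Suc i" by (cases j) auto
  have "x = take i x @ x ! i # x ! Suc i # drop (Suc (Suc i)) x"
    using j by (simp add: i Cons_nth_drop_Suc)
  then have "concat x = concat (take i x @ x ! i # x ! Suc i # drop (Suc (Suc i)) x)"
    by (rule arg_cong)
  then show ?thesis by (simp add: merge_at_def i)
qed

lemma rotate1_merge:
  assumes "1 \<le> j" "Suc j < length x"
  shows "rotate1 (merge_at (Suc j) x) = merge_at j (rotate1 x)"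
  using assms by (cases x) (auto simp: merge_Cons merge_append)

text \<open>Each rotation moves the merged pair one place to the left; \<open>1 \<le> j\<close>
  ensures that the pair is never torn apart between the two ends.\<close>

lemma rotate_merge:
  assumes "1 \<le> j" "j + l < length x"
  shows "rotate l (merge_at (j + l) x) = merge_at j (rotate l x)"
  using assms
proof (induction l arbitrary: j)
  case (Suc l)
  from Suc.IH[of "Suc j"] Suc.prems show ?case
    by (simp add: rotate1_merge)
qed simp

text \<open>On a circle the wrap-around face is no exception: after one rotation it is the last
  merge.\<close>

lemma wrap_eq_merge:
  assumes "length x = Suc (Suc p)"
  shows "wrap x = merge_at (Suc p) (rotate1 x)"
proof -
  obtain a c w where x: "x = a # c @ [w]"
    using assms by (metis length_Suc_conv rev_exhaust list.size(3) nat.distinct(1))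
  then have "length c = p" using assms by simp
  then show ?thesis using merge_last[of c w a] by (simp add: x wrap_def butlast_append)
qed

section \<open>Signed sums over rotations\<close>

lemma sum_periodic:
  fixes f :: "nat \<Rightarrow> 'b :: cancel_comm_monoid_add"
  assumes "f n = f 0"
  shows "(\<Sum>k<n. f (Suc k)) = (\<Sum>k<n. f k)"
  using sum.lessThan_Suc_shift[of f n] assms by (simp add: add.commute)

lemma sum_lessThan_add:
  fixes f :: "nat \<Rightarrow> 'b :: comm_monoid_add"
  shows "(\<Sum>l<a + b. f l) = (\<Sum>l<a. f l) + (\<Sum>l<b. f (a + l))"
  by (induction b) (simp_all add: add.assoc)

lemma minus_one_power_cancel [simp]: "(- 1 :: complex) ^ n * ((- 1) ^ n * z) = z"
  by (simp flip: mult.assoc power_add)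

lemma cyc_rotate1_arg: "cyc (\<lambda>y. g (rotate1 y)) x = (- 1) ^ (length x - 1) * cyc g x"
proof -
  let ?n = "length x"
  let ?f = "\<lambda>k. (- 1) ^ ((?n - 1) * k) * g (rotate k x)"
  \<comment> \<open>A full turn carries no sign, so the summands of \<open>cyc\<close> are periodic
    and the sum may start at any rotation.\<close>
  have "even ((?n - 1) * ?n)" by (cases "?n") auto
  then have "?f ?n = ?f 0" by simp
  from sum_periodic[OF this] have "cyc g x = (\<Sum>k<?n. ?f (Suc k))" unfolding cyc_def by (rule sym)
  then have "(- 1) ^ (?n - 1) * cyc g x = (\<Sum>k<?n. (- 1) ^ (?n - 1) * ?f (Suc k))"
    by (simp only: sum_distrib_left)
  also have "\<dots> = cyc (\<lambda>y. g (rotate1 y)) x"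
    unfolding cyc_def
    by (intro sum.cong refl) (simp only: mult_Suc_right power_add mult.assoc minus_one_power_cancel rotate_Suc)
  finally show ?thesis by simp
qed

lemma cyc_rotate_arg: "cyc (\<lambda>y. g (rotate l y)) x = (- 1) ^ ((length x - 1) * l) * cyc g x"
proof (induction l arbitrary: g)
  case (Suc l)
  show ?case
    using Suc[of "\<lambda>y. g (rotate1 y)"] by (simp add: cyc_rotate1_arg power_add)
qed simp

lemma cyc_rotate1: "cyc g (rotate1 x) = (- 1) ^ (length x - 1) * cyc g x"
proof -
  have "cyc g (rotate1 x) = cyc (\<lambda>y. g (rotate1 y)) x"
    by (simp add: cyc_def rotate1_rotate_swap)
  then show ?thesis by (simp only: cyc_rotate1_arg)
qed

lemma cyc_cong:
  "(\<And>y. length y = length x \<Longrightarrow> f y = g y) \<Longrightarrow> cyc f x = cyc g x"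
  by (simp add: cyc_def)

lemma cyc_add: "cyc (\<lambda>y. f y + g y) x = cyc f x + cyc g x"
  by (simp add: cyc_def algebra_simps sum.distrib)

lemma cyc_mult: "cyc (\<lambda>y. c * g y) x = c * cyc g x"
  by (simp add: cyc_def sum_distrib_left mult_ac)

lemma cyc_sum: "cyc (\<lambda>y. \<Sum>i\<in>A. f i y) x = (\<Sum>i\<in>A. cyc (f i) x)"
  unfolding cyc_def by (simp add: sum_distrib_left) (rule sum.swap)

text \<open>A tuple of \<open>p + 2\<close> words has as many junctions on the circle, and each of
  them is the last junction of exactly one rotation. Cyclicity of \<open>S\<close> pays for the
  rotation with a sign.\<close>

lemma word_coboundary_cyclic:
  assumes S: "\<And>y. length y = Suc p \<Longrightarrow> S (rotate1 y) = (- 1) ^ p * S y"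
    and x: "length x = Suc (Suc p)"
  shows "word_coboundary S x = cyc (\<lambda>y. (- 1) ^ Suc p * S (merge_at (Suc p) y)) x"
proof -
  have S_rot: "S (rotate k y) = (- 1) ^ (p * k) * S y" if "length y = Suc p" for k y
    using that by (induction k) (simp_all add: S power_add)
  have face: "(- 1) ^ j * S (merge_at j x) = (- 1) ^ (Suc p * j) * S (merge_at (Suc p) (rotate (Suc j) x))"
    if j: "1 \<le> j" "j \<le> Suc p" for j
  proof -
    let ?l = "Suc p - j" and ?y = "rotate (Suc j) x"
    have "rotate ?l ?y = rotate (length x) x"
      using j x by (simp add: rotate_rotate del: rotate_Suc)
    then have "rotate ?l ?y = x" by simp
    moreover have "merge_at j (rotate ?l ?y) = rotate ?l (merge_at (Suc p) ?y)"
      using j x rotate_merge[of j ?l ?y] by simp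
    ultimately have *: "S (merge_at j x) = (- 1) ^ (p * ?l) * S (merge_at (Suc p) ?y)"
      using x by (simp add: S_rot del: rotate_Suc)
    \<comment> \<open>\<open>p * Suc p\<close> is even, so \<open>j + p * (Suc p - j)\<close> has
      the parity of \<open>Suc p * j\<close>.\<close>
    have "(- 1) ^ j * (- 1) ^ (p * ?l) = (- 1 :: complex) ^ (Suc p * j)"
      using j by (auto simp: minus_one_power_iff simp flip: power_add)
    then show ?thesis unfolding * by (simp only: mult.assoc[symmetric])
  qed
  have "word_coboundary S x = S (merge_at (Suc p) (rotate1 x)) +
      (\<Sum>j=1..Suc p. (- 1) ^ (Suc p * j) * S (merge_at (Suc p) (rotate1 (rotate j x))))"
    unfolding word_coboundary_def wrap_eq_merge[OF x]
    by (intro arg_cong2[where f = "(+)"] sum.cong) (use x face in auto)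
  \<comment> \<open>The wrap-around face supplies the missing term \<open>j = 0\<close>.\<close>
  also have "\<dots> = (\<Sum>j\<le>Suc p. (- 1) ^ (Suc p * j) * S (merge_at (Suc p) (rotate1 (rotate j x))))"
    unfolding atMost_atLeast0 by (subst (2) sum.atLeast_Suc_atMost) simp_all
  also have "\<dots> = cyc (\<lambda>y. S (merge_at (Suc p) (rotate1 y))) x"
    by (simp only: cyc_def x lessThan_Suc_atMost diff_Suc_1)
  also have "\<dots> = cyc (\<lambda>y. (- 1) ^ Suc p * S (merge_at (Suc p) y)) x"
    unfolding cyc_rotate1_arg[of "\<lambda>y. S (merge_at (Suc p) y)"] cyc_mult by (simp only: x diff_Suc_1)
  finally show ?thesis .
qed

text \<open>With \<open>word_coboundary_cyclic\<close> for \<open>S = cyc R\<close> this is the dual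
  of the relation b'N = Nb of the cyclic bicomplex: the coboundary of a cyclic sum is the cyclic sum
  of the coboundary without its wrap-around term.\<close>

lemma cyc_cyc_merge:
  assumes x: "length x = Suc (Suc p)"
  shows "cyc (\<lambda>y. (- 1) ^ Suc p * cyc R (merge_at (Suc p) y)) x
    = cyc (\<lambda>y. \<Sum>j=1..Suc p. (- 1) ^ j * R (merge_at j y)) x"
proof -
  have "cyc (\<lambda>y. (- 1) ^ Suc p * cyc R (merge_at (Suc p) y)) x
    = cyc (\<lambda>y. \<Sum>l<Suc p. ((- 1) ^ Suc p * (- 1) ^ (p * l)) * R (merge_at (Suc p - l) (rotate l y))) x"
  proof (rule cyc_cong)
    fix y :: "'a list list" assume y: "length y = length x"
    then have "length (merge_at (Suc p) y) = Suc p" using x by simp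
    moreover have "rotate l (merge_at (Suc p) y) = merge_at (Suc p - l) (rotate l y)" if "l < Suc p" for l
      using rotate_merge[of "Suc p - l" l y] that x y by simp
    ultimately show "(- 1) ^ Suc p * cyc R (merge_at (Suc p) y) =
       (\<Sum>l<Suc p. ((- 1) ^ Suc p * (- 1) ^ (p * l)) * R (merge_at (Suc p - l) (rotate l y)))"
      unfolding cyc_def sum_distrib_left by (intro sum.cong) (auto simp: mult.assoc)
  qed
  also have "\<dots> = (\<Sum>l<Suc p. (- 1) ^ (Suc p - l) * cyc (\<lambda>y. R (merge_at (Suc p - l) y)) x)"
    unfolding cyc_sum
  proof (intro sum.cong refl)
    fix l assume l: "l \<in> {..<Suc p}"
    have "(- 1) ^ Suc p * (- 1) ^ (p * l) * (- 1) ^ (Suc p * l) = (- 1 :: complex) ^ (Suc p - l)"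
      using l by (auto simp: minus_one_power_iff simp flip: power_add)
    then show "cyc (\<lambda>y. ((- 1) ^ Suc p * (- 1) ^ (p * l)) * R (merge_at (Suc p - l) (rotate l y))) x
       = (- 1) ^ (Suc p - l) * cyc (\<lambda>y. R (merge_at (Suc p - l) y)) x"
      unfolding cyc_mult cyc_rotate_arg[of "\<lambda>y. R (merge_at (Suc p - l) y)"] x
      by (simp only: mult.assoc[symmetric] diff_Suc_1)
  qed
  also have "\<dots> = (\<Sum>j=1..Suc p. (- 1) ^ j * cyc (\<lambda>y. R (merge_at j y)) x)"
    by (rule sum.reindex_bij_witness[of _ "\<lambda>j. Suc p - j" "\<lambda>l. Suc p - l"]) auto
  finally show ?thesis by (simp only: cyc_sum cyc_mult)
qed

text \<open>
  Cutting only the last word loses nothing, since \<^const>\<open>cyc\<close> rotates every word into that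
  position.  The range of \<open>l\<close> puts the cut before a letter, so the new first word is nonempty.
\<close>

definition cut_last :: "('a list list \<Rightarrow> complex) \<Rightarrow> 'a list list \<Rightarrow> complex" where
  "cut_last F x = (\<Sum>l<length (last x). F (drop l (last x) # butlast x @ [take l (last x)]))"

definition shift_cut :: "('a list list \<Rightarrow> complex) \<Rightarrow> 'a list list \<Rightarrow> complex" where
  "shift_cut F x = (\<Sum>l<length (last x). F ((drop l (last x) @ hd x) # tl (butlast x) @ [take l (last x)]))"

text \<open>
  The cocycle identity at \<open>(z, b, u)\<close>, summed over the splittings \<open>w = u z\<close> of the last word of
  \<open>y = (b, w)\<close>.  The two \<^const>\<open>shift_cut\<close> terms differ by a signed rotation, so they cancel
  under \<^const>\<open>cyc\<close>.
\<close>

lemma cut_last_merge: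
  assumes F: "\<And>z. length z = Suc (Suc (Suc p)) \<Longrightarrow> word_coboundary F z = 0"
    and y: "length y = Suc (Suc p)"
  shows "(\<Sum>j=1..Suc p. (- 1) ^ j * cut_last F (merge_at j y)) =
    of_nat (length (last y)) * F y - shift_cut F y + (- 1) ^ Suc p * shift_cut F (last y # butlast y)"
proof -
  obtain b w where yb: "y = b @ [w]" "length b = Suc p"
    using y by (cases y rule: rev_cases) auto
  obtain c v where bc: "b = c @ [v]" "length c = p"
    using yb by (cases b rule: rev_cases) auto
  obtain h d where hd: "b = h # d" "length d = p"
    using yb by (cases b) auto
  have cocycle: "F y - F ((drop l w @ h) # d @ [take l w])
      - (\<Sum>j=1..p. (- 1) ^ j * F (drop l w # merge_at j b @ [take l w]))
      - (- 1) ^ Suc p * F (drop l w # c @ [v @ take l w]) = 0" for l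
  proof -
    let ?z = "drop l w # b @ [take l w]"
    have len: "length ?z - 1 = Suc (Suc p)" using yb by simp
    \<comment> \<open>The end of the tuple is glued in front of its beginning, and
      \<open>take l w @ drop l w = w\<close>.\<close>
    have w: "wrap ?z = y" by (simp add: wrap_def yb)
    have m1: "merge_at 1 ?z = (drop l w @ h) # d @ [take l w]" by (simp add: merge_at_def hd)
    have mj: "merge_at (Suc j) ?z = drop l w # merge_at j b @ [take l w]" if "j \<in> {1..p}" for j
      using that yb by (simp add: merge_Cons merge_append)
    have ml: "merge_at (Suc (Suc p)) ?z = drop l w # c @ [v @ take l w]"
      using merge_last[of c v "take l w"] bc by (simp add: merge_Cons)
    have "0 = F (wrap ?z) + (\<Sum>j=1..Suc (Suc p). (- 1) ^ j * F (merge_at j ?z))"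
      using F[of ?z] yb unfolding word_coboundary_def len by simp
    also have "(\<Sum>j=1..Suc (Suc p). (- 1) ^ j * F (merge_at j ?z)) =
       (- 1) * F (merge_at 1 ?z) + (\<Sum>j=1..p. (- 1) ^ Suc j * F (merge_at (Suc j) ?z))
       + (- 1) ^ Suc (Suc p) * F (merge_at (Suc (Suc p)) ?z)"
      by (subst sum.atLeast_Suc_atMost, simp, subst sum.cl_ivl_Suc)
         (simp only: sum.atLeast_Suc_atMost_Suc_shift One_nat_def, simp)
    also have "(\<Sum>j=1..p. (- 1) ^ Suc j * F (merge_at (Suc j) ?z))
        = - (\<Sum>j=1..p. (- 1) ^ j * F (drop l w # merge_at j b @ [take l w]))"
      unfolding sum_negf[symmetric] by (intro sum.cong refl) (simp only: mj, simp)
    finally show ?thesis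
      by (simp only: w m1 ml) (simp add: algebra_simps)
  qed
  have low: "cut_last F (merge_at j y) = (\<Sum>l<length w. F (drop l w # merge_at j b @ [take l w]))"
    if "j \<in> {1..p}" for j
    using that by (simp add: yb merge_append cut_last_def)
  have low_sum: "(\<Sum>l<length w. \<Sum>j=1..p. (- 1) ^ j * F (drop l w # merge_at j b @ [take l w]))
      = (\<Sum>j=1..p. (- 1) ^ j * cut_last F (merge_at j y))"
    by (subst sum.swap, intro sum.cong refl) (simp only: low sum_distrib_left)
  \<comment> \<open>A cut of \<open>v @ w\<close> falls either into \<open>v\<close>, which is what
    \<open>shift_cut\<close> collects at the rotated tuple \<open>w # b\<close>, or into
    \<open>w\<close>, which is the last face of the cocycle identity.\<close>
  have top: "cut_last F (merge_at (Suc p) y) = shift_cut F (w # b) + (\<Sum>l<length w. F (drop l w # c @ [v @ take l w]))"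
  proof -
    have "merge_at (Suc p) y = c @ [v @ w]" using merge_last[of c v w] by (simp add: yb bc)
    then have "cut_last F (merge_at (Suc p) y) =
        (\<Sum>l<length v + length w. F (drop l (v @ w) # c @ [take l (v @ w)]))"
      by (simp add: cut_last_def)
    also have "\<dots> = (\<Sum>l<length v. F (drop l (v @ w) # c @ [take l (v @ w)]))
       + (\<Sum>l<length w. F (drop (length v + l) (v @ w) # c @ [take (length v + l) (v @ w)]))"
      by (rule sum_lessThan_add)
    finally show ?thesis by (simp add: shift_cut_def bc)
  qed
  have "0 = (\<Sum>l<length w. F y - F ((drop l w @ h) # d @ [take l w])
      - (\<Sum>j=1..p. (- 1) ^ j * F (drop l w # merge_at j b @ [take l w]))
      - (- 1) ^ Suc p * F (drop l w # c @ [v @ take l w]))"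
    by (simp only: cocycle sum.neutral_const)
  also have "\<dots> = of_nat (length w) * F y - shift_cut F y
      - (\<Sum>j=1..p. (- 1) ^ j * cut_last F (merge_at j y))
      - (- 1) ^ Suc p * (cut_last F (merge_at (Suc p) y) - shift_cut F (w # b))"
    unfolding sum_subtractf top low_sum
    by (simp add: shift_cut_def yb hd sum_distrib_left)
  finally show ?thesis
    by (simp add: yb algebra_simps)
qed

text \<open>Every word is in the last position in exactly one rotation, so cutting the last word in
  all rotations cuts once before each letter.\<close>

lemma sum_length_last_rotate: "(\<Sum>k<length x. length (last (rotate k x))) = length (concat x)"
proof (cases "x = []")
  case False
  have last: "length (last (rotate (Suc k) x)) = length (x ! k)" if "k < length x" for k
  proof -
    have "last (rotate1 z) = hd z" if "z \<noteq> []" for z :: "'a list list"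
      using that by (cases z) auto
    then show ?thesis using False that by (simp add: hd_rotate_conv_nth)
  qed
  have "(\<Sum>k<length x. length (last (rotate k x))) = (\<Sum>k<length x. length (last (rotate (Suc k) x)))"
    using sum_periodic[of "\<lambda>k. length (last (rotate k x))" "length x"] by simp
  also have "\<dots> = (\<Sum>k<length x. length (x ! k))"
    by (intro sum.cong refl) (simp only: last lessThan_iff)
  also have "\<dots> = length (concat x)"
    by (simp add: length_concat sum_list_sum_nth atLeast0LessThan)
  finally show ?thesis .
qed simp

text \<open>The homotopy identity before averaging. By b'N = Nb only the inner faces of
  \<open>cut_last F\<close> are needed, and \<open>cut_last_merge\<close> evaluates them.\<close>

lemma cyc_coboundary_cut_last:
  assumes F: "\<And>z. length z = Suc (Suc (Suc p)) \<Longrightarrow> word_coboundary F z = 0"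
    and cyclic: "\<And>y. length y = Suc (Suc p) \<Longrightarrow> F (rotate1 y) = (- 1) ^ Suc p * F y"
    and x: "length x = Suc (Suc p)"
  shows "word_coboundary (cyc (cut_last F)) x = of_nat (length (concat x)) * F x"
proof -
  have rot: "F (rotate k x) = (- 1) ^ (Suc p * k) * F x" for k
    by (induction k) (simp_all only: rotate_Suc rotate0 id_apply cyclic x length_rotate power_add mult_Suc_right mult.assoc, simp)
  let ?g = "\<lambda>y. shift_cut F (last y # butlast y)"
  have "cyc (shift_cut F) x = cyc (\<lambda>y. ?g (rotate1 y)) x"
  proof (rule cyc_cong)
    fix y :: "'a list list" assume "length y = length x"
    then show "shift_cut F y = ?g (rotate1 y)" using x by (cases y) auto
  qed
  then have Q: "cyc (shift_cut F) x = (- 1) ^ Suc p * cyc ?g x"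
    by (simp only: cyc_rotate1_arg[of ?g] x diff_Suc_1)
  have "word_coboundary (cyc (cut_last F)) x = cyc (\<lambda>y. (- 1) ^ Suc p * cyc (cut_last F) (merge_at (Suc p) y)) x"
    by (rule word_coboundary_cyclic[OF _ x]) (simp add: cyc_rotate1)
  also have "\<dots> = cyc (\<lambda>y. of_nat (length (last y)) * F y + ((- 1) * shift_cut F y + (- 1) ^ Suc p * ?g y)) x"
    unfolding cyc_cyc_merge[OF x] by (rule cyc_cong) (subst cut_last_merge[OF F], simp_all add: x)
  also have "\<dots> = cyc (\<lambda>y. of_nat (length (last y)) * F y) x"
    unfolding cyc_add cyc_mult Q by simp
  \<comment> \<open>The sign from rotating the cyclic function \<open>F\<close> meets the same sign
    in \<open>cyc\<close>, and the two cancel.\<close>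
  also have "\<dots> = (\<Sum>k<length x. of_nat (length (last (rotate k x)))) * F x"
    unfolding cyc_def sum_distrib_right rot
    by (intro sum.cong) (simp_all add: x mult.left_commute flip: power_add)
  also have "\<dots> = of_nat (length (concat x)) * F x"
    by (simp only: of_nat_sum[symmetric] sum_length_last_rotate)
  finally show ?thesis .
qed

section \<open>Multilinear functions of words\<close>

lift_definition word :: "'v :: complex_banach list \<Rightarrow> 'v tensor_algebra" is
  "\<lambda>w k. if k = length w then tensor w else 0"
proof -
  fix w :: "'v list"
  have "summable (\<lambda>k. norm (if k = length w then tensor w else 0))"
    by (rule summable_finite[of "{length w}"]) auto
  then show "(\<forall>k. (if k = length w then tensor w else 0) \<in> tensor_power k) \<and>
      summable (\<lambda>k. norm (if k = length w then tensor w else 0))"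
    by (simp add: tensor_in_tensor_power complex_vector.subspace_0 tensor_power_subspace)
qed

lemma component_word: "component (word w) k = (if k = length w then tensor w else 0)"
  by (rule word.rep_eq[THEN fun_cong])

lemma norm_word_le: "norm (word w) \<le> word_norm w"
proof -
  have "norm (word w) = (\<Sum>k\<in>{length w}. norm (component (word w) k))"
    unfolding norm_tensor_algebra_def by (rule suminf_finite) (auto simp: component_word)
  then show ?thesis by (simp add: component_word norm_tensor_le)
qed

lemma bounded_multilinear_word: "bounded_multilinear word"
  unfolding bounded_multilinear_def multilinear_def
  by (auto intro!: tensor_algebra_eqI exI[of _ 1] norm_word_le
      simp: component_word tensor_add tensor_scaleC)

lemma word_times: "word v * word w = word (v @ w)"
proof (rule tensor_algebra_eqI)
  fix m
  have "component (word v * word w) m =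
      (\<Sum>i\<le>m. if i = length v then (if m = length v + length w then tensor (v @ w) else 0) else 0)"
    unfolding component_times component_word
    by (intro sum.cong) (auto simp: tensor_append_linear)
  then show "component (word v * word w) m = component (word (v @ w)) m"
    by (auto simp: component_word)
qed

lemma bounded_clinear_component: "bounded_clinear (\<lambda>u. component u k)"
  by (rule bounded_clinearI[where K = 1]) (simp_all add: norm_component_le)

text \<open>Puts all degrees into the single space \<open>'v ptensor\<close>, where
  \<open>tensor_lift\<close> and the density of elementary tensors are available.
  \<open>tensor_lift_word_flatten\<close> shows that nothing is lost.\<close>

definition flatten :: "'v :: complex_banach tensor_algebra \<Rightarrow> 'v ptensor" where
  "flatten u = (\<Sum>k. component u k)"

lemma summable_component: "summable (component u)"
  by (rule summable_norm_cancel) simp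

lemma norm_flatten_le: "norm (flatten u) \<le> norm u"
  unfolding flatten_def norm_tensor_algebra_def by (rule summable_norm) simp

lemma bounded_clinear_flatten: "bounded_clinear flatten"
proof (rule bounded_clinearI[where K = 1])
  show "flatten (u + v) = flatten u + flatten v" for u v :: "'a tensor_algebra"
    unfolding flatten_def suminf_add[OF summable_component summable_component]
    by (intro suminf_cong) simp
  show "flatten (c *\<^sub>C u) = c *\<^sub>C flatten u" for c and u :: "'a tensor_algebra"
    unfolding flatten_def bounded_linear.suminf[OF bounded_linear_scaleC summable_component]
    by (intro suminf_cong) simp
  show "norm (flatten u) \<le> 1 * norm u" for u :: "'a tensor_algebra"
    by (simp add: norm_flatten_le)
qed

lemma flatten_word [simp]: "flatten (word w) = tensor w"
proof -
  have "flatten (word w) = (\<Sum>k\<in>{length w}. component (word w) k)"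
    unfolding flatten_def by (rule suminf_finite) (auto simp: component_word)
  then show ?thesis by (simp add: component_word)
qed

lemma tensor_lift_word_flatten: "tensor_lift word (flatten u) = u"
proof (rule tensor_algebra_eqI)
  fix j
  let ?P = "\<lambda>x. component (tensor_lift word x) j"
  have P: "bounded_clinear ?P"
    by (rule bounded_clinear_compose[OF bounded_clinear_component
          bounded_clinear_tensor_lift[OF bounded_multilinear_word]])
  \<comment> \<open>Checked on words of length \<open>k\<close>: \<open>word\<close> puts such a
    word into degree \<open>k\<close> and nowhere else. Both sides are bounded, so this decides the
    whole tensor power.\<close>
  have eq: "?P (component u k) = (if k = j then component u j else 0)" for k
  proof (cases "k = j")
    case True
    have "?P (component u j) = component u j"
      by (rule tensor_power_eqI[OF P _ _ component_in])
         (auto simp: tensor_lift_tensor[OF bounded_multilinear_word] component_word intro: bounded_clinearI[where K = 1])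
    then show ?thesis using True by simp
  next
    case False
    have "?P (component u k) = 0"
      by (rule tensor_power_eqI[OF P _ _ component_in])
         (use False in \<open>auto simp: tensor_lift_tensor[OF bounded_multilinear_word] component_word
            intro: bounded_clinearI[where K = 0]\<close>)
    then show ?thesis using False by simp
  qed
  have "?P (flatten u) = (\<Sum>k. ?P (component u k))"
    unfolding flatten_def by (rule bounded_linear.suminf[OF bounded_clinearD(1)[OF P] summable_component])
  also have "\<dots> = (\<Sum>k\<in>{j}. ?P (component u k))"
    by (rule suminf_finite) (auto simp: eq)
  finally show "?P (flatten u) = component u j" by (simp add: eq)
qed

lemma tensor_algebra_clinear_eqI:
  assumes "bounded_clinear F" "bounded_clinear G" "\<And>w. F (word w) = G (word w)"
  shows "F u = G u"
proof -
  note P = bounded_clinear_tensor_lift[OF bounded_multilinear_word]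
  have "F (tensor_lift word (flatten u)) = G (tensor_lift word (flatten u))"
    by (rule ptensor_eqI[OF bounded_clinear_compose[OF assms(1) P] bounded_clinear_compose[OF assms(2) P]])
       (simp add: tensor_lift_tensor[OF bounded_multilinear_word] assms(3))
  then show ?thesis by (simp add: tensor_lift_word_flatten)
qed

section \<open>Functions of several arguments from the tensor algebra\<close>

lemma multilinear_bounded_clinear_arg:
  assumes "bounded_multilinear f"
  shows "bounded_clinear (\<lambda>a. f (us @ a # vs))"
proof -
  obtain K where ml: "multilinear f" and K: "\<And>w. norm (f w) \<le> K * word_norm w"
    using assms unfolding bounded_multilinear_def by blast
  show ?thesis
  proof (rule bounded_clinearI[where K = "K * (word_norm us * word_norm vs)"])
    show "norm (f (us @ a # vs)) \<le> K * (word_norm us * word_norm vs) * norm a" for a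
      using K[of "us @ a # vs"] by (simp add: mult_ac)
  qed (use ml in \<open>simp_all add: multilinear_def\<close>)
qed

text \<open>The arguments are freed from left to right: \<open>us\<close> holds those that are
  already arbitrary, and density of the words frees the next one.\<close>

lemma multilinear_eq_0_on_words:
  assumes "bounded_multilinear f" "\<And>ws. f (us @ map word ws) = 0"
  shows "f (us @ as) = 0"
  using assms(2)
proof (induction as arbitrary: us)
  case Nil
  from Nil[of "[]"] show ?case by simp
next
  case (Cons a as)
  have "f ((us @ [a]) @ map word ws) = 0" for ws
  proof -
    have "f (us @ a # map word ws) = 0"
      by (rule tensor_algebra_clinear_eqI[OF multilinear_bounded_clinear_arg[OF assms(1)], of "\<lambda>_. 0"])
         (use Cons.prems[of "_ # ws"] in \<open>auto intro: bounded_clinearI[where K = 0]\<close>)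
    then show ?thesis by simp
  qed
  from Cons.IH[OF this] show ?case by simp
qed

text \<open>Linearity is in every letter of every word, and \<open>K\<close> serves all numbers and
  lengths of words at once.\<close>

definition word_multilinear :: "real \<Rightarrow> ('v :: complex_banach list list \<Rightarrow> complex) \<Rightarrow> bool" where
  "word_multilinear K F \<longleftrightarrow>
     (\<forall>uss wss. multilinear (\<lambda>w. F (uss @ w # wss))) \<and> (\<forall>ws. cmod (F ws) \<le> K * word_norm (concat ws))"

lemma word_multilinearD:
  assumes "word_multilinear K F"
  shows "F (uss @ (us @ (a + b) # vs) # wss) = F (uss @ (us @ a # vs) # wss) + F (uss @ (us @ b # vs) # wss)"
    "F (uss @ (us @ (c *\<^sub>C a) # vs) # wss) = c * F (uss @ (us @ a # vs) # wss)"
    "cmod (F ws) \<le> K * word_norm (concat ws)"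
  using assms by (auto simp: word_multilinear_def multilinear_def scaleC_complex_def)

lemma word_multilinearI:
  assumes "\<And>uss us a b vs wss.
      F (uss @ (us @ (a + b) # vs) # wss) = F (uss @ (us @ a # vs) # wss) + F (uss @ (us @ b # vs) # wss)"
    and "\<And>uss us c a vs wss. F (uss @ (us @ (c *\<^sub>C a) # vs) # wss) = c * F (uss @ (us @ a # vs) # wss)"
    and "\<And>ws. cmod (F ws) \<le> K * word_norm (concat ws)"
  shows "word_multilinear K F"
  using assms by (auto simp: word_multilinear_def multilinear_def scaleC_complex_def)

lemma word_multilinear_Cons:
  assumes "word_multilinear K F"
  shows "word_multilinear (K * word_norm w) (\<lambda>ws. F (w # ws))"
  using word_multilinearD[OF assms, of "w # _"] word_multilinearD(3)[OF assms, of "w # _"]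
  by (intro word_multilinearI) (simp_all add: mult.assoc)

lemma tensor_lift_add:
  assumes "bounded_multilinear f" "bounded_multilinear g"
  shows "tensor_lift (\<lambda>w. f w + g w) u = tensor_lift f u + tensor_lift g u"
  by (rule ptensor_eqI[OF bounded_clinear_tensor_lift[OF bounded_multilinear_add[OF assms]]
        bounded_clinear_add[OF assms[THEN bounded_clinear_tensor_lift]]])
     (simp add: assms bounded_multilinear_add tensor_lift_tensor)

lemma tensor_lift_scaleC:
  assumes "bounded_multilinear f"
  shows "tensor_lift (\<lambda>w. c *\<^sub>C f w) u = c *\<^sub>C tensor_lift f u"
  by (rule ptensor_eqI[OF bounded_clinear_tensor_lift[OF bounded_multilinear_scaleC[OF assms]]
        bounded_clinear_scaleC[OF assms[THEN bounded_clinear_tensor_lift]]])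
     (simp add: assms bounded_multilinear_scaleC tensor_lift_tensor)

text \<open>\<open>tensor_lift\<close> handles one tensor at a time, so the arguments are lifted
  successively, with the words chosen so far stored in the function.\<close>

primrec word_extension ::
  "'v :: complex_banach tensor_algebra list \<Rightarrow> ('v list list \<Rightarrow> complex) \<Rightarrow> complex" where
  "word_extension [] F = F []"
| "word_extension (a # as) F = tensor_lift (\<lambda>w. word_extension as (\<lambda>ws. F (w # ws))) (flatten a)"

text \<open>The assumptions on \<open>as\<close> are the claims of the simultaneous induction below.
  Stating them as hypotheses lets the same argument serve inside that induction and after
  it.\<close>

lemma word_extension_arg:
  assumes F: "word_multilinear K F"
    and bound: "\<And>F K. word_multilinear K F \<Longrightarrow> cmod (word_extension as F) \<le> K * word_norm as"
    and add: "\<And>F G K L. word_multilinear K F \<Longrightarrow> word_multilinear L G \<Longrightarrow>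
        word_extension as (\<lambda>ws. F ws + G ws) = word_extension as F + word_extension as G"
    and mult: "\<And>F K c. word_multilinear K F \<Longrightarrow>
        word_extension as (\<lambda>ws. c * F ws) = c * word_extension as F"
  shows "multilinear (\<lambda>w. word_extension as (\<lambda>ws. F (w # ws)))"
    "cmod (word_extension as (\<lambda>ws. F (w # ws))) \<le> K * word_norm as * word_norm w"
proof -
  note Fw = word_multilinear_Cons[OF F]
  show "multilinear (\<lambda>w. word_extension as (\<lambda>ws. F (w # ws)))"
    unfolding multilinear_def scaleC_complex_def
    using word_multilinearD(1,2)[OF F, of "[]"]
    by (simp add: add[OF Fw Fw] mult[OF Fw])
  show "cmod (word_extension as (\<lambda>ws. F (w # ws))) \<le> K * word_norm as * word_norm w"
    using bound[OF Fw] by (simp add: mult_ac)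
qed

text \<open>The three claims need each other: lifting the first argument requires the inner
  extension to be bounded and multilinear in \<open>w\<close>, which is boundedness and linearity in
  \<open>F\<close> for the shorter list.\<close>

lemma
  shows word_extension_bound: "word_multilinear K F \<Longrightarrow> cmod (word_extension as F) \<le> K * word_norm as"
    and word_extension_add: "word_multilinear K F \<Longrightarrow> word_multilinear L G \<Longrightarrow>
        word_extension as (\<lambda>ws. F ws + G ws) = word_extension as F + word_extension as G"
    and word_extension_mult: "word_multilinear K F \<Longrightarrow>
        word_extension as (\<lambda>ws. c * F ws) = c * word_extension as F"
proof (induction as arbitrary: K F L G c)
  case Nil
  { case 1 then show ?case using word_multilinearD(3)[of K F "[]"] by simp }
  { case 2 show ?case by simp }
  { case 3 show ?case by simp }
next
  case (Cons a as)
  have arg: "multilinear (\<lambda>w. word_extension as (\<lambda>ws. F (w # ws)))"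
    "cmod (word_extension as (\<lambda>ws. F (w # ws))) \<le> K * word_norm as * word_norm w"
    if "word_multilinear K F" for K F w
  proof -
    show "multilinear (\<lambda>w. word_extension as (\<lambda>ws. F (w # ws)))"
      by (rule word_extension_arg(1)[OF that]) (rule Cons.IH, assumption+)+
    show "cmod (word_extension as (\<lambda>ws. F (w # ws))) \<le> K * word_norm as * word_norm w"
      by (rule word_extension_arg(2)[OF that]) (rule Cons.IH, assumption+)+
  qed
  have bm: "bounded_multilinear (\<lambda>w. word_extension as (\<lambda>ws. F (w # ws)))" if "word_multilinear K F" for K F
    using arg[OF that] unfolding bounded_multilinear_def by blast
  { case 1
    have "cmod (word_extension (a # as) F) \<le> K * word_norm as * norm (flatten a)"
      unfolding word_extension.simps by (rule tensor_lift_bound[OF arg[OF 1]])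
    also have "\<dots> \<le> K * word_norm as * norm a"
    proof (rule mult_left_mono)
      show "norm (flatten a) \<le> norm a" by (rule norm_flatten_le)
      have "0 \<le> K" using order_trans[OF norm_ge_zero word_multilinearD(3)[OF 1, of "[]"]] by simp
      then show "0 \<le> K * word_norm as" by simp
    qed
    finally show ?case by (simp add: mult_ac) }
  { case 2
    show ?case
      by (simp add: Cons.IH(2)[OF word_multilinear_Cons[OF 2(1)] word_multilinear_Cons[OF 2(2)]]
          tensor_lift_add bm[OF 2(1)] bm[OF 2(2)]) }
  { case 3
    show ?case
      using tensor_lift_scaleC[OF bm[OF 3], of c "flatten a"]
      by (simp add: Cons.IH(3)[OF word_multilinear_Cons[OF 3]] scaleC_complex_def) }
qed

lemma bounded_multilinear_word_extension_arg:
  assumes "word_multilinear K F"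
  shows "bounded_multilinear (\<lambda>w. word_extension as (\<lambda>ws. F (w # ws)))"
proof -
  note linear = word_extension_bound word_extension_add word_extension_mult
  have "multilinear (\<lambda>w. word_extension as (\<lambda>ws. F (w # ws)))"
    by (rule word_extension_arg(1)[OF assms]) (rule linear, assumption+)+
  moreover have "cmod (word_extension as (\<lambda>ws. F (w # ws))) \<le> K * word_norm as * word_norm w" for w
    by (rule word_extension_arg(2)[OF assms]) (rule linear, assumption+)+
  ultimately show ?thesis unfolding bounded_multilinear_def by blast
qed

lemma bounded_multilinear_word_extension:
  assumes "word_multilinear K F"
  shows "bounded_multilinear (\<lambda>as. word_extension as F)"
proof -
  have add: "word_extension (us @ (a + b) # vs) F = word_extension (us @ a # vs) F + word_extension (us @ b # vs) F"
    if "word_multilinear K F" for us vs a b K and F :: "'a list list \<Rightarrow> complex"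
    using that
  proof (induction us arbitrary: F K)
    case Nil
    show ?case
      by (simp add: bounded_clinearD(2)[OF bounded_clinear_flatten]
          bounded_clinearD(2)[OF bounded_clinear_tensor_lift[OF bounded_multilinear_word_extension_arg[OF Nil]]])
  next
    case (Cons u us)
    show ?case
      by (simp add: Cons.IH[OF word_multilinear_Cons[OF Cons.prems]] tensor_lift_add
          bounded_multilinear_word_extension_arg[OF Cons.prems])
  qed
  have scale: "word_extension (us @ (c *\<^sub>C a) # vs) F = c *\<^sub>C word_extension (us @ a # vs) F"
    if "word_multilinear K F" for us vs a c K and F :: "'a list list \<Rightarrow> complex"
    using that
  proof (induction us arbitrary: F K)
    case Nil
    show ?case
      by (simp add: bounded_clinearD(5)[OF bounded_clinear_flatten]
          bounded_clinearD(5)[OF bounded_clinear_tensor_lift[OF bounded_multilinear_word_extension_arg[OF Nil]]])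
  next
    case (Cons u us)
    show ?case
      by (simp add: Cons.IH[OF word_multilinear_Cons[OF Cons.prems]] tensor_lift_scaleC
          bounded_multilinear_word_extension_arg[OF Cons.prems])
  qed
  show ?thesis
    unfolding bounded_multilinear_def multilinear_def
    using add[OF assms] scale[OF assms] word_extension_bound[OF assms] by blast
qed

lemma word_extension_words:
  assumes "word_multilinear K F"
  shows "word_extension (map word ws) F = F ws"
  using assms
proof (induction ws arbitrary: K F)
  case (Cons w ws)
  have "word_extension (map word (w # ws)) F = word_extension (map word ws) (\<lambda>vs. F (w # vs))"
    unfolding list.map word_extension.simps flatten_word
    by (rule tensor_lift_tensor[OF bounded_multilinear_word_extension_arg[OF Cons.prems]])
  then show ?case by (simp only: Cons.IH[OF word_multilinear_Cons[OF Cons.prems]])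
qed simp

section \<open>Cochains as functions of words\<close>

lemma hochschild_chains_subspace: "complex_vector.subspace (hochschild_chains n)"
  unfolding hochschild_chains_def by (rule tensor_power_subspace)

lemma tensor_in_hochschild_chains: "length a = Suc n \<Longrightarrow> tensor a \<in> hochschild_chains n"
  unfolding hochschild_chains_def by (rule tensor_in_tensor_power) simp

lemma hochschild_cochainsD:
  assumes "T \<in> hochschild_cochains n"
  shows "x \<in> hochschild_chains n \<Longrightarrow> y \<in> hochschild_chains n \<Longrightarrow> T (x + y) = T x + T y"
    "x \<in> hochschild_chains n \<Longrightarrow> T (c *\<^sub>C x) = c * T x"
    "x \<notin> hochschild_chains n \<Longrightarrow> T x = 0"
  using assms by (simp_all add: hochschild_cochains_def)

lemma hochschild_cochain_bound:
  assumes "T \<in> hochschild_cochains n"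
  obtains K where "K \<ge> 0" "\<And>x. cmod (T x) \<le> K * norm x"
proof -
  obtain K where K: "\<And>x. x \<in> hochschild_chains n \<Longrightarrow> cmod (T x) \<le> K * norm x"
    using assms unfolding hochschild_cochains_def by blast
  have "cmod (T x) \<le> \<bar>K\<bar> * norm x" for x
  proof (cases "x \<in> hochschild_chains n")
    case True
    from K[OF this] show ?thesis
      by (rule order_trans) (simp add: mult_right_mono)
  qed (simp add: hochschild_cochainsD(3)[OF assms])
  then show ?thesis using that[of "\<bar>K\<bar>"] by simp
qed

lemma hochschild_cochain_sum:
  assumes T: "T \<in> hochschild_cochains n" and "finite A" "\<And>i. i \<in> A \<Longrightarrow> f i \<in> hochschild_chains n"
  shows "T (\<Sum>i\<in>A. c i *\<^sub>C f i) = (\<Sum>i\<in>A. c i * T (f i))"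
  using assms(2,3)
proof (induction A)
  case empty
  show ?case
    using hochschild_cochainsD(2)[OF T complex_vector.subspace_0[OF hochschild_chains_subspace], of 0] by simp
next
  case (insert i A)
  have "(\<Sum>i\<in>A. c i *\<^sub>C f i) \<in> hochschild_chains n" "c i *\<^sub>C f i \<in> hochschild_chains n"
    using insert.prems
    by (auto intro!: complex_vector.subspace_sum complex_vector.subspace_scale hochschild_chains_subspace)
  then show ?case
    using insert by (simp add: hochschild_cochainsD(1,2)[OF T])
qed

lemma hochschild_cochainsI:
  assumes "bounded_clinear G"
  shows "(\<lambda>x. if x \<in> hochschild_chains n then G x else 0) \<in> hochschild_cochains n"
proof -
  obtain K where "\<And>x. norm (G x) \<le> norm x * K"
    using bounded_linear.bounded[OF bounded_clinearD(1)[OF assms]] by blast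
  then have "\<exists>K. \<forall>x\<in>hochschild_chains n. cmod (G x) \<le> K * norm x"
    by (metis mult.commute)
  then show ?thesis
    by (simp add: hochschild_cochains_def bounded_clinearD[OF assms] scaleC_complex_def
      complex_vector.subspace_add complex_vector.subspace_scale hochschild_chains_subspace)
qed

lemma hochschild_cochains_compose:
  assumes T: "T \<in> hochschild_cochains n" and G: "bounded_clinear G"
    and maps: "\<And>x. x \<in> hochschild_chains m \<Longrightarrow> G x \<in> hochschild_chains n"
  shows "(\<lambda>x. if x \<in> hochschild_chains m then T (G x) else 0) \<in> hochschild_cochains m"
proof -
  obtain L where L: "\<And>x. norm (G x) \<le> norm x * L"
    using bounded_linear.bounded[OF bounded_clinearD(1)[OF G]] by blast
  obtain K where K: "K \<ge> 0" "\<And>x. cmod (T x) \<le> K * norm x"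
    using hochschild_cochain_bound[OF T] by blast
  have "cmod (T (G x)) \<le> (K * L) * norm x" for x
    using order_trans[OF K(2) mult_left_mono[OF L K(1)]] by (simp add: mult_ac)
  then have "\<exists>K. \<forall>x\<in>hochschild_chains m. cmod (T (G x)) \<le> K * norm x" by blast
  then show ?thesis
    by (simp add: hochschild_cochains_def bounded_clinearD[OF G] hochschild_cochainsD[OF T] maps
      complex_vector.subspace_add complex_vector.subspace_scale hochschild_chains_subspace)
qed

lemma hochschild_cochains_linear:
  assumes S: "S \<in> hochschild_cochains n" and T: "T \<in> hochschild_cochains n"
  shows "(\<lambda>x. S x + c * T x) \<in> hochschild_cochains n"
proof -
  obtain K where K: "\<And>x. cmod (S x) \<le> K * norm x" using hochschild_cochain_bound[OF S] by blast
  obtain L where L: "\<And>x. cmod (T x) \<le> L * norm x" using hochschild_cochain_bound[OF T] by blast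
  have "cmod (S x + c * T x) \<le> (K + cmod c * L) * norm x" for x
    using norm_triangle_ineq[of "S x" "c * T x"] K[of x] mult_left_mono[OF L[of x], of "cmod c"]
    by (simp add: norm_mult algebra_simps)
  then have "\<exists>K. \<forall>x\<in>hochschild_chains n. cmod (S x + c * T x) \<le> K * norm x" by blast
  then show ?thesis
    by (simp add: hochschild_cochains_def hochschild_cochainsD[OF S] hochschild_cochainsD[OF T] algebra_simps)
qed

text \<open>A cochain is linear on the chains only, so the principle \<open>tensor_power_eqI\<close>
  for globally linear maps does not apply; the density argument is repeated inside the closed
  subspace.\<close>

lemma hochschild_cochain_eq_0:
  assumes T: "T \<in> hochschild_cochains n" and zero: "\<And>a. length a = Suc n \<Longrightarrow> T (tensor a) = 0"
  shows "T = (\<lambda>_. 0)"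
proof
  fix x
  show "T x = 0"
  proof (cases "x \<in> hochschild_chains n")
    case True
    let ?A = "tensor ` {w. length w = n + 1}"
    note sub = hochschild_chains_subspace[of n]
    have span: "y \<in> hochschild_chains n \<and> T y = 0" if "y \<in> complex_vector.span ?A" for y
      using that
    proof (induction rule: complex_vector.span_induct_alt)
      case base
      show ?case
        using hochschild_cochain_sum[OF T, of "{}"] complex_vector.subspace_0[OF sub] by simp
    next
      case (step c y z)
      then have y: "y \<in> hochschild_chains n" "T y = 0" using zero by (auto intro: tensor_in_hochschild_chains)
      then have "c *\<^sub>C y \<in> hochschild_chains n" using complex_vector.subspace_scale[OF sub] by blast
      moreover from this have "c *\<^sub>C y + z \<in> hochschild_chains n"
        using step complex_vector.subspace_add[OF sub] by blast
      ultimately show ?case using step y by (simp add: hochschild_cochainsD[OF T])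
    qed
    obtain K where K: "\<And>x. cmod (T x) \<le> K * norm x" using hochschild_cochain_bound[OF T] by blast
    obtain X where X: "\<And>n. X n \<in> complex_vector.span ?A" "X \<longlonglongrightarrow> x"
      using True unfolding hochschild_chains_def tensor_power_def closure_sequential by blast
    have "T x = T (X k + (x - X k))" for k by simp
    also have "\<dots> k = T (x - X k)" for k
      using span[OF X(1)] complex_vector.subspace_diff[OF sub True] by (subst hochschild_cochainsD(1)[OF T]) auto
    finally have "cmod (T x) \<le> K * norm (x - X k)" for k using K by metis
    moreover have "(\<lambda>k. K * norm (x - X k)) \<longlonglongrightarrow> K * norm (x - x)"
      by (intro tendsto_intros X)
    ultimately have "cmod (T x) \<le> K * norm (x - x)"
      by (intro LIMSEQ_le_const) auto
    then show ?thesis by simp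
  qed (simp add: hochschild_cochainsD(3)[OF T])
qed

lemma bounded_multilinear_cochain:
  assumes T: "T \<in> hochschild_cochains n"
  shows "bounded_multilinear (\<lambda>a. if length a = Suc n then T (tensor a) else 0)"
proof -
  obtain K where K: "K \<ge> 0" "\<And>x. cmod (T x) \<le> K * norm x" using hochschild_cochain_bound[OF T] by blast
  have "cmod (T (tensor a)) \<le> K * word_norm a" for a
    using order_trans[OF K(2) mult_left_mono[OF norm_tensor_le K(1)]] .
  then have "\<exists>K. \<forall>a. cmod (if length a = Suc n then T (tensor a) else 0) \<le> K * word_norm a"
    using K(1) by (intro exI[of _ K]) simp
  then show ?thesis
    unfolding bounded_multilinear_def multilinear_def
    by (auto simp: tensor_add tensor_scaleC hochschild_cochainsD[OF T] tensor_in_hochschild_chains scaleC_complex_def)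
qed

definition word_values :: "nat \<Rightarrow> 'v :: complex_banach tensor_algebra cochain \<Rightarrow> 'v list list \<Rightarrow> complex" where
  "word_values n T ws = (if length ws = Suc n then T (tensor (map word ws)) else 0)"

lemma word_values_eq: "length ws = Suc n \<Longrightarrow> word_values n T ws = T (tensor (map word ws))"
  by (simp add: word_values_def)

lemma cochain_eqI:
  assumes S: "S \<in> hochschild_cochains n" and T: "T \<in> hochschild_cochains n"
    and eq: "\<And>ws. length ws = Suc n \<Longrightarrow> S (tensor (map word ws)) = T (tensor (map word ws))"
  shows "S = T"
proof -
  have D: "(\<lambda>x. S x + (- 1) * T x) \<in> hochschild_cochains n" (is "?D \<in> _")
    by (rule hochschild_cochains_linear[OF S T])
  have "?D = (\<lambda>_. 0)"
  proof (rule hochschild_cochain_eq_0[OF D])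
    fix a :: "'a tensor_algebra list" assume a: "length a = Suc n"
    have "(if length ([] @ a) = Suc n then ?D (tensor ([] @ a)) else 0) = 0"
      by (rule multilinear_eq_0_on_words[OF bounded_multilinear_cochain[OF D]]) (simp add: eq)
    then show "?D (tensor a) = 0" using a by simp
  qed
  then show ?thesis by (simp add: fun_eq_iff)
qed

lemma word_multilinear_word_values:
  assumes T: "T \<in> hochschild_cochains n"
  obtains K where "word_multilinear K (word_values n T)"
proof -
  obtain K where K: "K \<ge> 0" "\<And>x. cmod (T x) \<le> K * norm x" using hochschild_cochain_bound[OF T] by blast
  have le: "word_norm (map word ws) \<le> word_norm (concat ws)" for ws :: "'a list list"
    by (induction ws) (auto intro!: mult_mono norm_word_le)
  have add: "word (us @ (a + b) # vs) = word (us @ a # vs) + word (us @ b # vs)"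
    and scale: "word (us @ (c *\<^sub>C a) # vs) = c *\<^sub>C word (us @ a # vs)" for us vs :: "'a list" and a b c
    using bounded_multilinear_word unfolding bounded_multilinear_def multilinear_def by blast+
  have "word_multilinear K (word_values n T)"
  proof (rule word_multilinearI)
    fix ws :: "'a list list"
    have "cmod (T (tensor (map word ws))) \<le> K * norm (tensor (map word ws))" by (rule K)
    also have "\<dots> \<le> K * word_norm (concat ws)"
      by (rule mult_left_mono[OF order_trans[OF norm_tensor_le le] K(1)])
    finally show "cmod (word_values n T ws) \<le> K * word_norm (concat ws)"
      using K(1) by (simp add: word_values_def)
  qed (simp_all add: word_values_def add scale tensor_add tensor_scaleC hochschild_cochainsD[OF T] tensor_in_hochschild_chains)
  then show ?thesis by (rule that)
qed

text \<open>The converse of \<open>word_multilinear_word_values\<close>; by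
  \<open>cochain_eqI\<close> the cochain is unique. Cochains can thus be defined by formulas on
  words.\<close>

lemma ex_cochain_word_values:
  assumes F: "word_multilinear K F"
  obtains T where "T \<in> hochschild_cochains n" "\<And>ws. length ws = Suc n \<Longrightarrow> T (tensor (map word ws)) = F ws"
proof -
  let ?f = "\<lambda>a. if length a = Suc n then word_extension a F else 0"
  have f: "bounded_multilinear ?f"
  proof -
    have K: "K \<ge> 0" using order_trans[OF norm_ge_zero word_multilinearD(3)[OF F, of "[]"]] by simp
    have "\<exists>K. \<forall>a. cmod (?f a) \<le> K * word_norm a"
      using word_extension_bound[OF F] K by (intro exI[of _ K]) simp
    then show ?thesis
      using bounded_multilinear_word_extension[OF F] unfolding bounded_multilinear_def multilinear_def by simp
  qed
  show ?thesis
    by (rule that[OF hochschild_cochainsI[OF bounded_clinear_tensor_lift[OF f]]])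
       (simp add: tensor_in_hochschild_chains tensor_lift_tensor[OF f] word_extension_words[OF F])
qed

text \<open>\<open>word\<close> turns concatenation into the product, so the boundary of a tuple of
  words stays among tuples of words.\<close>

lemma hochschild_coboundary_words:
  assumes T: "T \<in> hochschild_cochains n" and ws: "length ws = n + 2"
  shows "hochschild_coboundary n T (tensor (map word ws)) = word_coboundary (word_values n T) ws"
proof -
  have wrap: "tl (butlast (map word ws)) @ [last (map word ws) * hd (map word ws)] = map word (wrap ws)"
  proof -
    have "ws \<noteq> []" using ws by auto
    then show ?thesis by (simp add: wrap_def map_butlast[symmetric] map_tl last_map hd_map word_times)
  qed
  have merge: "take (j - 1) (map word ws) @ [map word ws ! (j - 1) * map word ws ! j] @ drop (j + 1) (map word ws)
      = map word (merge_at j ws)" if "j \<in> {1..n + 1}" for j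
  proof -
    have "j - 1 < length ws" "j < length ws" using that ws by auto
    then show ?thesis by (simp only: merge_at_def take_map drop_map word_times nth_map map_append list.map)
  qed
  have in_chains: "tensor (map word (wrap ws)) \<in> hochschild_chains n"
    "\<And>j. j \<in> {1..n + 1} \<Longrightarrow> tensor (map word (merge_at j ws)) \<in> hochschild_chains n"
    using ws by (auto intro!: tensor_in_hochschild_chains)
  have "hochschild_boundary n (tensor (map word ws)) = tensor (map word (wrap ws))
      + (\<Sum>j=1..n + 1. (- 1) ^ j *\<^sub>C tensor (map word (merge_at j ws)))"
    using ws by (simp only: hochschild_boundary_tensor length_map hochschild_boundary_word_def wrap merge cong: sum.cong)
  moreover have "(\<Sum>j=1..n + 1. (- 1) ^ j *\<^sub>C tensor (map word (merge_at j ws))) \<in> hochschild_chains n"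
    using in_chains
    by (intro complex_vector.subspace_sum complex_vector.subspace_scale hochschild_chains_subspace)
  ultimately have "T (hochschild_boundary n (tensor (map word ws))) = T (tensor (map word (wrap ws)))
      + (\<Sum>j=1..n + 1. (- 1) ^ j * T (tensor (map word (merge_at j ws))))"
    using in_chains by (simp only: hochschild_cochainsD(1)[OF T] hochschild_cochain_sum[OF T] finite_atLeastAtMost)
  also have "\<dots> = word_coboundary (word_values n T) ws"
    unfolding word_coboundary_def using ws by (intro arg_cong2[where f = "(+)"] sum.cong) (simp_all add: word_values_def)
  finally show ?thesis
    using ws by (simp add: hochschild_coboundary_def tensor_in_hochschild_chains)
qed

lemma hochschild_coboundary_in:
  "T \<in> hochschild_cochains n \<Longrightarrow> hochschild_coboundary n T \<in> hochschild_cochains (Suc n)"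
  unfolding hochschild_coboundary_def Suc_eq_plus1
  by (rule hochschild_cochains_compose[OF _ bounded_clinear_hochschild_boundary hochschild_boundary_in_hochschild_chains])

text \<open>\<open>cyclic_shift\<close> undoes \<open>rotate1\<close> up to a sign that is its own
  inverse. Composing \<open>T\<close> with it gives a cochain, so agreement with \<open>T\<close>
  can be tested on words.\<close>

lemma cyclic_cochains_iff:
  "T \<in> cyclic_cochains n \<longleftrightarrow> T \<in> hochschild_cochains n \<and>
     (\<forall>ws. length ws = Suc n \<longrightarrow> word_values n T (rotate1 ws) = (- 1) ^ n * word_values n T ws)"
proof -
  have shift: "T (cyclic_shift n (tensor (map word (rotate1 ws)))) = (- 1) ^ n * word_values n T ws"
    if "T \<in> hochschild_cochains n" "length ws = Suc n" for ws
  proof -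
    have "last (map word (rotate1 ws)) # butlast (map word (rotate1 ws)) = map word ws"
      using that by (cases ws) auto
    then show ?thesis
      using that by (simp add: cyclic_shift_tensor hochschild_cochainsD[OF that(1)] tensor_in_hochschild_chains word_values_eq)
  qed
  show ?thesis
  proof safe
    assume T: "T \<in> cyclic_cochains n"
    then show T': "T \<in> hochschild_cochains n" by (simp add: cyclic_cochains_def)
    fix ws :: "'a list list" assume "length ws = Suc n"
    then show "word_values n T (rotate1 ws) = (- 1) ^ n * word_values n T ws"
      using T by (simp add: cyclic_cochains_def word_values_eq[of "rotate1 ws"] tensor_in_hochschild_chains flip: shift[OF T'])
  next
    assume T: "T \<in> hochschild_cochains n"
      and rot: "\<forall>ws. length ws = Suc n \<longrightarrow> word_values n T (rotate1 ws) = (- 1) ^ n * word_values n T ws"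
    have "(\<lambda>x. if x \<in> hochschild_chains n then T (cyclic_shift n x) else 0) = T"
    proof (rule cochain_eqI[OF hochschild_cochains_compose[OF T bounded_clinear_cyclic_shift cyclic_shift_in_hochschild_chains] T])
      fix ws :: "'a list list" assume ws: "length ws = Suc n"
      define vs where "vs = last ws # butlast ws"
      have vs: "length vs = Suc n" "rotate1 vs = ws" using ws by (auto simp: vs_def intro!: append_butlast_last_id)
      show "(if tensor (map word ws) \<in> hochschild_chains n then T (cyclic_shift n (tensor (map word ws))) else 0)
          = T (tensor (map word ws))"
        using shift[OF T vs(1)] rot[rule_format, OF vs(1)] vs(2)
        by (simp add: tensor_in_hochschild_chains ws word_values_eq)
    qed
    then have "T (cyclic_shift n x) = T x" if "x \<in> hochschild_chains n" for x
      using that by (metis (mono_tags, lifting))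
    then show "T \<in> cyclic_cochains n"
      using T unfolding cyclic_cochains_def by blast
  qed
qed

section \<open>The contracting homotopy\<close>

text \<open>The new position of a slot does not depend on its content, so composing with a rotation
  preserves linearity in that slot.\<close>

lemma rotate_slot: "\<exists>uss' wss'. \<forall>w. rotate k (uss @ w # wss) = uss' @ w # wss'"
proof (induction k)
  case 0
  show ?case by auto
next
  case (Suc k)
  then obtain uss' wss' where *: "\<And>w. rotate k (uss @ w # wss) = uss' @ w # wss'" by blast
  show ?case
  proof (cases uss')
    case Nil
    then have "\<forall>w. rotate (Suc k) (uss @ w # wss) = wss' @ w # []" by (simp add: *)
    then show ?thesis by blast
  next
    case (Cons u us)
    then have "\<forall>w. rotate (Suc k) (uss @ w # wss) = us @ w # (wss' @ [u])" by (simp add: *)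
    then show ?thesis by blast
  qed
qed

lemma cut_last_slot:
  "\<exists>uss' us' vs' wss'. \<forall>a. drop l (last (uss @ (us @ a # vs) # wss))
      # butlast (uss @ (us @ a # vs) # wss) @ [take l (last (uss @ (us @ a # vs) # wss))]
    = uss' @ (us' @ a # vs') # wss'"
proof (cases wss rule: rev_cases)
  case (snoc b y)
  then show ?thesis
    by (intro exI[of _ "drop l y # uss"] exI[of _ us] exI[of _ vs] exI[of _ "b @ [take l y]"])
       (simp add: butlast_append)
next
  case Nil
  show ?thesis
  proof (cases "l \<le> length us")
    case True
    then show ?thesis using Nil
      by (intro exI[of _ "[]"] exI[of _ "drop l us"] exI[of _ vs] exI[of _ "uss @ [take l us]"]) simp
  next
    case False
    \<comment> \<open>The cut lies behind the letter \<open>a\<close>; the subtracted 1 counts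
      \<open>a\<close> itself.\<close>
    then have "l - length us = Suc (l - length us - 1)" by simp
    then show ?thesis using Nil False
      by (intro exI[of _ "drop (l - length us - 1) vs # uss"] exI[of _ us]
            exI[of _ "take (l - length us - 1) vs"] exI[of _ "[]"])
         (simp add: drop_Cons' take_Cons')
  qed
qed

lemma word_norm_concat_rotate: "word_norm (concat (rotate k x)) = word_norm (concat x)"
proof (induction k)
  case (Suc k)
  have "word_norm (concat (rotate1 y)) = word_norm (concat y)" for y :: "'a list list"
    by (cases y) simp_all
  then show ?case using Suc by simp
qed simp

lemma length_concat_rotate1 [simp]: "length (concat (rotate1 x)) = length (concat x)"
  by (cases x) simp_all

lemma cut_last_bound:
  assumes F: "word_multilinear K F" and "x \<noteq> []"
  shows "cmod (cut_last F x) \<le> real (length (last x)) * (K * word_norm (concat x))"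
proof -
  obtain b w where x: "x = b @ [w]" using assms(2) by (cases x rule: rev_cases) auto
  have "cmod (F (drop l w # b @ [take l w])) \<le> K * word_norm (concat x)" for l
  proof -
    have "word_norm w = word_norm (take l w) * word_norm (drop l w)"
      by (simp flip: word_norm_simps(3))
    then show ?thesis
      using word_multilinearD(3)[OF F, of "drop l w # b @ [take l w]"] by (simp add: x mult_ac)
  qed
  then have "cmod (\<Sum>l<length w. F (drop l w # b @ [take l w])) \<le> (\<Sum>l<length w. K * word_norm (concat x))"
    by (rule sum_norm_le)
  then show ?thesis by (simp add: cut_last_def x)
qed

text \<open>
  The number of terms in \<open>cyc (cut_last F) x\<close> is the number of letters of \<open>x\<close>, which is why
  the same bound \<open>K\<close> serves for the average.  If \<open>x\<close> has no letters, the quotient is \<open>0 / 0 = 0\<close>.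
\<close>

lemma word_multilinear_cyc_cut_last:
  assumes F: "word_multilinear K F"
  shows "word_multilinear K (\<lambda>x. cyc (cut_last F) x / of_nat (length (concat x)))"
proof (rule word_multilinearI)
  have cut_add: "cut_last F (uss @ (us @ (a + b) # vs) # wss)
      = cut_last F (uss @ (us @ a # vs) # wss) + cut_last F (uss @ (us @ b # vs) # wss)"
    and cut_scale: "cut_last F (uss @ (us @ (c *\<^sub>C a) # vs) # wss) = c * cut_last F (uss @ (us @ a # vs) # wss)"
    for uss us a b c vs wss
  proof -
    have len: "length (last (uss @ (us @ a # vs) # wss)) = length (last (uss @ (us @ b # vs) # wss))" for a b
      by simp
    have slot: "F (drop l (last (uss @ (us @ (a + b) # vs) # wss))
      # butlast (uss @ (us @ (a + b) # vs) # wss) @ [take l (last (uss @ (us @ (a + b) # vs) # wss))])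
      = F (drop l (last (uss @ (us @ a # vs) # wss))
      # butlast (uss @ (us @ a # vs) # wss) @ [take l (last (uss @ (us @ a # vs) # wss))])
      + F (drop l (last (uss @ (us @ b # vs) # wss))
      # butlast (uss @ (us @ b # vs) # wss) @ [take l (last (uss @ (us @ b # vs) # wss))])"
      "F (drop l (last (uss @ (us @ (c *\<^sub>C a) # vs) # wss))
      # butlast (uss @ (us @ (c *\<^sub>C a) # vs) # wss) @ [take l (last (uss @ (us @ (c *\<^sub>C a) # vs) # wss))])
      = c * F (drop l (last (uss @ (us @ a # vs) # wss))
      # butlast (uss @ (us @ a # vs) # wss) @ [take l (last (uss @ (us @ a # vs) # wss))])" for l
      using cut_last_slot[of l uss us vs wss] word_multilinearD(1,2)[OF F] by metis+
    show "cut_last F (uss @ (us @ (a + b) # vs) # wss)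
      = cut_last F (uss @ (us @ a # vs) # wss) + cut_last F (uss @ (us @ b # vs) # wss)"
      unfolding cut_last_def len[of "a + b" a] len[of b a] by (simp only: slot sum.distrib)
    show "cut_last F (uss @ (us @ (c *\<^sub>C a) # vs) # wss) = c * cut_last F (uss @ (us @ a # vs) # wss)"
      unfolding cut_last_def len[of "c *\<^sub>C a" a] by (simp only: slot sum_distrib_left)
  qed
  fix uss us wss and a b :: 'a and vs c
  have rot_add: "cut_last F (rotate k (uss @ (us @ (a + b) # vs) # wss))
      = cut_last F (rotate k (uss @ (us @ a # vs) # wss)) + cut_last F (rotate k (uss @ (us @ b # vs) # wss))"
    and rot_scale: "cut_last F (rotate k (uss @ (us @ (c *\<^sub>C a) # vs) # wss))
      = c * cut_last F (rotate k (uss @ (us @ a # vs) # wss))" for k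
    using rotate_slot[of k uss wss] cut_add cut_scale by metis+
  show "cyc (cut_last F) (uss @ (us @ (a + b) # vs) # wss) / of_nat (length (concat (uss @ (us @ (a + b) # vs) # wss)))
      = cyc (cut_last F) (uss @ (us @ a # vs) # wss) / of_nat (length (concat (uss @ (us @ a # vs) # wss)))
      + cyc (cut_last F) (uss @ (us @ b # vs) # wss) / of_nat (length (concat (uss @ (us @ b # vs) # wss)))"
    by (simp add: cyc_def rot_add sum.distrib distrib_left add_divide_distrib)
  show "cyc (cut_last F) (uss @ (us @ (c *\<^sub>C a) # vs) # wss) / of_nat (length (concat (uss @ (us @ (c *\<^sub>C a) # vs) # wss)))
      = c * (cyc (cut_last F) (uss @ (us @ a # vs) # wss) / of_nat (length (concat (uss @ (us @ a # vs) # wss))))"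
    by (simp add: cyc_def rot_scale sum_distrib_left distrib_left mult_ac)
next
  fix x :: "'a list list"
  let ?m = "real (length (concat x))" and ?P = "K * word_norm (concat x)"
  have "cmod (cyc (cut_last F) x) \<le> (\<Sum>k<length x. real (length (last (rotate k x))) * ?P)"
    unfolding cyc_def
  proof (rule sum_norm_le)
    fix k assume k: "k \<in> {..<length x}"
    then have "rotate k x \<noteq> []" by auto
    from cut_last_bound[OF F this]
    show "cmod ((- 1) ^ ((length x - 1) * k) * cut_last F (rotate k x)) \<le> real (length (last (rotate k x))) * ?P"
      by (simp add: norm_mult norm_power word_norm_concat_rotate)
  qed
  also have "\<dots> = ?m * ?P"
    by (simp only: sum_distrib_right[symmetric] of_nat_sum[symmetric] sum_length_last_rotate)
  finally have le: "cmod (cyc (cut_last F) x) \<le> ?m * ?P" .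
  have "0 \<le> ?P" by (rule order_trans[OF norm_ge_zero word_multilinearD(3)[OF F]])
  then show "cmod (cyc (cut_last F) x / of_nat (length (concat x))) \<le> ?P"
    using le by (cases "?m = 0") (auto simp: norm_divide field_simps)
qed

text \<open>Faces preserve the number of letters, so a factor depending on that number alone is
  constant here. This makes averaging compatible with the coboundary.\<close>

lemma word_coboundary_cong:
  assumes "\<And>z. length z = length x - 1 \<Longrightarrow> length (concat z) = length (concat x) \<Longrightarrow> F z = G z"
    and x: "length x \<ge> 2"
  shows "word_coboundary F x = word_coboundary G x"
proof -
  have len: "length x = Suc (Suc (length x - 2))" using x by simp
  have "length (concat (wrap x)) = length (concat x)"
    unfolding wrap_eq_merge[OF len] using len by (subst concat_merge) auto
  then have "F (wrap x) = G (wrap x)" using assms by simp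
  moreover have "F (merge_at j x) = G (merge_at j x)" if "j \<in> {1..length x - 1}" for j
    using that x by (intro assms) (auto simp: concat_merge)
  ultimately show ?thesis
    unfolding word_coboundary_def by (intro arg_cong2[where f = "(+)"] sum.cong) simp_all
qed

lemma word_coboundary_divide: "word_coboundary (\<lambda>z. F z / c) x = word_coboundary F x / c"
  by (simp add: word_coboundary_def add_divide_distrib sum_divide_distrib)

lemma length_concat_eq_0: "length (concat x) = 0 \<Longrightarrow> x = replicate (length x) []"
  by (induction x) auto

text \<open>The empty word is the unit, so this is the chain of \<open>n + 1\<close> units.\<close>

definition unit_chain :: "nat \<Rightarrow> 'v :: complex_banach tensor_algebra ptensor" where
  "unit_chain n = tensor (map word (replicate (Suc n) []))"

text \<open>The tuple is fixed by rotation while the sign is -1. Cochains rather than cocycles are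
  treated because primitives of coboundaries are also evaluated here.\<close>

lemma cyclic_cochain_unit_chain:
  assumes T: "T \<in> cyclic_cochains n" and "odd n"
  shows "T (unit_chain n) = 0"
proof -
  let ?E = "replicate (Suc n) []"
  have "rotate1 ?E = ?E" by (rule rotate1_replicate)
  then have "word_values n T ?E = (- 1) ^ n * word_values n T ?E"
    using T unfolding cyclic_cochains_iff by (metis length_replicate)
  then show ?thesis using \<open>odd n\<close> by (simp add: unit_chain_def word_values_eq)
qed

lemma cyclic_cocycles_word_coboundary:
  assumes "T \<in> cyclic_cocycles n" "length z = n + 2"
  shows "word_coboundary (word_values n T) z = 0"
proof -
  have "hochschild_coboundary n T (tensor (map word z)) = 0" "T \<in> hochschild_cochains n"
    using assms by (auto simp: cyclic_cocycles_def cyclic_cochains_def)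
  then show ?thesis using hochschild_coboundary_words[OF _ assms(2)] by simp
qed

lemma cyclic_cocycle_coboundary:
  fixes T :: "'v :: complex_banach tensor_algebra cochain"
  assumes T: "T \<in> cyclic_cocycles (Suc p)" and unit: "T (unit_chain (Suc p)) = 0"
  shows "T \<in> cyclic_coboundaries (Suc p)"
proof -
  have T': "T \<in> cyclic_cochains (Suc p)" "T \<in> hochschild_cochains (Suc p)"
    using T by (auto simp: cyclic_cocycles_def cyclic_cochains_def)
  let ?F = "word_values (Suc p) T"
  let ?S = "\<lambda>x. cyc (cut_last ?F) x / of_nat (length (concat x))"
  obtain K where "word_multilinear K ?F" using word_multilinear_word_values[OF T'(2)] by blast
  then obtain S where S: "S \<in> hochschild_cochains p"
      "\<And>ws. length ws = Suc p \<Longrightarrow> S (tensor (map word ws)) = ?S ws"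
    using ex_cochain_word_values[OF word_multilinear_cyc_cut_last] by blast
  have "S \<in> cyclic_cochains p"
    using S by (simp add: cyclic_cochains_iff word_values_eq cyc_rotate1 del: length_concat)
  moreover have "hochschild_coboundary p S = T"
  proof (rule cochain_eqI[OF hochschild_coboundary_in[OF S(1)] T'(2)])
    fix ws :: "'v list list" assume ws: "length ws = Suc (Suc p)"
    let ?m = "length (concat ws)"
    have "hochschild_coboundary p S (tensor (map word ws)) = word_coboundary (word_values p S) ws"
      by (rule hochschild_coboundary_words[OF S(1)]) (simp add: ws)
    also have "\<dots> = word_coboundary (\<lambda>z. cyc (cut_last ?F) z / of_nat ?m) ws"
      by (rule word_coboundary_cong) (simp_all add: ws word_values_eq S(2) del: length_concat)
    also have "\<dots> = of_nat ?m * ?F ws / of_nat ?m"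
      unfolding word_coboundary_divide
      by (subst cyc_coboundary_cut_last[OF _ _ ws])
         (use cyclic_cocycles_word_coboundary[OF T] T'(1) in \<open>simp_all add: cyclic_cochains_iff del: length_concat\<close>)
    also have "\<dots> = T (tensor (map word ws))"
    \<comment> \<open>Without letters the quotient is 0 by convention, and \<open>unit\<close> says
      that \<open>T\<close> vanishes there too.\<close>
    proof (cases "?m = 0")
      case True
      then show ?thesis using unit length_concat_eq_0[OF True] ws by (simp add: unit_chain_def)
    qed (simp add: word_values_eq ws del: length_concat)
    finally show "hochschild_coboundary p S (tensor (map word ws)) = T (tensor (map word ws))" .
  qed
  ultimately show ?thesis by (auto simp: cyclic_coboundaries_def)
qed

text \<open>All faces of the tuple of units are tuples of units in the odd degree \<open>p\<close>,
  where the primitive vanishes. Hence evaluation at \<open>unit_chain\<close> descends to cohomology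
  in positive even degree.\<close>

lemma cyclic_coboundary_unit_chain:
  fixes T :: "'v :: complex_banach tensor_algebra cochain"
  assumes T: "T \<in> cyclic_coboundaries (Suc p)" and p: "odd p"
  shows "T (unit_chain (Suc p)) = 0"
proof -
  obtain S where S: "S \<in> cyclic_cochains p" and T_eq: "T = hochschild_coboundary p S"
    using T by (auto simp: cyclic_coboundaries_def)
  then have S': "S \<in> hochschild_cochains p" by (simp add: cyclic_cochains_def)
  have "T (unit_chain (Suc p)) = word_coboundary (word_values p S) (replicate (Suc (Suc p)) [])"
    unfolding T_eq unit_chain_def by (rule hochschild_coboundary_words[OF S']) simp
  also have "\<dots> = word_coboundary (\<lambda>_. 0) (replicate (Suc (Suc p)) ([] :: 'v list))"
  proof (rule word_coboundary_cong)
    fix z :: "'v list list"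
    assume z: "length z = length (replicate (Suc (Suc p)) []) - 1"
      "length (concat z) = length (concat (replicate (Suc (Suc p)) []))"
    then have len: "length z = Suc p" and "length (concat z) = 0" by (simp_all add: sum_list_replicate)
    then have "z = replicate (Suc p) []" using length_concat_eq_0[of z] by simp
    then show "word_values p S z = 0"
      using cyclic_cochain_unit_chain[OF S p] by (simp add: word_values_eq unit_chain_def)
  qed simp
  also have "\<dots> = 0" by (simp add: word_coboundary_def)
  finally show ?thesis .
qed

text \<open>The cocycle is the product of the degree 0 coefficients of its arguments, on words the
  indicator of tuples without letters. Its coboundary is a multiple of the alternating sum of
  \<open>n + 2\<close> signs, which is 0 for even \<open>n\<close>.\<close>

lemma ex_unit_cocycle:
  assumes n: "even n"
  obtains T :: "'v :: complex_banach tensor_algebra cochain" where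
    "T \<in> cyclic_cocycles n" "T (unit_chain n) = 1"
proof -
  let ?F = "\<lambda>ws :: 'v list list. if concat ws = [] then 1 else 0 :: complex"
  \<comment> \<open>Linearity concerns a letter, and every tuple that has one gets the value
    0.\<close>
  have "word_multilinear 1 ?F"
  proof (rule word_multilinearI)
    show "cmod (?F ws) \<le> 1 * word_norm (concat ws)" for ws
      by (cases "concat ws = []") (simp_all del: concat_eq_Nil_conv)
  qed simp_all
  then obtain T :: "'v tensor_algebra cochain" where T: "T \<in> hochschild_cochains n"
      "\<And>ws. length ws = Suc n \<Longrightarrow> T (tensor (map word ws)) = ?F ws"
    using ex_cochain_word_values by blast
  have empty: "concat (rotate1 ws) = [] \<longleftrightarrow> concat ws = []" for ws :: "'v list list"
    by (cases ws) auto
  have "T \<in> cyclic_cochains n"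
    using T n empty by (simp add: cyclic_cochains_iff word_values_eq)
  moreover have "hochschild_coboundary n T = (\<lambda>_. 0)"
  proof (rule cochain_eqI[OF hochschild_coboundary_in[OF T(1)]])
    show "(\<lambda>_. 0) \<in> hochschild_cochains (Suc n)" by (auto simp: hochschild_cochains_def intro: exI[of _ 0])
    fix ws :: "'v list list" assume ws: "length ws = Suc (Suc n)"
    have signs: "(\<Sum>j=1..Suc n. (- 1 :: complex) ^ j) = - 1"
      using n by (induction n rule: induct_nat_012) auto
    have "hochschild_coboundary n T (tensor (map word ws)) = word_coboundary (word_values n T) ws"
      by (rule hochschild_coboundary_words[OF T(1)]) (simp add: ws)
    also have "\<dots> = word_coboundary (\<lambda>_. ?F ws) ws"
    proof (rule word_coboundary_cong)
      fix z :: "'v list list" assume z: "length z = length ws - 1" "length (concat z) = length (concat ws)"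
      have "concat z = [] \<longleftrightarrow> concat ws = []" using z(2) by (metis length_0_conv)
      then show "word_values n T z = ?F ws" using z(1) ws by (simp add: word_values_eq T(2))
    qed (simp add: ws)
    also have "\<dots> = ?F ws * (1 + (\<Sum>j=1..Suc n. (- 1) ^ j))"
      unfolding word_coboundary_def ws by (simp add: sum_distrib_left mult.commute algebra_simps)
    finally show "hochschild_coboundary n T (tensor (map word ws)) = 0" by (simp only: signs) simp
  qed
  moreover have "T (unit_chain n) = 1" using T(2)[of "replicate (Suc n) []"] by (simp add: unit_chain_def)
  ultimately show ?thesis by (intro that[of T]) (simp_all add: cyclic_cocycles_def)
qed

section \<open>Passage to cohomology classes\<close>

lemma hochschild_coboundary_linear:
  "hochschild_coboundary n (\<lambda>x. S x + c * T x) =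
     (\<lambda>x. hochschild_coboundary n S x + c * hochschild_coboundary n T x)"
  by (auto simp: hochschild_coboundary_def)

lemma cyclic_cocycles_linear:
  assumes "S \<in> cyclic_cocycles n" "T \<in> cyclic_cocycles n"
  shows "(\<lambda>x. S x + c * T x) \<in> cyclic_cocycles n"
  using assms hochschild_cochains_linear[of S n T c]
  by (simp add: cyclic_cocycles_def cyclic_cochains_def hochschild_coboundary_linear)

lemma cyclic_coboundaries_linear:
  assumes "S \<in> cyclic_coboundaries n" "T \<in> cyclic_coboundaries n"
  shows "(\<lambda>x. S x + c * T x) \<in> cyclic_coboundaries n"
proof (cases n)
  case (Suc m)
  obtain S' T' where *: "S' \<in> cyclic_cochains m" "S = hochschild_coboundary m S'"
      "T' \<in> cyclic_cochains m" "T = hochschild_coboundary m T'"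
    using assms by (auto simp: cyclic_coboundaries_def Suc)
  have "(\<lambda>x. S' x + c * T' x) \<in> cyclic_cochains m"
    using * hochschild_cochains_linear[of S' m T' c] by (simp add: cyclic_cochains_def)
  moreover have "(\<lambda>x. S x + c * T x) = hochschild_coboundary m (\<lambda>x. S' x + c * T' x)"
    by (simp add: * hochschild_coboundary_linear)
  ultimately show ?thesis by (simp add: cyclic_coboundaries_def Suc)
qed (use assms in \<open>simp add: cyclic_coboundaries_def\<close>)

lemma zero_in_cyclic_cocycles: "(\<lambda>_. 0) \<in> cyclic_cocycles n"
  by (auto simp: cyclic_cocycles_def cyclic_cochains_def hochschild_cochains_def hochschild_coboundary_def
      intro: exI[of _ 0])

lemma zero_in_cyclic_coboundaries: "(\<lambda>_. 0) \<in> cyclic_coboundaries n"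
proof (cases n)
  case (Suc m)
  have "(\<lambda>_. 0) \<in> cyclic_cochains m" using zero_in_cyclic_cocycles by (auto simp: cyclic_cocycles_def)
  moreover have "(\<lambda>_. 0) = hochschild_coboundary m (\<lambda>_. 0)" by (auto simp: hochschild_coboundary_def)
  ultimately show ?thesis unfolding cyclic_coboundaries_def Suc by (simp add: image_iff) blast
qed (simp add: cyclic_coboundaries_def)

lemma cyclic_class_eqI:
  assumes D: "(\<lambda>x. T x + (- 1) * T' x) \<in> cyclic_coboundaries n"
  shows "cyclic_class n T = cyclic_class n T'"
proof -
  have "\<exists>S'. U = (\<lambda>x. T' x + S' x) \<and> S' \<in> cyclic_coboundaries n"
    if "S \<in> cyclic_coboundaries n" "U = (\<lambda>x. T x + S x)" for U S
    using cyclic_coboundaries_linear[OF D that(1), of 1]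
    by (intro exI[of _ "\<lambda>x. (T x + (- 1) * T' x) + 1 * S x"]) (auto simp: that(2))
  moreover have "\<exists>S'. U = (\<lambda>x. T x + S' x) \<and> S' \<in> cyclic_coboundaries n"
    if "S \<in> cyclic_coboundaries n" "U = (\<lambda>x. T' x + S x)" for U S
    using cyclic_coboundaries_linear[OF that(1) D, of "- 1"]
    by (intro exI[of _ "\<lambda>x. S x + (- 1) * (T x + (- 1) * T' x)"]) (auto simp: that(2))
  ultimately show ?thesis unfolding cyclic_class_def by blast
qed

theorem theorem7p2:
  shows "(\<forall>n. odd n \<longrightarrow>
      (cyclic_cohomology n :: 'v :: complex_banach tensor_algebra cochain set set)
        = {cyclic_class n (\<lambda>_. 0)}) \<and>
    (\<forall>n>0. even n \<longrightarrow>
      (\<exists>\<Phi> :: 'v tensor_algebra cochain set \<Rightarrow> complex.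
         bij_betw \<Phi> (cyclic_cohomology n) UNIV \<and>
         (\<forall>P\<in>cyclic_cohomology n. \<forall>Q\<in>cyclic_cohomology n. \<Phi> (class_add P Q) = \<Phi> P + \<Phi> Q) \<and>
         (\<forall>c. \<forall>P\<in>cyclic_cohomology n. \<Phi> (class_scale n c P) = c * \<Phi> P)))"
proof (intro conjI allI impI)
  fix n :: nat assume "odd n"
  then obtain p where n: "n = Suc p" by (cases n) auto
  have "cyclic_class n T = cyclic_class n (\<lambda>_. 0)" if "T \<in> cyclic_cocycles n" for T :: "'v tensor_algebra cochain"
  proof (rule cyclic_class_eqI)
    have "T (unit_chain n) = 0"
      using that cyclic_cochain_unit_chain \<open>odd n\<close> by (auto simp: cyclic_cocycles_def)
    then have "T \<in> cyclic_coboundaries n"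
      using cyclic_cocycle_coboundary that unfolding n by blast
    then show "(\<lambda>x. T x + - 1 * 0) \<in> cyclic_coboundaries n" by simp
  qed
  then show "cyclic_cohomology n = {cyclic_class n (\<lambda>_. 0 :: complex) :: 'v tensor_algebra cochain set}"
    unfolding cyclic_cohomology_def using zero_in_cyclic_cocycles by blast
next
  fix n :: nat assume "0 < n" "even n"
  then obtain p where n: "n = Suc p" "odd p" by (cases n) auto
  let ?E = "unit_chain n :: 'v tensor_algebra ptensor"
  \<comment> \<open>The choice of representative is harmless: on a class all of them agree at
    \<open>?E\<close>, since coboundaries vanish there.\<close>
  define \<Phi> where "\<Phi> P = (SOME T. T \<in> P) ?E" for P :: "'v tensor_algebra cochain set"
  have \<Phi>I: "\<Phi> P = v" if "P \<noteq> {}" "\<And>T. T \<in> P \<Longrightarrow> T ?E = v" for P v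
    using that some_in_eq unfolding \<Phi>_def by blast
  have B: "S ?E = 0" if "S \<in> cyclic_coboundaries n" for S
    using cyclic_coboundary_unit_chain that n by blast
  have ne: "cyclic_class n T \<noteq> {}" for T :: "'v tensor_algebra cochain"
    unfolding cyclic_class_def using zero_in_cyclic_coboundaries by blast
  have val: "S ?E = T ?E" if "S \<in> cyclic_class n T" for S T
    using that B by (auto simp: cyclic_class_def)
  have \<Phi>_class: "\<Phi> (cyclic_class n T) = T ?E" for T
    by (rule \<Phi>I[OF ne]) (rule val)
  have "bij_betw \<Phi> (cyclic_cohomology n) UNIV"
    unfolding bij_betw_def
  proof
    show "inj_on \<Phi> (cyclic_cohomology n)"
    proof (rule inj_onI)
      fix P Q :: "'v tensor_algebra cochain set"
      assume "P \<in> cyclic_cohomology n" "Q \<in> cyclic_cohomology n" and eq: "\<Phi> P = \<Phi> Q"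
      then obtain S T where S: "S \<in> cyclic_cocycles n" "P = cyclic_class n S"
        and T: "T \<in> cyclic_cocycles n" "Q = cyclic_class n T"
        by (auto simp: cyclic_cohomology_def)
      \<comment> \<open>The difference is a cocycle that vanishes on the units, hence a
        coboundary.\<close>
      have "(\<lambda>x. S x + (- 1) * T x) \<in> cyclic_coboundaries n"
        unfolding n by (rule cyclic_cocycle_coboundary)
          (use cyclic_cocycles_linear[OF S(1) T(1), of "- 1"] eq in \<open>simp_all add: S T \<Phi>_class flip: n(1)\<close>)
      then show "P = Q" unfolding S T by (rule cyclic_class_eqI)
    qed
    obtain T0 :: "'v tensor_algebra cochain" where T0: "T0 \<in> cyclic_cocycles n" "T0 ?E = 1"
      using ex_unit_cocycle[OF \<open>even n\<close>] by blast
    have "c \<in> \<Phi> ` cyclic_cohomology n" for c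
    proof -
      have "(\<lambda>x. 0 + c * T0 x) \<in> cyclic_cocycles n"
        by (rule cyclic_cocycles_linear[OF zero_in_cyclic_cocycles T0(1)])
      moreover have "\<Phi> (cyclic_class n (\<lambda>x. 0 + c * T0 x)) = c" by (simp add: \<Phi>_class T0)
      ultimately show ?thesis unfolding cyclic_cohomology_def by (metis imageI)
    qed
    then show "\<Phi> ` cyclic_cohomology n = UNIV" by blast
  qed
  moreover have "\<Phi> (class_add P Q) = \<Phi> P + \<Phi> Q" if in_cohomology: "P \<in> cyclic_cohomology n" "Q \<in> cyclic_cohomology n"
    for P Q :: "'v tensor_algebra cochain set"
  proof -
    obtain S T where PQ: "P = cyclic_class n S" "Q = cyclic_class n T"
      using in_cohomology by (auto simp: cyclic_cohomology_def)
    have "\<Phi> (class_add P Q) = S ?E + T ?E"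
    proof (rule \<Phi>I)
      show "class_add P Q \<noteq> {}" using ne[of S] ne[of T] unfolding class_add_def PQ by blast
    qed (auto simp: class_add_def PQ val)
    then show ?thesis by (simp add: PQ \<Phi>_class)
  qed
  moreover have "\<Phi> (class_scale n c P) = c * \<Phi> P" if in_cohomology: "P \<in> cyclic_cohomology n"
    for c and P :: "'v tensor_algebra cochain set"
  proof -
    obtain T where P: "P = cyclic_class n T" using in_cohomology by (auto simp: cyclic_cohomology_def)
    have "\<Phi> (class_scale n c P) = c * T ?E"
    proof (rule \<Phi>I)
      show "class_scale n c P \<noteq> {}"
        using ne[of T] zero_in_cyclic_coboundaries unfolding class_scale_def P by blast
    qed (auto simp: class_scale_def P val B)
    then show ?thesis by (simp add: P \<Phi>_class)
  qed
  ultimately show "\<exists>\<Phi> :: 'v tensor_algebra cochain set \<Rightarrow> complex.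
         bij_betw \<Phi> (cyclic_cohomology n) UNIV \<and>
         (\<forall>P\<in>cyclic_cohomology n. \<forall>Q\<in>cyclic_cohomology n. \<Phi> (class_add P Q) = \<Phi> P + \<Phi> Q) \<and>
         (\<forall>c. \<forall>P\<in>cyclic_cohomology n. \<Phi> (class_scale n c P) = c * \<Phi> P)"
    by blast
qed

end
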